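(* Suppose $p\ge 1$ (with $p<\infty$) and $\alpha$ is real. Let $\gamma$ and $\lambda$ be complex parameters satisfying the following two conditions: (a) $p(\mathrm{Re}\,\gamma+1)>\mathrm{Re}\,\lambda+1$; (b) $n+\gamma+(\alpha-\lambda)/p$ is not a negative integer. Then a holomorphic function $f$ in $\mathbb B_n$ belongs to $A^p_\alpha$ if and only if $$f(z)=\int_{\mathbb B_n}\frac{g(w)\,dv_\gamma(w)}{(1-\langle z,w\rangle)^{n+1+\gamma+(\alpha-\lambda)/p}},\qquad z\in\mathbb B_n,$$ for some $g\in L^p(\mathbb B_n,dv_\lambda)$.
   Context: Fix a positive integer $n$. $\mathbb B_n=\{z\in\mathbb C^n:|z|<1\}$, $\langle z,w\rangle=\sum_{j=1}^n z_j\overline{w_j}$, $H(\mathbb B_n)$ is the space of holomorphic functions in $\mathbb B_n$, and $dv$ is volume measure on $\mathbb B_n$. For a parameter $\alpha$ (real or complex), $dv_\alpha(z)=(1-|z|^2)^\alpha\,dv(z)$ (for real $\alpha>-1$ it is normalized by a positive constant to be a probability measure). For complex $\lambda$, $L^p(\mathbb B_n,dv_\lambda)$ means the measurable $g$ with $\int_{\mathbb B_n}|g(z)|^p(1-|z|^2)^{\mathrm{Re}\,\lambda}\,dv(z)<\infty$. Powers of $1-\langle z,w\rangle$ are taken with the principal branch. The radial derivative is $Rf(z)=\sum_{k=1}^n z_k\frac{\partial f}{\partial z_k}(z)$, $R^k$ is its $k$-fold iterate, $R^0f=f$. For $p>0$ and real $\alpha$, $A^p_\alpha$ is the space of $f\in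 H(\mathbb B_n)$ such that, for a nonnegative integer $k$ with $pk+\alpha>-1$, the function $(1-|z|^2)^kR^kf(z)$ belongs to $L^p(\mathbb B_n,dv_\alpha)$; this does not depend on the choice of such $k$. *)

theory Defs
  imports "HOL-Complex_Analysis.Complex_Analysis"
begin

text \<open>
  The space \<open>\<complex>\<^sup>n\<close> is \<^typ>\<open>complex ^ 'n\<close> with \<open>n = CARD('n)\<close>; its library norm is the
  usual Euclidean norm, and \<^term>\<open>lebesgue\<close> on it is volume measure on \<open>\<complex>\<^sup>n = \<real>\<^bsup>2n\<^esup>\<close>.
\<close>

abbreviation unit_ball :: "(complex ^ 'n) set" (\<open>\<B>\<close>)
  where "\<B> \<equiv> ball 0 1"

text \<open>The library inner product on \<^typ>\<open>complex ^ 'n\<close> is only the real part of this one.\<close>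

definition herm :: "complex ^ 'n \<Rightarrow> complex ^ 'n \<Rightarrow> complex"
  where "herm z w = (\<Sum>j\<in>UNIV. z $ j * cnj (w $ j))"

text \<open>Holomorphy in several variables: the real Frechet derivative exists and is complex linear.\<close>

definition holomorphic_sev_on :: "(complex ^ 'n \<Rightarrow> complex) \<Rightarrow> (complex ^ 'n) set \<Rightarrow> bool"
    (infix \<open>holomorphic'_sev'_on\<close> 50)
  where "f holomorphic_sev_on S \<longleftrightarrow>
    (\<forall>z\<in>S. \<exists>D. (f has_derivative D) (at z) \<and> (\<forall>c v. D (c *s v) = c * D v))"

definition partial_deriv :: "'n \<Rightarrow> (complex ^ 'n \<Rightarrow> complex) \<Rightarrow> complex ^ 'n \<Rightarrow> complex"
  where "partial_deriv k f z = deriv (\<lambda>t. f (z + axis k t)) 0"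

definition radial_deriv :: "(complex ^ 'n \<Rightarrow> complex) \<Rightarrow> complex ^ 'n \<Rightarrow> complex"
  where "radial_deriv f z = (\<Sum>k\<in>UNIV. z $ k * partial_deriv k f z)"

text \<open>
  The density of \<open>dv\<^sub>\<gamma>\<close> with respect to volume measure. The normalizing constant makes
  \<open>dv\<^sub>\<gamma>\<close> a probability measure when \<open>\<gamma>\<close> is real and greater than \<open>-1\<close>; it is 1 otherwise.
\<close>

definition dv_const :: "(complex ^ 'n) itself \<Rightarrow> complex \<Rightarrow> real"
  where "dv_const _ \<gamma> =
    (if \<gamma> \<in> \<real> \<and> Re \<gamma> > -1
     then 1 / (LINT w|lebesgue_on (\<B> :: (complex ^ 'n) set). (1 - (norm w)\<^sup>2) powr Re \<gamma>)
     else 1)"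

definition dv_density :: "complex \<Rightarrow> complex ^ 'n \<Rightarrow> complex"
  where "dv_density \<gamma> w =
    of_real (dv_const TYPE(complex ^ 'n) \<gamma>) * of_real (1 - (norm w)\<^sup>2) powr \<gamma>"

text \<open>
  \<open>L\<^sup>p(\<B>, dv\<^sub>\<lambda>)\<close> with \<open>\<lambda> = lam\<close>, as functions rather than classes modulo null sets. The positive
  normalizing constant is immaterial for finiteness of the integral.
\<close>

definition Lp_ball :: "real \<Rightarrow> complex \<Rightarrow> (complex ^ 'n \<Rightarrow> complex) set"
  where "Lp_ball p lam =
    {g. g \<in> borel_measurable (lebesgue_on \<B>) \<and>
        integrable (lebesgue_on \<B>) (\<lambda>z. norm (g z) powr p * (1 - (norm z)\<^sup>2) powr Re lam)}"

definition bergman_space :: "real \<Rightarrow> real \<Rightarrow> (complex ^ 'n \<Rightarrow> complex) set"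
  where "bergman_space p \<alpha> =
    {f. f holomorphic_sev_on \<B> \<and>
        (\<exists>k::nat. p * real k + \<alpha> > -1 \<and>
          (\<lambda>z. of_real ((1 - (norm z)\<^sup>2) ^ k) * (radial_deriv ^^ k) f z)
            \<in> Lp_ball p (of_real \<alpha>))}"

end

theory Submission
  imports Defs
begin

text \<open>
  Write \<open>\<rho>(w) = 1 - |w|\<^sup>2\<close>, \<open>\<beta> = \<gamma> + (\<alpha> - \<lambda>) / p\<close> and \<open>\<sigma> = n + 1 + \<beta>\<close>; the theorem concerns kernel integrals
  \<open>\<integral> g(w) \<rho>(w) powr \<gamma> (1 - \<langle>z, w\<rangle>) powr -\<sigma> dv(w)\<close>. A holomorphic function is studied through its slices
  \<open>t \<mapsto> f (t z)\<close>, whose Taylor coefficients are the homogeneous parts of \<open>f\<close>. On them the radial derivative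
  multiplies by the degree \<open>m\<close>, and kernel integrals of a holomorphic function against a power of \<open>\<rho>\<close> are
  diagonal as well.

  The last fact is \<open>kernel_integral_sums\<close>. It rests on the moments \<open>\<integral> F \<langle>z, w\<rangle>\<^sup>m \<rho> powr b\<close> computed in
  \<open>moment_formula\<close>. The integral of a directional derivative of a compactly supported function is zero, so a
  factor \<open>\<langle>z, w\<rangle>\<close> can be exchanged for a derivative of \<open>F\<close> in direction \<open>z\<close> at the expense of raising the
  exponent of the weight by 1. After \<open>m\<close> exchanges the mean value property of holomorphic functions finishes
  the computation. The mean value property and the dependence of the total mass on \<open>b\<close> are themselves
  integrations by parts, along the fields \<open>w \<mapsto> \<i> w\<close> and \<open>w \<mapsto> w\<close>. In particular
  the reproducing formula holds for complex exponents \<open>b\<close>, and the series for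
  \<open>\<integral> \<rho> powr t |1 - \<langle>z, w\<rangle>| powr -(n + 1 + t + c)\<close> yields the estimate \<open>forelli_rudin\<close>.

  If \<open>f\<close> is a kernel integral, the radial derivative of order \<open>k\<close> falls on the kernel and raises its exponent
  by \<open>k\<close>. The resulting positive operator is bounded on \<open>L\<^sup>p\<close> by a Schur test whose test function is a
  power of \<open>\<rho>\<close>; condition (a) and \<open>p k + \<alpha> > -1\<close> are what the choice of that power requires. This shows that \<open>f\<close> lies in the
  Bergman space.

  Conversely, let \<open>f\<close> be in the space. The same operator bound, applied to the reproducing formula for the
  radial derivative of order \<open>k\<close>, together with a growth estimate for the lower derivatives, shows that the
  radial derivatives of all orders up to \<open>N\<close>, times \<open>\<rho> powr N\<close>, are in \<open>L\<^sup>p(dv\<^sub>\<alpha>)\<close> once \<open>N\<close> is large.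
  Let \<open>G\<close> be the polynomial \<open>(\<sigma> + R)\<^sub>N\<close> in the radial derivative \<open>R\<close>, applied to \<open>f\<close>. By
  \<open>kernel_integral_sums\<close> with \<open>b = \<beta> + N\<close> the kernel integral of \<open>G \<rho> powr b\<close> is a constant multiple of \<open>f\<close>, with
  the constant \<open>(\<sigma>)\<^sub>N\<close> times a mass. Neither factor vanishes, the first by condition (b) and the second by
  \<open>bmass_nonzero\<close>. Hence \<open>g = const G \<rho> powr (b - \<gamma>)\<close> represents \<open>f\<close>.
\<close>

section \<open>The Hermitian form\<close>

lemma norm_vector_cmult: "norm (c *s (v :: complex ^ 'n)) = norm c * norm v"
  by (simp add: norm_vec_def norm_mult L2_set_right_distrib)

lemma of_real_vector_cmult: "complex_of_real r *s v = r *\<^sub>R v"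
  by (simp add: vec_eq_iff complex_eq_iff)

lemma bounded_linear_vector_cmult: "bounded_linear (\<lambda>v :: complex ^ 'n. c *s v)"
  by (rule bounded_linear_intro[where K = "norm c"])
     (auto simp: vec_eq_iff algebra_simps norm_vector_cmult)

lemma bounded_linear_vector_cmult_left: "bounded_linear (\<lambda>c. c *s (v :: complex ^ 'n))"
  by (rule bounded_linear_intro[where K = "norm v"])
     (auto simp: vec_eq_iff algebra_simps norm_vector_cmult)

lemma continuous_on_vector_cmult [continuous_intros]:
  assumes "continuous_on S f" "continuous_on S g"
  shows "continuous_on S (\<lambda>x. f x *s (g x :: complex ^ 'n))"
proof -
  have "(\<lambda>x. f x *s g x) = (\<lambda>x. \<chi> i. f x * g x $ i)" by (auto simp: vec_eq_iff)
  then show ?thesis using assms by (simp only:) (intro continuous_intros)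
qed

lemma herm_add_left: "herm (x + y) w = herm x w + herm y w"
  by (simp add: herm_def sum.distrib algebra_simps)

lemma herm_add_right: "herm w (x + y) = herm w x + herm w y"
  by (simp add: herm_def sum.distrib algebra_simps)

lemma herm_cmult_left: "herm (c *s z) w = c * herm z w"
  by (simp add: herm_def sum_distrib_left algebra_simps)

lemma herm_cmult_right: "herm z (c *s w) = cnj c * herm z w"
  by (simp add: herm_def sum_distrib_left algebra_simps)

lemma cnj_herm: "cnj (herm z w) = herm w z"
  by (simp add: herm_def algebra_simps)

lemma herm_zero [simp]: "herm 0 w = 0" "herm z 0 = 0"
  by (simp_all add: herm_def)

lemma Re_herm: "Re (herm z w) = inner z w"
  by (simp add: herm_def inner_vec_def inner_complex_def)

lemma herm_self: "herm z z = of_real ((norm z)\<^sup>2)"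
proof -
  have "Im (herm z z) = 0" by (simp add: herm_def)
  moreover have "Re (herm z z) = (norm z)\<^sup>2" by (simp add: Re_herm power2_norm_eq_inner)
  ultimately show ?thesis by (simp add: complex_eq_iff)
qed

text \<open>
  Multiplication by \<open>\<i>\<close> is a tangential field on spheres, and it has trace zero; both facts are
  instances of this identity.
\<close>

lemma inner_imag_mult_self: "inner (\<i> *s (v :: complex ^ 'n)) v = 0"
  by (simp add: Re_herm[symmetric] herm_cmult_left herm_self)

lemma norm_herm_le: "norm (herm z w) \<le> norm z * norm w"
proof (cases "herm z w = 0")
  case False
  define c where "c = cnj (sgn (herm z w))"
  have c: "norm c = 1" using False by (simp add: c_def norm_sgn)
  have "c * herm z w = of_real (norm (herm z w))"
    using False by (simp add: c_def sgn_eq complex_norm_square[symmetric] power2_eq_square field_simps)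
  then have "norm (herm z w) = Re (herm (c *s z) w)" by (simp add: herm_cmult_left)
  also have "\<dots> \<le> norm (c *s z) * norm w" by (simp add: Re_herm norm_cauchy_schwarz)
  finally show ?thesis by (simp add: norm_vector_cmult c)
qed auto

lemma norm_herm_less_1:
  assumes "z \<in> \<B>" "w \<in> \<B>" shows "norm (herm z w) < 1"
proof -
  have "norm z * norm w < 1 * 1"
    by (rule mult_strict_mono') (use assms in auto)
  then show ?thesis using norm_herm_le[of z w] by linarith
qed

lemma herm_scaleR: "herm (r *\<^sub>R z) w = r *\<^sub>R herm z w" "herm z (r *\<^sub>R w) = r *\<^sub>R herm z w"
  by (simp_all only: of_real_vector_cmult[symmetric] herm_cmult_left herm_cmult_right
      complex_cnj_complex_of_real scaleR_conv_of_real)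

lemma bounded_linear_herm_right: "bounded_linear (herm z)"
  by (rule bounded_linear_intro[where K = "norm z"])
     (simp_all add: herm_add_right herm_scaleR, metis norm_herm_le mult.commute)

lemma bounded_linear_herm_left: "bounded_linear (\<lambda>z. herm z w)"
  by (rule bounded_linear_intro[where K = "norm w"])
     (simp_all add: herm_add_left herm_scaleR norm_herm_le)

lemma continuous_on_herm [continuous_intros]:
  "continuous_on S f \<Longrightarrow> continuous_on S g \<Longrightarrow> continuous_on S (\<lambda>x. herm (f x) (g x))"
  unfolding herm_def by (intro continuous_intros)

section \<open>Holomorphic functions of several variables\<close>

definition dirderiv :: "(complex ^ 'n \<Rightarrow> complex) \<Rightarrow> complex ^ 'n \<Rightarrow> complex ^ 'n \<Rightarrow> complex"
  where "dirderiv F v w = deriv (\<lambda>t. F (w + t *s v)) 0"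

lemma field_deriv_line:
  fixes F :: "complex ^ 'n \<Rightarrow> complex"
  assumes D: "(F has_derivative D) (at (w + t *s v))" "\<And>c v. D (c *s v) = c * D v"
  shows "((\<lambda>t. F (w + t *s v)) has_field_derivative D v) (at t)"
proof -
  have "((\<lambda>t. w + t *s v) has_derivative (\<lambda>t. t *s v)) (at t)"
    using has_derivative_add[OF has_derivative_const[where c = w]
        bounded_linear_imp_has_derivative[OF bounded_linear_vector_cmult_left[of v]]] by simp
  then have "((\<lambda>t. F (w + t *s v)) has_derivative (\<lambda>t. D (t *s v))) (at t)"
    using has_derivative_compose[of "\<lambda>t. w + t *s v" "\<lambda>t. t *s v" t UNIV F D] D by simp
  then show ?thesis
    by (simp add: has_field_derivative_def D(2) mult.commute[of _ "D v"])
qed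

lemma holomorphic_sev_dirderiv_eq:
  assumes "(F has_derivative D) (at w)" "\<And>c v. D (c *s v) = c * D v"
  shows "dirderiv F v w = D v"
  unfolding dirderiv_def
  by (rule DERIV_imp_deriv, rule field_deriv_line) (use assms in auto)

lemma holomorphic_sev_has_derivative:
  assumes "F holomorphic_sev_on S" "w \<in> S"
  shows "(F has_derivative (\<lambda>v. dirderiv F v w)) (at w)"
    and "dirderiv F (c *s v) w = c * dirderiv F v w"
proof -
  obtain D where D: "(F has_derivative D) (at w)" "\<And>c v. D (c *s v) = c * D v"
    using assms unfolding holomorphic_sev_on_def by blast
  have "(\<lambda>v. dirderiv F v w) = D" using holomorphic_sev_dirderiv_eq[OF D] by auto
  then show "(F has_derivative (\<lambda>v. dirderiv F v w)) (at w)"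
    "dirderiv F (c *s v) w = c * dirderiv F v w"
    using D by (auto simp: fun_eq_iff)
qed

lemma holomorphic_sev_onI:
  fixes F :: "complex ^ 'n \<Rightarrow> complex"
  assumes "\<And>w. w \<in> S \<Longrightarrow> (F has_derivative D w) (at w)"
    and "\<And>w v. w \<in> S \<Longrightarrow> D w (\<i> *s v) = \<i> * D w v"
  shows "F holomorphic_sev_on S"
  unfolding holomorphic_sev_on_def
proof (intro ballI exI conjI allI)
  fix w c and v :: "complex ^ 'n" assume w: "w \<in> S"
  show "(F has_derivative D w) (at w)" using assms(1)[OF w] .
  interpret bounded_linear "D w" using assms(1)[OF w] by (rule has_derivative_bounded_linear)
  have "c *s v = Re c *\<^sub>R v + Im c *\<^sub>R (\<i> *s v)"
    by (simp add: vec_eq_iff complex_eq_iff)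
  then have "D w (c *s v) = Re c *\<^sub>R D w v + Im c *\<^sub>R (\<i> * D w v)"
    by (simp only: add scaleR assms(2)[OF w])
  also have "\<dots> = c * D w v" by (simp add: complex_eq_iff)
  finally show "D w (c *s v) = c * D w v" .
qed

lemma holomorphic_sev_on_imp_continuous_on: "F holomorphic_sev_on S \<Longrightarrow> continuous_on S F"
  unfolding holomorphic_sev_on_def
  by (meson continuous_at_imp_continuous_on has_derivative_continuous)

lemma dirderiv_linear:
  assumes "F holomorphic_sev_on S" "w \<in> S"
  shows "linear (\<lambda>v. dirderiv F v w)"
  using has_derivative_linear[OF holomorphic_sev_has_derivative(1)[OF assms]] .

lemma holomorphic_sev_line:
  assumes "F holomorphic_sev_on S" "w + t *s v \<in> S"
  shows "((\<lambda>t. F (w + t *s v)) has_field_derivative dirderiv F v (w + t *s v)) (at t)"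
  by (rule field_deriv_line[OF holomorphic_sev_has_derivative[OF assms]])

lemma holomorphic_sev_line_holomorphic:
  assumes "F holomorphic_sev_on S" "\<And>t. t \<in> T \<Longrightarrow> w + t *s v \<in> S"
  shows "(\<lambda>t. F (w + t *s v)) holomorphic_on T"
  unfolding holomorphic_on_def field_differentiable_def
  using holomorphic_sev_line[OF assms(1)] assms(2) by (meson DERIV_subset subset_UNIV has_field_derivative_at_within)

lemma holomorphic_sev_on_const: "(\<lambda>_. c) holomorphic_sev_on S"
  by (rule holomorphic_sev_onI[where D = "\<lambda>_ _. 0"]) auto

lemma holomorphic_sev_on_add:
  assumes "F holomorphic_sev_on S" "G holomorphic_sev_on S"
  shows "(\<lambda>w. F w + G w) holomorphic_sev_on S"
  by (rule holomorphic_sev_onI[where D = "\<lambda>w v. dirderiv F v w + dirderiv G v w"])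
     (auto intro!: has_derivative_add holomorphic_sev_has_derivative(1)[OF assms(1)]
        holomorphic_sev_has_derivative(1)[OF assms(2)]
        simp: holomorphic_sev_has_derivative(2)[OF assms(1)]
          holomorphic_sev_has_derivative(2)[OF assms(2)] algebra_simps)

lemma holomorphic_sev_on_mult:
  assumes "F holomorphic_sev_on S" "G holomorphic_sev_on S"
  shows "(\<lambda>w. F w * G w) holomorphic_sev_on S"
proof (rule holomorphic_sev_onI[where D = "\<lambda>w v. F w * dirderiv G v w + dirderiv F v w * G w"])
  show "((\<lambda>w. F w * G w) has_derivative (\<lambda>v. F w * dirderiv G v w + dirderiv F v w * G w)) (at w)"
    if "w \<in> S" for w
    using that by (intro has_derivative_mult holomorphic_sev_has_derivative(1)[OF assms(1)]
        holomorphic_sev_has_derivative(1)[OF assms(2)])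
qed (simp add: holomorphic_sev_has_derivative(2)[OF assms(1)]
       holomorphic_sev_has_derivative(2)[OF assms(2)] algebra_simps)

lemma holomorphic_sev_on_sum:
  assumes "\<And>i. i \<in> I \<Longrightarrow> F i holomorphic_sev_on S"
  shows "(\<lambda>w. \<Sum>i\<in>I. F i w) holomorphic_sev_on S"
  using assms
  by (induction I rule: infinite_finite_induct)
     (auto intro: holomorphic_sev_on_add holomorphic_sev_on_const)

lemma holomorphic_sev_on_component: "(\<lambda>w. w $ k) holomorphic_sev_on S"
  by (rule holomorphic_sev_onI[where D = "\<lambda>_ v. v $ k"])
     (auto intro!: bounded_linear_imp_has_derivative bounded_linear_vec_nth)

lemma holomorphic_sev_on_compose:
  assumes "\<phi> holomorphic_on T" "open T" "\<And>w. w \<in> S \<Longrightarrow> herm w z \<in> T"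
  shows "(\<lambda>w. \<phi> (herm w z)) holomorphic_sev_on S"
proof (rule holomorphic_sev_onI[where D = "\<lambda>w v. deriv \<phi> (herm w z) * herm v z"])
  fix w assume "w \<in> S"
  then have "(\<phi> has_field_derivative deriv \<phi> (herm w z)) (at (herm w z))"
    using assms holomorphic_derivI by blast
  moreover have "((\<lambda>w. herm w z) has_derivative (\<lambda>v. herm v z)) (at w)"
    by (rule bounded_linear_imp_has_derivative[OF bounded_linear_herm_left])
  ultimately show "((\<lambda>w. \<phi> (herm w z)) has_derivative (\<lambda>v. deriv \<phi> (herm w z) * herm v z)) (at w)"
    using has_derivative_compose[of "\<lambda>w. herm w z" "\<lambda>v. herm v z" w UNIV \<phi>]
    by (simp add: has_field_derivative_def)
qed (simp add: herm_cmult_left)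

text \<open>
  Cauchy's formula on the complex line through \<open>w\<close> in direction \<open>v\<close>. It expresses the derivative
  by values of \<open>F\<close> alone, so the derivative inherits continuity and differentiability from \<open>F\<close>
  although holomorphy only asserts that a derivative exists at each point.
\<close>

lemma dirderiv_circle_integral:
  assumes F: "F holomorphic_sev_on S" and d: "d > 0"
    and S: "\<And>t. norm t \<le> d \<Longrightarrow> w + t *s v \<in> S"
  shows "dirderiv F v w = integral {0..1}
    (\<lambda>x. F (w + (of_real d * exp (2 * of_real pi * \<i> * of_real x)) *s v)
            / (of_real d * exp (2 * of_real pi * \<i> * of_real x)))"
proof -
  let ?f = "\<lambda>t. F (w + t *s v)"
  have hol: "?f holomorphic_on cball 0 d"
    by (rule holomorphic_sev_line_holomorphic[OF F]) (use S in auto)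
  have "((\<lambda>u. ?f u / (u - 0)^(Suc 1)) has_contour_integral (2 * pi * \<i>) / fact 1 * (deriv ^^ 1) ?f 0)
          (circlepath 0 d)"
    by (rule Cauchy_has_contour_integral_higher_derivative_circlepath)
       (use d hol in \<open>auto intro: holomorphic_on_imp_continuous_on holomorphic_on_subset\<close>)
  then have "contour_integral (circlepath 0 d) (\<lambda>u. ?f u / u^2) = 2 * pi * \<i> * deriv ?f 0"
    by (simp add: contour_integral_unique power2_eq_square)
  also have "contour_integral (circlepath 0 d) (\<lambda>u. ?f u / u^2) =
    integral {0..1} (\<lambda>x. (2 * pi * \<i>) * (F (w + (of_real d * exp (2 * of_real pi * \<i> * of_real x)) *s v)
            / (of_real d * exp (2 * of_real pi * \<i> * of_real x))))"
    unfolding contour_integral_integral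
    by (rule integral_cong)
       (use d in \<open>simp add: vector_derivative_circlepath, simp add: circlepath power2_eq_square field_simps\<close>)
  also have "\<dots> = (2 * pi * \<i>) * integral {0..1} (\<lambda>x. (F (w + (of_real d * exp (2 * of_real pi * \<i> * of_real x)) *s v)
            / (of_real d * exp (2 * of_real pi * \<i> * of_real x))))"
    by (rule integral_mult_right)
  finally show ?thesis by (simp add: dirderiv_def)
qed

text \<open>
  One disc radius for all base points near \<open>w0\<close>: this is what allows Cauchy's formula on the lines
  in direction \<open>v\<close> to be differentiated in the base point.
\<close>

lemma discs_in_open:
  fixes v :: "complex ^ 'n"
  assumes "open S" "w0 \<in> S"
  obtains e d where "e > 0" "d > 0" "\<And>w t. w \<in> ball w0 e \<Longrightarrow> norm t \<le> d \<Longrightarrow> w + t *s v \<in> S"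
proof -
  obtain e where e: "e > 0" "cball w0 e \<subseteq> S" using assms open_contains_cball by blast
  define d where "d = e / (2 * (norm v + 1))"
  have d: "d > 0" using e by (simp add: d_def add_nonneg_pos)
  have "w + t *s v \<in> S" if "w \<in> ball w0 (e/2)" "norm t \<le> d" for w t
  proof -
    have "norm (t *s v) \<le> d * (norm v + 1)"
      unfolding norm_vector_cmult by (rule mult_mono) (use that d in auto)
    also have "\<dots> = e / 2" using norm_ge_zero[of v] by (simp add: d_def field_simps add_nonneg_eq_0_iff)
    finally have "dist w0 (w + t *s v) \<le> e"
      using that dist_triangle[of w0 "w + t *s v" w] by (simp add: dist_norm)
    then show ?thesis using e by auto
  qed
  then show ?thesis using that[of "e/2" d] e(1) d by auto
qed

lemma continuous_on_dirderiv:
  assumes F: "F holomorphic_sev_on S" and S: "open S"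
  shows "continuous_on S (dirderiv F v)"
proof (rule continuous_at_imp_continuous_on, rule ballI)
  fix w0 assume "w0 \<in> S"
  then obtain e d where e: "e > 0" and d: "d > 0"
    and in_S: "\<And>w t. w \<in> ball w0 e \<Longrightarrow> norm t \<le> d \<Longrightarrow> w + t *s v \<in> S"
    using discs_in_open[OF S] by blast
  have "continuous_on (ball w0 e) (\<lambda>w. integral (cbox 0 1)
    (\<lambda>x::real. F (w + (of_real d * exp (2 * of_real pi * \<i> * of_real x)) *s v)
            / (of_real d * exp (2 * of_real pi * \<i> * of_real x))))"
    unfolding split_beta
  proof (rule integral_continuous_on_param, unfold split_beta, intro continuous_intros
      continuous_on_compose2[OF holomorphic_sev_on_imp_continuous_on[OF F]])
    show "(\<lambda>x. fst x + (complex_of_real d * exp (2 * complex_of_real pi * \<i> * complex_of_real (snd x))) *s v) `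
      (ball w0 e \<times> cbox 0 1) \<subseteq> S"
      using d by (auto intro!: in_S simp: norm_mult norm_exp_eq_Re)
  qed (use d in auto)
  then have "continuous_on (ball w0 e) (dirderiv F v)"
    by (rule continuous_on_eq)
       (subst dirderiv_circle_integral[OF F d], auto intro!: in_S)
  then show "isCont (dirderiv F v) w0"
    using e by (simp add: continuous_on_eq_continuous_at)
qed


text \<open>
  Differentiating the Cauchy integral in \<open>w\<close> is legitimate because the derivative of the integrand,
  as a linear map, is jointly continuous; in finite dimension this may be tested on basis vectors,
  where it is the previous lemma. Complex linearity passes through the integral.
\<close>

lemma holomorphic_sev_on_dirderiv:
  assumes F: "F holomorphic_sev_on S" and S: "open S"
  shows "dirderiv F v holomorphic_sev_on S"
proof -
  have "\<exists>D. (dirderiv F v has_derivative D) (at w0) \<and> (\<forall>u. D (\<i> *s u) = \<i> * D u)" if "w0 \<in> S" for w0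
  proof -
    from that obtain e d where e: "e > 0" and d: "d > 0"
      and in_S: "\<And>w t. w \<in> ball w0 e \<Longrightarrow> norm t \<le> d \<Longrightarrow> w + t *s v \<in> S"
      using discs_in_open[OF S] by blast
    let ?U = "ball w0 e"
    define c where "c = (\<lambda>x::real. of_real d * exp (2 * of_real pi * \<i> * of_real x))"
    have c: "norm (c x) = d" "c x \<noteq> 0" for x
      using d by (auto simp: c_def norm_mult norm_exp_eq_Re)
    have c_cont: "continuous_on T c" for T
      unfolding c_def by (intro continuous_intros)
    define D where "D = (\<lambda>w x. Blinfun (\<lambda>u. dirderiv F u (w + c x *s v) / c x))"
    have bl: "bounded_linear (\<lambda>u. dirderiv F u (w + c x *s v) / c x)" if "w \<in> ?U" for w x
      using has_derivative_bounded_linear[OF holomorphic_sev_has_derivative(1)[OF F in_S[OF that]]]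
      by (rule bounded_linear_divide[THEN bounded_linear_compose]) (simp add: c)
    have D: "blinfun_apply (D w x) u = dirderiv F u (w + c x *s v) / c x" if "w \<in> ?U" for w x u
      by (simp add: D_def bounded_linear_Blinfun_apply[OF bl[OF that]])
    have img: "(\<lambda>x. fst x + c (snd x) *s v) ` (?U \<times> cbox 0 1) \<subseteq> S"
      by (auto intro!: in_S simp: c)
    have cont: "continuous_on (?U \<times> cbox 0 1) (\<lambda>(w, x). D w x)"
    proof (rule continuous_on_blinfun_componentwise, unfold split_beta)
      fix i :: "complex ^ 'a"
      have "continuous_on (?U \<times> cbox 0 1) (\<lambda>x. dirderiv F i (fst x + c (snd x) *s v) / c (snd x))"
        by (intro continuous_intros continuous_on_compose2[OF continuous_on_dirderiv[OF F S] _ img]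
              continuous_on_compose2[OF c_cont[of UNIV]]) (auto simp: c)
      then show "continuous_on (?U \<times> cbox 0 1) (\<lambda>x. blinfun_apply (D (fst x) (snd x)) i)"
        by (rule continuous_on_eq) (auto simp: D)
    qed
    have der: "((\<lambda>w. F (w + c x *s v) / c x) has_derivative blinfun_apply (D w x)) (at w within ?U)"
      if "w \<in> ?U" for w x
    proof -
      have "(F has_derivative (\<lambda>u. dirderiv F u (w + c x *s v))) (at (w + c x *s v))"
        by (rule holomorphic_sev_has_derivative(1)[OF F in_S[OF that]]) (simp add: c)
      then have "((\<lambda>w. F (w + c x *s v)) has_derivative (\<lambda>u. dirderiv F u (w + c x *s v))) (at w within ?U)"
        by (intro has_derivative_compose[of "\<lambda>w. w + c x *s v" "\<lambda>u. u" w ?U F])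
           (auto intro!: derivative_eq_intros)
      then have "((\<lambda>w. F (w + c x *s v) / c x) has_derivative (\<lambda>u. dirderiv F u (w + c x *s v) / c x)) (at w within ?U)"
        by (rule bounded_linear.has_derivative[OF bounded_linear_divide])
      moreover have "blinfun_apply (D w x) = (\<lambda>u. dirderiv F u (w + c x *s v) / c x)"
        using D[OF that] by auto
      ultimately show ?thesis by simp
    qed
    have w0: "w0 \<in> ?U" using e by simp
    have int: "(\<lambda>x. F (w + c x *s v) / c x) integrable_on cbox 0 1" if "w \<in> ?U" for w
      by (rule integrable_continuous, intro continuous_intros c_cont
          continuous_on_compose2[OF holomorphic_sev_on_imp_continuous_on[OF F]])
         (use in_S[OF that] in \<open>auto simp: c\<close>)
    have "((\<lambda>w. integral (cbox 0 1) (\<lambda>x. F (w + c x *s v) / c x)) has_derivative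
        blinfun_apply (integral (cbox 0 1) (D w0))) (at w0 within ?U)"
      by (rule leibniz_rule[OF der int cont w0]) auto
    then have "((\<lambda>w. integral (cbox 0 1) (\<lambda>x. F (w + c x *s v) / c x)) has_derivative
        blinfun_apply (integral (cbox 0 1) (D w0))) (at w0)"
      using w0 by (simp add: at_within_open[of w0 ?U])
    then have 1: "(dirderiv F v has_derivative blinfun_apply (integral (cbox 0 1) (D w0))) (at w0)"
      by (rule has_derivative_transform_within_open[OF _ open_ball w0])
         (subst dirderiv_circle_integral[OF F d], auto intro!: in_S simp: c_def)
    have "continuous_on (cbox 0 1) (\<lambda>x. case (w0, x) of (w, x) \<Rightarrow> D w x)"
      by (rule continuous_on_compose2[OF cont continuous_on_Pair[OF continuous_on_const continuous_on_id]])
         (use w0 in auto)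
    then have "continuous_on (cbox 0 1) (D w0)" by simp
    then have Dint: "D w0 integrable_on cbox 0 1" by (rule integrable_continuous)
    have app: "blinfun_apply (integral (cbox 0 1) (D w0)) u = integral (cbox 0 1) (\<lambda>x. D w0 x u)" for u
      by (rule blinfun_apply_integral[OF Dint])
    have "blinfun_apply (integral (cbox 0 1) (D w0)) (\<i> *s u) =
        \<i> * blinfun_apply (integral (cbox 0 1) (D w0)) u" for u
      unfolding app integral_mult_right[symmetric]
      by (rule integral_cong)
         (use w0 in \<open>simp add: D holomorphic_sev_has_derivative(2)[OF F in_S] c\<close>)
    with 1 show ?thesis by blast
  qed
  then obtain D where "\<And>w0. w0 \<in> S \<Longrightarrow> (dirderiv F v has_derivative D w0) (at w0)"
    "\<And>w0 u. w0 \<in> S \<Longrightarrow> D w0 (\<i> *s u) = \<i> * D w0 u" by metis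
  then show ?thesis by (rule holomorphic_sev_onI)
qed

lemma vector_sum_axis: "w = (\<Sum>k\<in>UNIV. w $ k *s axis k (1::complex))"
  by (simp add: basis_expansion)

lemma partial_deriv_eq: "partial_deriv k F w = dirderiv F (axis k 1) w"
proof -
  have "axis k t = t *s axis k (1::complex)" for t
    by (simp add: vec_eq_iff axis_def)
  then have "(\<lambda>t. F (w + axis k t)) = (\<lambda>t. F (w + t *s axis k 1))" by metis
  then show ?thesis by (simp only: partial_deriv_def dirderiv_def)
qed

text \<open>
  Complex linearity turns the sum of partial derivatives into one directional derivative, so along
  \<open>t \<mapsto> t z\<close> the radial derivative acts as \<open>t d/dt\<close>, an operator in one variable.
\<close>

lemma radial_deriv_eq:
  assumes F: "F holomorphic_sev_on S" "w \<in> S"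
  shows "radial_deriv F w = dirderiv F w w"
proof -
  have "radial_deriv F w = (\<Sum>k\<in>UNIV. dirderiv F (w $ k *s axis k 1) w)"
    by (simp add: radial_deriv_def partial_deriv_eq holomorphic_sev_has_derivative(2)[OF F])
  also have "\<dots> = dirderiv F (\<Sum>k\<in>UNIV. w $ k *s axis k 1) w"
    by (simp add: linear_sum[OF dirderiv_linear[OF F]])
  finally show ?thesis by (simp add: vector_sum_axis[symmetric])
qed

lemma holomorphic_sev_on_radial_deriv:
  assumes F: "F holomorphic_sev_on S" "open S"
  shows "radial_deriv F holomorphic_sev_on S"
proof -
  have "radial_deriv F = (\<lambda>w. \<Sum>k\<in>UNIV. w $ k * dirderiv F (axis k 1) w)"
    by (simp add: fun_eq_iff radial_deriv_def partial_deriv_eq)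
  then show ?thesis
    by (simp only:) (intro holomorphic_sev_on_sum holomorphic_sev_on_mult
        holomorphic_sev_on_component holomorphic_sev_on_dirderiv F)
qed

lemma holomorphic_sev_on_radial_deriv_iterate:
  assumes "F holomorphic_sev_on S" "open S"
  shows "(radial_deriv ^^ k) F holomorphic_sev_on S"
  using assms by (induction k) (auto intro: holomorphic_sev_on_radial_deriv)

section \<open>Taylor expansion on slices\<close>

text \<open>
  The value at \<open>z\<close> of the homogeneous part of degree \<open>m\<close> of \<open>F\<close>. It is read off the slice
  \<open>t \<mapsto> F (t z)\<close>, so no multi-indices occur.
\<close>

definition slice_coeff :: "(complex ^ 'n \<Rightarrow> complex) \<Rightarrow> nat \<Rightarrow> complex ^ 'n \<Rightarrow> complex"
  where "slice_coeff F m z = (deriv ^^ m) (\<lambda>t. F (t *s z)) 0 / fact m"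

lemma slice_near_zero:
  fixes z :: "complex ^ 'n"
  assumes "R > 0"
  shows "\<exists>e>0. \<forall>t. norm t < e \<longrightarrow> t *s z \<in> ball 0 R"
proof (intro exI conjI allI impI)
  have pos: "norm z + 1 > 0" by (simp add: add_nonneg_pos)
  show "R / (norm z + 1) > 0" using assms pos by simp
  fix t :: complex assume "norm t < R / (norm z + 1)"
  then have "norm t * (norm z + 1) < R" using pos by (simp add: pos_less_divide_eq)
  moreover have "norm t * norm z \<le> norm t * (norm z + 1)" by (intro mult_left_mono) auto
  ultimately show "t *s z \<in> ball 0 R" by (simp add: norm_vector_cmult)
qed

text \<open>
  For \<open>z\<close> in the open ball the slice extends beyond the closed unit disc, hence its Taylor series
  may be evaluated at \<open>t = 1\<close>.
\<close>

lemma slice_holomorphic: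
  assumes "F holomorphic_sev_on ball 0 R" "z \<in> ball 0 R"
  shows "\<exists>q>1. (\<lambda>t. F (t *s z)) holomorphic_on ball 0 q \<and> (\<forall>t\<in>ball 0 q. t *s z \<in> ball 0 R)"
proof -
  obtain q where q: "q > 1" "q * norm z < R"
  proof (cases "z = 0")
    case True then show ?thesis using assms that[of 2] by auto
  next
    case False
    then have "1 < R / norm z" using assms by (simp add: field_simps)
    then obtain q where "1 < q" "q < R / norm z" using dense by blast
    then show ?thesis using that[of q] False by (simp add: field_simps)
  qed
  have "t *s z \<in> ball 0 R" if "t \<in> ball 0 q" for t
  proof -
    have "norm t * norm z \<le> q * norm z" using that by (intro mult_right_mono) auto
    then show ?thesis using q by (simp add: norm_vector_cmult)
  qed
  then show ?thesis
    using q holomorphic_sev_line_holomorphic[OF assms(1), of "ball 0 q" 0 z] by auto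
qed

lemma slice_coeff_sums:
  assumes "F holomorphic_sev_on ball 0 R" "z \<in> ball 0 R"
  shows "(\<lambda>m. slice_coeff F m z) sums F z"
proof -
  obtain q where q: "q > 1" "(\<lambda>t. F (t *s z)) holomorphic_on ball 0 q"
    using slice_holomorphic[OF assms] by blast
  show ?thesis using holomorphic_power_series[OF q(2), of 1] q(1) by (simp add: slice_coeff_def)
qed

lemma slice_coeff_unique:
  assumes "F holomorphic_sev_on ball 0 R" "R > 0" "e > 0"
    and sums: "\<And>t. norm t < e \<Longrightarrow> (\<lambda>m. a m * t ^ m) sums F (t *s z)"
  shows "slice_coeff F m z = a m"
proof -
  have "((\<lambda>t. F (t *s z)) has_fps_expansion Abs_fps a)"
    unfolding has_fps_expansion_def
  proof
    have "summable (\<lambda>m. a m * of_real (e/2) ^ m)" using sums[of "of_real (e/2)"] assms(3) by (auto simp: sums_iff)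
    then have "ereal (e/2) \<le> conv_radius a"
      using conv_radius_geI[of a "of_real (e/2)"] assms(3) by simp
    then show "fps_conv_radius (Abs_fps a) > 0"
      using assms(3) by (simp add: fps_conv_radius_def order_less_le_trans[of 0 "ereal (e/2)"])
    have "eventually (\<lambda>t::complex. t \<in> ball 0 e) (nhds 0)"
      using assms(3) by (intro eventually_nhds_in_open) auto
    then show "\<forall>\<^sub>F t in nhds 0. eval_fps (Abs_fps a) t = F (t *s z)"
      by eventually_elim (use sums in \<open>auto simp: eval_fps_def sums_iff\<close>)
  qed
  then have "fps_nth (Abs_fps a) m = (deriv ^^ m) (\<lambda>t. F (t *s z)) 0 / fact m"
    by (rule fps_nth_fps_expansion)
  then show ?thesis by (simp add: slice_coeff_def)
qed

lemma slice_coeff_dirderiv: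
  assumes "F holomorphic_sev_on ball 0 R" "R > 0"
  shows "(deriv ^^ m) (\<lambda>t. dirderiv F z (t *s z)) 0 = (deriv ^^ Suc m) (\<lambda>t. F (t *s z)) 0"
proof -
  obtain e where e: "e > 0" "\<And>t. norm t < e \<Longrightarrow> t *s z \<in> ball 0 R"
    using slice_near_zero[OF assms(2)] by blast
  have "\<forall>\<^sub>F t::complex in nhds 0. t \<in> ball 0 e"
    using e(1) by (intro eventually_nhds_in_open) auto
  then have "\<forall>\<^sub>F t in nhds 0. t *s z \<in> ball 0 R"
    by eventually_elim (use e in auto)
  then have "\<forall>\<^sub>F t in nhds 0. dirderiv F z (t *s z) = deriv (\<lambda>t. F (t *s z)) t"
    by eventually_elim
       (use holomorphic_sev_line[OF assms(1), of 0 _ z] in \<open>auto intro!: DERIV_imp_deriv[symmetric]\<close>)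
  then show ?thesis
    by (subst higher_deriv_cong_ev[OF _ refl]) (auto simp: funpow_Suc_right simp del: funpow.simps)
qed

text \<open>
  On slices \<open>t d/dt\<close> multiplies \<open>t\<^sup>m\<close> by \<open>m\<close>: the radial derivative is diagonal.
\<close>

lemma slice_coeff_radial_deriv:
  assumes F: "F holomorphic_sev_on ball 0 R" and R: "R > 0"
  shows "slice_coeff (radial_deriv F) m z = of_nat m * slice_coeff F m z"
proof -
  obtain e where e: "e > 0" "\<And>t. norm t < e \<Longrightarrow> t *s z \<in> ball 0 R"
    using slice_near_zero[OF R] by blast
  let ?f = "\<lambda>t. F (t *s z)"
  have der: "(?f has_field_derivative dirderiv F z (t *s z)) (at t)" if "norm t < e" for t
    using holomorphic_sev_line[OF F, of 0 t z] e(2)[OF that] by simp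
  have hol: "?f holomorphic_on ball 0 e"
    unfolding holomorphic_on_open[OF open_ball] using der by (auto intro!: exI)
  show ?thesis
  proof (rule slice_coeff_unique[OF holomorphic_sev_on_radial_deriv[OF F open_ball] R e(1)])
    fix t :: complex assume t: "norm t < e"
    have "(\<lambda>n. (deriv ^^ n) (deriv ?f) 0 / fact n * t ^ n) sums deriv ?f t"
      using holomorphic_power_series[OF holomorphic_deriv[OF hol open_ball], of t] t by simp
    then have "(\<lambda>n. t * ((deriv ^^ n) (deriv ?f) 0 / fact n * t ^ n)) sums (t * deriv ?f t)"
      by (rule sums_mult)
    also have "(\<lambda>n. t * ((deriv ^^ n) (deriv ?f) 0 / fact n * t ^ n)) =
        (\<lambda>n. of_nat (Suc n) * slice_coeff F (Suc n) z * t ^ Suc n)"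
      by (auto simp: fun_eq_iff slice_coeff_def funpow_Suc_right field_simps simp del: funpow.simps of_nat_Suc)
    also have "t * deriv ?f t = radial_deriv F (t *s z)"
      using e(2)[OF t] DERIV_imp_deriv[OF der[OF t]]
      by (simp add: radial_deriv_eq[OF F] holomorphic_sev_has_derivative(2)[OF F])
    finally show "(\<lambda>n. of_nat n * slice_coeff F n z * t ^ n) sums radial_deriv F (t *s z)"
      by (subst (asm) sums_Suc_iff) simp
  qed
qed

section \<open>Differentiation under the integral\<close>

text \<open>
  Dominated convergence for the difference quotients, which are bounded by \<open>B\<close> by the mean value
  inequality.
\<close>

lemma has_vector_derivative_lebesgue_integral:
  fixes u :: "real \<Rightarrow> 'w \<Rightarrow> 'b :: {banach, second_countable_topology}"
  assumes e: "e > 0"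
    and int: "\<And>t. \<bar>t - t0\<bar> < e \<Longrightarrow> integrable M (u t)"
    and der: "\<And>t w. \<bar>t - t0\<bar> < e \<Longrightarrow> w \<in> space M \<Longrightarrow> ((\<lambda>t. u t w) has_vector_derivative u' t w) (at t)"
    and bd: "\<And>t w. \<bar>t - t0\<bar> < e \<Longrightarrow> w \<in> space M \<Longrightarrow> norm (u' t w) \<le> B w"
    and B: "integrable M B"
  shows "((\<lambda>t. LINT w|M. u t w) has_vector_derivative (LINT w|M. u' t0 w)) (at t0)"
    and "u' t0 \<in> borel_measurable M"
proof -
  define q where "q = (\<lambda>t w. (1 / (t - t0)) *\<^sub>R (u t w - u t0 w))"
  have q_lim: "(\<lambda>i. q (X i) w) \<longlonglongrightarrow> u' t0 w"
    if X: "X \<longlonglongrightarrow> t0" "\<And>i. X i \<noteq> t0" and w: "w \<in> space M" for X :: "nat \<Rightarrow> real" and w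
  proof -
    have "((\<lambda>t. u t w) has_derivative (\<lambda>h. h *\<^sub>R u' t0 w)) (at t0)"
      using der[of t0 w] e w by (simp add: has_vector_derivative_def)
    then have "(\<lambda>t. (1 / norm (t - t0)) *\<^sub>R (u t w - (u t0 w + (t - t0) *\<^sub>R u' t0 w))) \<midarrow>t0\<rightarrow> 0"
      by (simp add: has_derivative_within)
    then have "(\<lambda>i. (1 / norm (X i - t0)) *\<^sub>R (u (X i) w - (u t0 w + (X i - t0) *\<^sub>R u' t0 w))) \<longlonglongrightarrow> 0"
      using X by (auto simp: tendsto_at_iff_sequentially o_def)
    then have "(\<lambda>i. norm ((1 / norm (X i - t0)) *\<^sub>R (u (X i) w - (u t0 w + (X i - t0) *\<^sub>R u' t0 w)))) \<longlonglongrightarrow> 0"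
      by (simp only: tendsto_norm_zero_iff)
    also have "(\<lambda>i. norm ((1 / norm (X i - t0)) *\<^sub>R (u (X i) w - (u t0 w + (X i - t0) *\<^sub>R u' t0 w))))
        = (\<lambda>i. norm (q (X i) w - u' t0 w))"
    proof
      fix i
      have "q (X i) w - u' t0 w = (1 / (X i - t0)) *\<^sub>R (u (X i) w - (u t0 w + (X i - t0) *\<^sub>R u' t0 w))"
        using X(2)[of i] by (simp add: q_def scaleR_right_diff_distrib scaleR_right_distrib)
      then show "norm ((1 / norm (X i - t0)) *\<^sub>R (u (X i) w - (u t0 w + (X i - t0) *\<^sub>R u' t0 w)))
          = norm (q (X i) w - u' t0 w)" by simp
    qed
    finally have "(\<lambda>i. q (X i) w - u' t0 w) \<longlonglongrightarrow> 0" by (simp only: tendsto_norm_zero_iff)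
    then show ?thesis by (simp add: LIM_zero_iff)
  qed
  have q_meas: "q t \<in> borel_measurable M" if "\<bar>t - t0\<bar> < e" for t
    unfolding q_def using int[OF that] int[of t0] e
    by (intro borel_measurable_scaleR borel_measurable_diff) auto
  have q_bd: "norm (q t w) \<le> B w" if t: "\<bar>t - t0\<bar> < e" "t \<noteq> t0" and w: "w \<in> space M" for t w
  proof -
    have "norm (u t w - u t0 w) \<le> B w * norm (t - t0)"
    proof (rule differentiable_bound[where S = "{t0 - \<bar>t - t0\<bar> .. t0 + \<bar>t - t0\<bar>}"])
      fix x assume x: "x \<in> {t0 - \<bar>t - t0\<bar> .. t0 + \<bar>t - t0\<bar>}"
      then have x: "\<bar>x - t0\<bar> < e" using t by auto
      show "((\<lambda>t. u t w) has_derivative (\<lambda>h. h *\<^sub>R u' x w)) (at x within {t0 - \<bar>t - t0\<bar> .. t0 + \<bar>t - t0\<bar>})"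
        using der[OF x w] by (simp add: has_vector_derivative_def has_derivative_at_withinI)
      show "onorm (\<lambda>h. h *\<^sub>R u' x w) \<le> B w"
        using bd[OF x w] by (intro onorm_bound) (auto simp: mult.commute[of "B w"] intro!: mult_left_mono intro: order_trans[OF norm_ge_zero])
    qed auto
    then show ?thesis using t(2) by (simp add: q_def divide_simps mult.commute)
  qed
  have step: "(\<lambda>i. LINT w|M. q (X i) w) \<longlonglongrightarrow> (LINT w|M. u' t0 w) \<and> u' t0 \<in> borel_measurable M"
    if X: "X \<longlonglongrightarrow> t0" "\<And>i. X i \<noteq> t0" for X :: "nat \<Rightarrow> real"
  proof -
    obtain N where N: "\<And>i. i \<ge> N \<Longrightarrow> \<bar>X i - t0\<bar> < e"
      using LIMSEQ_D[OF X(1) e] by auto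
    define Y where "Y = (\<lambda>i. X (i + N))"
    have Y: "Y \<longlonglongrightarrow> t0" "\<And>i. Y i \<noteq> t0" "\<And>i. \<bar>Y i - t0\<bar> < e"
      using LIMSEQ_ignore_initial_segment[OF X(1), of N] X(2) N by (auto simp: Y_def)
    have m: "u' t0 \<in> borel_measurable M"
      by (rule borel_measurable_LIMSEQ_metric[OF q_meas q_lim[OF Y(1,2)]]) (use Y in auto)
    have "(\<lambda>i. LINT w|M. q (Y i) w) \<longlonglongrightarrow> (LINT w|M. u' t0 w)"
      by (rule integral_dominated_convergence[OF m q_meas[OF Y(3)] B])
         (use q_lim[OF Y(1,2)] q_bd Y in auto)
    then show ?thesis using m LIMSEQ_offset[of "\<lambda>i. LINT w|M. q (X i) w" N] by (simp add: Y_def)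
  qed
  have "(\<lambda>i. t0 + 1 / real (Suc i)) \<longlonglongrightarrow> t0"
    using tendsto_add[OF tendsto_const LIMSEQ_inverse_real_of_nat, of t0] by (simp add: inverse_eq_divide)
  from step[OF this] show "u' t0 \<in> borel_measurable M" by simp
  have int_q: "(LINT w|M. q t w) = (1 / (t - t0)) *\<^sub>R ((LINT w|M. u t w) - (LINT w|M. u t0 w))"
    if "\<bar>t - t0\<bar> < e" for t
    using int[OF that] int[of t0] e by (simp add: q_def)
  let ?F = "\<lambda>t. LINT w|M. u t w" and ?v = "LINT w|M. u' t0 w"
  have lim: "((\<lambda>t. LINT w|M. q t w) \<longlongrightarrow> ?v) (at t0)"
    using step by (auto simp: tendsto_at_iff_sequentially o_def)
  have "((\<lambda>t. norm ((LINT w|M. q t w) - ?v)) \<longlongrightarrow> 0) (at t0)"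
    using lim by (simp add: tendsto_norm_zero_iff LIM_zero_iff)
  moreover have "\<forall>\<^sub>F t in at t0. norm ((LINT w|M. q t w) - ?v)
      = norm ((1 / norm (t - t0)) *\<^sub>R (?F t - (?F t0 + (t - t0) *\<^sub>R ?v)))"
  proof -
    have "\<forall>\<^sub>F t in at t0. \<bar>t - t0\<bar> < e \<and> t \<noteq> t0"
      unfolding eventually_at using e by (auto simp: dist_real_def)
    then show ?thesis
    proof eventually_elim
      case (elim t)
      have "(LINT w|M. q t w) - ?v = (1 / (t - t0)) *\<^sub>R (?F t - (?F t0 + (t - t0) *\<^sub>R ?v))"
        using elim by (simp add: int_q scaleR_right_diff_distrib scaleR_right_distrib)
      then show ?case by simp
    qed
  qed
  ultimately have "((\<lambda>t. norm ((1 / norm (t - t0)) *\<^sub>R (?F t - (?F t0 + (t - t0) *\<^sub>R ?v)))) \<longlongrightarrow> 0) (at t0)"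
    by (rule Lim_transform_eventually)
  then have "((\<lambda>t. (1 / norm (t - t0)) *\<^sub>R (?F t - (?F t0 + (t - t0) *\<^sub>R ?v))) \<longlongrightarrow> 0) (at t0)"
    by (simp only: tendsto_norm_zero_iff)
  then show "(?F has_vector_derivative ?v) (at t0)"
    by (simp add: has_vector_derivative_def has_derivative_within bounded_linear_scaleR_left)
qed

section \<open>Integration by parts with boundary weights\<close>

text \<open>
  By translation invariance \<open>\<integral> H(w + t v)\<close> does not depend on \<open>t\<close>; its derivative at \<open>t = 0\<close> is
  the integral in question. All integrations by parts below come from this.
\<close>

lemma integral_directional_derivative_eq_0:
  fixes H :: "'a :: euclidean_space \<Rightarrow> complex"
  assumes der: "\<And>w. (H has_derivative H' w) (at w)"
    and bd: "\<And>w. norm (H' w v) \<le> C"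
    and supp: "\<And>w. norm w \<ge> r' \<Longrightarrow> H w = 0" and r: "r' < r"
  shows "(LINT w|lebesgue_on (ball 0 r). H' w v) = 0"
proof -
  have H'0: "H' w v = 0" if "norm w > r'" for w
  proof -
    have "open (- cball 0 r' :: 'a set)" by auto
    then have "(H has_derivative (\<lambda>_. 0)) (at w)"
      by (rule has_derivative_transform_within_open[OF has_derivative_const[of 0]]) (use that supp in auto)
    then show ?thesis using has_derivative_unique[OF der] by metis
  qed
  have H_cont: "continuous_on S H" for S
    by (rule continuous_at_imp_continuous_on) (use der has_derivative_continuous in blast)
  define R where "R = \<bar>r'\<bar> + norm v"
  have int: "integrable lborel (\<lambda>w. H (w + t *\<^sub>R v))" if "\<bar>t - 0\<bar> < 1" for t
  proof -
    have "integrable lborel (\<lambda>w. indicator (cball 0 R) w *\<^sub>R H (w + t *\<^sub>R v))"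
      by (intro borel_integrable_compact compact_cball continuous_on_compose2[OF H_cont[of UNIV]] continuous_intros) auto
    moreover have "H (w + t *\<^sub>R v) = 0" if "norm w > R" for w
    proof (rule supp)
      have "norm (t *\<^sub>R v) \<le> 1 * norm v" unfolding norm_scaleR
        by (rule mult_right_mono) (use \<open>\<bar>t - 0\<bar> < 1\<close> in auto)
      then show "norm (w + t *\<^sub>R v) \<ge> r'"
        using that norm_diff_ineq[of w "t *\<^sub>R v"] by (auto simp: R_def)
    qed
    then have "indicator (cball 0 R) w *\<^sub>R H (w + t *\<^sub>R v) = H (w + t *\<^sub>R v)" for w
      by (auto simp: indicator_def not_le)
    ultimately show ?thesis by simp
  qed
  have C: "C \<ge> 0" using bd[of 0] norm_ge_zero order_trans by blast
  have Bint: "integrable lborel (\<lambda>w. C * indicator (cball (0::'a) R) w :: real)"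
    using borel_integrable_compact[of "cball (0::'a) R" "\<lambda>_. C"] by (simp add: mult.commute)
  have bd2: "norm (H' (w + t *\<^sub>R v) v) \<le> C * indicator (cball 0 R) w" if "\<bar>t - 0\<bar> < 1" for w t
  proof (cases "norm w \<le> R")
    case False
    have "norm (t *\<^sub>R v) \<le> 1 * norm v" unfolding norm_scaleR
      by (rule mult_right_mono) (use \<open>\<bar>t - 0\<bar> < 1\<close> in auto)
    then have "norm (w + t *\<^sub>R v) > r'"
      using False norm_diff_ineq[of w "t *\<^sub>R v"] by (auto simp: R_def)
    then show ?thesis using C by (simp add: H'0)
  qed (use bd in auto)
  have der2: "((\<lambda>t. H (w + t *\<^sub>R v)) has_vector_derivative H' (w + t *\<^sub>R v) v) (at t)" for t w
  proof -
    have "((\<lambda>t. w + t *\<^sub>R v) has_derivative (\<lambda>h. h *\<^sub>R v)) (at t)"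
      by (auto intro!: derivative_eq_intros)
    from has_derivative_compose[OF this der]
    show ?thesis
      by (simp add: has_vector_derivative_def linear_cmul[OF has_derivative_linear[OF der]])
  qed
  have const: "(LINT w|lborel. H (w + t *\<^sub>R v)) = (LINT w|lborel. H w)" for t
  proof -
    have "(LINT w|lborel. H w) = (LINT w|distr lborel borel ((+) (t *\<^sub>R v)). H w)"
      by (simp add: lborel_distr_plus)
    also have "\<dots> = (LINT w|lborel. H (t *\<^sub>R v + w))"
      by (rule integral_distr) (auto intro: borel_measurable_continuous_onI H_cont)
    finally show ?thesis by (simp add: add.commute)
  qed
  have "((\<lambda>t. LINT w|lborel. H (w + t *\<^sub>R v)) has_vector_derivative (LINT w|lborel. H' (w + 0 *\<^sub>R v) v)) (at 0)"
    and m: "(\<lambda>w. H' (w + 0 *\<^sub>R v) v) \<in> borel_measurable lborel"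
    using has_vector_derivative_lebesgue_integral[of 1 0 lborel
        "\<lambda>t w. H (w + t *\<^sub>R v)" "\<lambda>t w. H' (w + t *\<^sub>R v) v", OF _ int der2 bd2 Bint]
    by auto
  then have "((\<lambda>t::real. LINT w|lborel. H w) has_vector_derivative (LINT w|lborel. H' w v)) (at 0)"
    by (simp add: const)
  from vector_derivative_unique_at[OF this has_vector_derivative_const]
  have "(LINT w|lborel. H' w v) = 0" .
  then have "(LINT w|lebesgue. H' w v) = 0"
    using m by (simp add: integral_completion)
  moreover have "indicator (ball 0 r) w *\<^sub>R H' w v = H' w v" for w
    using H'0[of w] r by (auto simp: indicator_def)
  ultimately show ?thesis by (simp add: integral_restrict_space)
qed

lemma has_real_derivative_max_square:
  "((\<lambda>x. (max 0 (x - e))\<^sup>2) has_real_derivative 2 * max 0 (x - e)) (at x)"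
proof -
  consider "x < e" | "x > e" | "x = e" by linarith
  then show ?thesis
  proof cases
    case 1
    have "((\<lambda>x. 0) has_real_derivative 2 * max 0 (x - e)) (at x)" using 1 by simp
    then show ?thesis
      by (rule has_field_derivative_transform_within_open[where S = "{..<e}"]) (use 1 in auto)
  next
    case 2
    have "((\<lambda>x. (x - e)\<^sup>2) has_real_derivative 2 * max 0 (x - e)) (at x)"
      using 2 by (auto intro!: derivative_eq_intros)
    then show ?thesis
      by (rule has_field_derivative_transform_within_open[where S = "{e<..}"]) (use 2 in auto)
  next
    case 3
    have "((\<lambda>y. ((max 0 (y - e))\<^sup>2 - (max 0 (e - e))\<^sup>2) / (y - e)) \<longlongrightarrow> 0) (at e)"
    proof (rule Lim_null_comparison)
      show "\<forall>\<^sub>F y in at e. norm (((max 0 (y - e))\<^sup>2 - (max 0 (e - e))\<^sup>2) / (y - e)) \<le> \<bar>y - e\<bar>"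
        by (rule always_eventually) (auto simp: max_def power2_eq_square)
      show "((\<lambda>y. \<bar>y - e\<bar>) \<longlongrightarrow> 0) (at e)"
        by (rule tendsto_eq_intros refl)+ simp
    qed
    then show ?thesis using 3 by (simp add: has_field_derivative_iff)
  qed
qed

abbreviation defect :: "real \<Rightarrow> 'a :: real_normed_vector \<Rightarrow> real"
  where "defect r w \<equiv> r\<^sup>2 - (norm w)\<^sup>2"

text \<open>
  A \<open>C\<^sup>1\<close> substitute for \<open>x powr (b + 1)\<close> that vanishes for \<open>x \<le> e\<close>. The power itself, evaluated at
  the defect \<open>x\<close>, need not be differentiable at the boundary of the ball if \<open>Re b < 0\<close>. As \<open>e\<close> tends
  to \<open>0\<close> both the function and its derivative converge, dominated by constant multiples of
  \<open>x powr (Re b + 1)\<close> and \<open>x powr Re b\<close>.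
\<close>

definition cutoff :: "real \<Rightarrow> complex \<Rightarrow> real \<Rightarrow> complex"
  where "cutoff e b x = of_real ((max 0 (x - e))\<^sup>2) * of_real x powr (b - 1)"

definition cutoff' :: "real \<Rightarrow> complex \<Rightarrow> real \<Rightarrow> complex"
  where "cutoff' e b x = of_real (2 * max 0 (x - e)) * of_real x powr (b - 1)
     + of_real ((max 0 (x - e))\<^sup>2) * ((b - 1) * of_real x powr (b - 2))"

lemma has_vector_derivative_of_real_powr:
  assumes "x > 0"
  shows "((\<lambda>x. complex_of_real x powr b) has_vector_derivative b * of_real x powr (b - 1)) (at x)"
proof -
  have "((\<lambda>z. z powr b) has_field_derivative b * of_real x powr (b - 1)) (at (of_real x))"
    using assms by (intro has_field_derivative_powr) (auto simp: complex_nonpos_Reals_iff)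
  from field_vector_diff_chain_at[OF has_vector_derivative_of_real[OF DERIV_ident] this]
  show ?thesis by (simp add: o_def)
qed

lemma cutoff_has_vector_derivative:
  assumes "e > 0"
  shows "(cutoff e b has_vector_derivative cutoff' e b x) (at x)"
proof (cases "x < e")
  case True
  have "((\<lambda>_. 0) has_vector_derivative cutoff' e b x) (at x)"
    using True by (simp add: cutoff'_def)
  then show ?thesis
    by (rule has_vector_derivative_transform_within_open[where S = "{..<e}"])
       (use True in \<open>auto simp: cutoff_def\<close>)
next
  case False
  have "((\<lambda>x. complex_of_real ((max 0 (x - e))\<^sup>2)) has_vector_derivative of_real (2 * max 0 (x - e))) (at x)"
    by (rule has_vector_derivative_of_real)
       (use has_real_derivative_max_square[of e x] in \<open>simp add: has_real_derivative_iff_has_vector_derivative\<close>)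
  from has_vector_derivative_mult[OF this has_vector_derivative_of_real_powr[of x "b - 1"]]
  show ?thesis
    using False assms unfolding cutoff_def[abs_def] cutoff'_def by (simp add: algebra_simps)
qed

lemma cutoff_eq_0: "x \<le> e \<Longrightarrow> cutoff e b x = 0" "x \<le> e \<Longrightarrow> cutoff' e b x = 0"
  by (simp_all add: cutoff_def cutoff'_def)

lemma norm_of_real_powr: "x \<ge> 0 \<Longrightarrow> norm (complex_of_real x powr b) = x powr Re b"
  by (simp add: norm_powr_real_powr)

lemma norm_cutoff_le:
  assumes "x > 0" "e \<ge> 0"
  shows "norm (cutoff e b x) \<le> x powr (Re b + 1)"
    and "norm (cutoff' e b x) \<le> (2 + norm (b - 1)) * x powr Re b"
proof -
  let ?m = "max 0 (x - e)"
  have m: "0 \<le> ?m" "?m \<le> x" using assms by auto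
  have m2: "?m\<^sup>2 \<le> x\<^sup>2" using m by (intro power_mono)
  have "norm (cutoff e b x) = ?m\<^sup>2 * x powr (Re b - 1)"
    using assms by (simp add: cutoff_def norm_mult norm_power norm_of_real_powr)
  also have "\<dots> \<le> x powr 2 * x powr (Re b - 1)"
    using m2 assms by (intro mult_right_mono) auto
  finally show "norm (cutoff e b x) \<le> x powr (Re b + 1)"
    by (simp add: powr_add[symmetric] add.commute)
  have "norm (cutoff' e b x) \<le> 2 * ?m * x powr (Re b - 1) + ?m\<^sup>2 * (norm (b - 1) * x powr (Re b - 2))"
    using assms unfolding cutoff'_def
    by (intro norm_triangle_le add_mono) (simp_all add: norm_mult norm_power norm_of_real_powr)
  also have "\<dots> \<le> 2 * x powr 1 * x powr (Re b - 1) + x powr 2 * (norm (b - 1) * x powr (Re b - 2))"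
    using m m2 assms by (intro add_mono mult_right_mono) auto
  also have "\<dots> = (2 + norm (b - 1)) * x powr Re b"
    using assms by (simp add: powr_add[symmetric] algebra_simps powr_diff power2_eq_square)
  finally show "norm (cutoff' e b x) \<le> (2 + norm (b - 1)) * x powr Re b" .
qed

lemma cutoff_tendsto:
  assumes x: "x > 0"
  shows "(\<lambda>n. cutoff (1 / real (Suc n)) b x) \<longlonglongrightarrow> of_real x powr (b + 1)"
    and "(\<lambda>n. cutoff' (1 / real (Suc n)) b x) \<longlonglongrightarrow> (b + 1) * of_real x powr b"
proof -
  have 0: "(\<lambda>n. 1 / real (Suc n)) \<longlonglongrightarrow> 0"
    using LIMSEQ_inverse_real_of_nat by (simp add: inverse_eq_divide)
  have p: "complex_of_real x powr (c + 1) = of_real x * of_real x powr c" for c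
    using x by (simp add: powr_add mult.commute)
  have p1: "complex_of_real x powr (b + 1) = of_real (x^2) * of_real x powr (b - 1)"
    using p[of "b"] p[of "b - 1"] by (simp add: power2_eq_square)
  have m: "max 0 (x - 0) = x" using x by simp
  have "(\<lambda>n. cutoff (1 / real (Suc n)) b x) \<longlonglongrightarrow> of_real ((max 0 (x - 0))\<^sup>2) * of_real x powr (b - 1)"
    unfolding cutoff_def by (intro tendsto_intros 0)
  then show "(\<lambda>n. cutoff (1 / real (Suc n)) b x) \<longlonglongrightarrow> of_real x powr (b + 1)"
    unfolding m p1 .
  have "(\<lambda>n. cutoff' (1 / real (Suc n)) b x) \<longlonglongrightarrow>
      of_real (2 * max 0 (x - 0)) * of_real x powr (b - 1)
     + of_real ((max 0 (x - 0))\<^sup>2) * ((b - 1) * of_real x powr (b - 2))"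
    unfolding cutoff'_def by (intro tendsto_intros 0)
  also have "of_real (2 * max 0 (x - 0)) * of_real x powr (b - 1)
     + of_real ((max 0 (x - 0))\<^sup>2) * ((b - 1) * of_real x powr (b - 2)) = (b + 1) * of_real x powr b"
    unfolding m using p[of "b - 1"] p[of "b - 2"] by (simp add: power2_eq_square algebra_simps)
  finally show "(\<lambda>n. cutoff' (1 / real (Suc n)) b x) \<longlonglongrightarrow> (b + 1) * of_real x powr b" .
qed

lemma continuous_on_cutoff:
  assumes "e > 0"
  shows "continuous_on UNIV (cutoff e b)" "continuous_on UNIV (cutoff' e b)"
proof -
  show "continuous_on UNIV (cutoff e b)"
    by (rule continuous_at_imp_continuous_on)
       (use cutoff_has_vector_derivative[OF assms] has_vector_derivative_continuous in blast)
  have "continuous_on {0<..} (cutoff' e b)"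
    unfolding cutoff'_def[abs_def]
    by (intro continuous_intros) (auto simp: complex_nonpos_Reals_iff)
  moreover have "continuous_on {..<e} (cutoff' e b)"
    by (rule continuous_on_eq[of _ "\<lambda>_. 0"]) (auto simp: cutoff_eq_0)
  ultimately have "continuous_on ({0<..} \<union> {..<e}) (cutoff' e b)"
    by (rule continuous_on_open_Un[rotated 2]) auto
  moreover have "{0<..} \<union> {..<e} = (UNIV :: real set)" using assms by auto
  ultimately show "continuous_on UNIV (cutoff' e b)" by simp
qed

lemma cutoff_integration_by_parts:
  fixes G :: "complex ^ 'n \<Rightarrow> complex"
  assumes S: "open S" "cball 0 r \<subseteq> S" and r: "r > 0" and e: "e > 0"
    and der: "\<And>w. w \<in> S \<Longrightarrow> (G has_derivative G' w) (at w)"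
    and cont: "continuous_on S (\<lambda>w. G' w v)"
  shows "(LINT w|lebesgue_on (ball 0 r). G' w v * cutoff e b (defect r w)
      - 2 * G w * of_real (inner w v) * cutoff' e b (defect r w)) = 0"
proof -
  let ?x = "\<lambda>w :: complex ^ 'n. defect r w"
  define H where "H = (\<lambda>w. if w \<in> S then G w * cutoff e b (?x w) else 0)"
  define H' where "H' = (\<lambda>w v. if w \<in> cball 0 r
     then G' w v * cutoff e b (?x w) - 2 * G w * of_real (inner w v) * cutoff' e b (?x w) else 0)"
  have zero: "?x w \<le> 0" if "norm w \<ge> r" for w :: "complex ^ 'n"
    using that r by (simp add: power_mono)
  obtain r' where r': "0 < r'" "r' < r" "r\<^sup>2 - r'\<^sup>2 \<le> e"
  proof -
    have "((\<lambda>t. r\<^sup>2 - t\<^sup>2) \<longlongrightarrow> r\<^sup>2 - r\<^sup>2) (at_left r)" by (intro tendsto_intros)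
    then have "\<forall>\<^sub>F t in at_left r. r\<^sup>2 - t\<^sup>2 < e" using e by (intro order_tendstoD) auto
    moreover have "\<forall>\<^sub>F t in at_left r. t > 0 \<and> t < r"
      using eventually_at_left_field[of _ r] r by (auto intro: exI[of _ 0])
    ultimately have "\<forall>\<^sub>F t in at_left r. 0 < t \<and> t < r \<and> r\<^sup>2 - t\<^sup>2 \<le> e" by eventually_elim auto
    then show ?thesis using that eventually_happens[of _ "at_left r"] trivial_limit_at_left_real by blast
  qed
  have x_le: "?x w \<le> e" if "norm w \<ge> r'" for w :: "complex ^ 'n"
  proof -
    have "r'\<^sup>2 \<le> (norm w)\<^sup>2" using that r'(1) by (intro power_mono) auto
    then show ?thesis using r'(3) by linarith
  qed
  have derx: "(?x has_derivative (\<lambda>h. - 2 * inner w h)) (at w)" for w :: "complex ^ 'n"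
    unfolding power2_norm_eq_inner by (auto intro!: derivative_eq_intros simp: inner_commute)
  have der_cut: "((\<lambda>w. cutoff e b (?x w)) has_derivative (\<lambda>h. (- 2 * inner w h) *\<^sub>R cutoff' e b (?x w))) (at w)"
    for w :: "complex ^ 'n"
    using has_derivative_compose[OF derx cutoff_has_vector_derivative[OF e, unfolded has_vector_derivative_def]] .
  have derH: "(H has_derivative H' w) (at w)" for w
  proof (cases "w \<in> cball 0 r")
    case True
    then have w: "w \<in> S" using S by auto
    have "((\<lambda>w. G w * cutoff e b (?x w)) has_derivative H' w) (at w)"
      using has_derivative_mult[OF der[OF w] der_cut[of w]] True
      by (simp add: H'_def scaleR_conv_of_real algebra_simps)
    then show ?thesis
      by (rule has_derivative_transform_within_open[OF _ S(1) w]) (simp add: H_def)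
  next
    case False
    have "open (- cball 0 r :: (complex ^ 'n) set)" by auto
    moreover have "H w = 0" if "w \<notin> cball 0 r" for w
      using that cutoff_eq_0[of "?x w" e b] zero[of w] e by (auto simp: H_def not_le)
    ultimately have "(H has_derivative (\<lambda>_. 0)) (at w)"
      by (intro has_derivative_transform_within_open[OF has_derivative_const[of 0]]) (use False in auto)
    then show ?thesis using False by (simp add: H'_def)
  qed
  have supp: "H w = 0" if "norm w \<ge> r'" for w
    using cutoff_eq_0[OF x_le[OF that]] by (simp add: H_def)
  have contG: "continuous_on S G"
    by (rule continuous_at_imp_continuous_on) (use der has_derivative_continuous in blast)
  obtain C where C: "\<And>w. norm (H' w v) \<le> C"
  proof -
    note cc = continuous_on_cutoff[OF e, of b]
    have sub: "cball 0 r' \<subseteq> S" using S(2) r' by auto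
    have "continuous_on (cball 0 r') (\<lambda>w. G' w v * cutoff e b (?x w) - 2 * G w * of_real (inner w v) * cutoff' e b (?x w))"
      by (intro continuous_intros continuous_on_compose2[OF cc(1)] continuous_on_compose2[OF cc(2)]
          continuous_on_subset[OF contG sub] continuous_on_subset[OF cont sub]) auto
    from compact_imp_bounded[OF compact_continuous_image[OF this compact_cball]]
    obtain C where C: "C > 0" "\<And>w. w \<in> cball 0 r' \<Longrightarrow>
       norm (G' w v * cutoff e b (?x w) - 2 * G w * of_real (inner w v) * cutoff' e b (?x w)) \<le> C"
      by (auto simp: bounded_pos)
    show ?thesis
    proof (rule that)
      fix w show "norm (H' w v) \<le> C"
        using C x_le[of w] cutoff_eq_0[of "?x w" e b] by (cases "norm w \<le> r'") (auto simp: H'_def)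
    qed
  qed
  have "(LINT w|lebesgue_on (ball 0 r). H' w v) = 0"
    by (rule integral_directional_derivative_eq_0[OF derH C supp r'(2)])
  also have "(LINT w|lebesgue_on (ball 0 r). H' w v) = (LINT w|lebesgue_on (ball 0 r).
      G' w v * cutoff e b (?x w) - 2 * G w * of_real (inner w v) * cutoff' e b (?x w))"
    by (rule Bochner_Integration.integral_cong) (auto simp: H'_def)
  finally show ?thesis .
qed

section \<open>Moments of holomorphic functions\<close>

lemma integral_lebesgue_on_subset:
  fixes f :: "'a :: euclidean_space \<Rightarrow> 'b :: {banach, second_countable_topology}"
  assumes "S \<subseteq> T" "S \<in> sets lebesgue" "T \<in> sets lebesgue"
  shows "(LINT w|lebesgue_on S. f w) = (LINT w|lebesgue_on T. indicator S w *\<^sub>R f w)"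
proof -
  have eq: "indicator T w * indicator S w = (indicator S w :: real)" for w
    using assms(1) by (auto simp: indicator_def)
  show ?thesis using assms(2,3) by (simp add: integral_restrict_space eq)
qed

lemma integrable_continuous_cball:
  fixes f :: "'a :: euclidean_space \<Rightarrow> complex"
  assumes "continuous_on (cball 0 r) f"
  shows "integrable (lebesgue_on (ball 0 r)) f"
proof -
  have 1: "integrable lborel (\<lambda>w. indicator (cball 0 r) w *\<^sub>R f w)"
    by (rule borel_integrable_compact[OF compact_cball assms])
  have "integrable lborel (\<lambda>w. indicator (ball 0 r) w *\<^sub>R indicator (cball 0 r) w *\<^sub>R f w)"
    by (rule integrable_mult_indicator[OF _ 1]) simp
  moreover have "indicator (ball 0 r) w * indicator (cball 0 r) w = (indicator (ball 0 r) w :: real)" for w :: 'a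
    by (auto simp: indicator_def)
  ultimately have "integrable lborel (\<lambda>w. indicator (ball 0 r) w *\<^sub>R f w)" by simp
  then have "integrable lebesgue (\<lambda>w. indicator (ball 0 r) w *\<^sub>R f w)"
    by (subst integrable_completion) (auto dest: borel_measurable_integrable)
  then show ?thesis by (simp add: integrable_restrict_space)
qed

lemma defect_pos: "w \<in> ball 0 r \<Longrightarrow> defect r w > 0" for r :: real
  using power_strict_mono[of "norm w" r 2] by simp

lemma sum_inner_Basis_square: "(\<Sum>e\<in>Basis. (inner w e)\<^sup>2) = (norm (w :: 'a :: euclidean_space))\<^sup>2"
  by (simp add: norm_eq_sqrt_inner euclidean_inner[of w w] power2_eq_square sum_nonneg)

text \<open>
  Integration by parts applied to the coordinate functions and summed: this is the divergence
  theorem for the Euler field, whose divergence is the real dimension \<open>2 n\<close>.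
\<close>

lemma cutoff_mass_identity:
  assumes r: "r > 0" and e: "e > 0"
  shows "of_nat CARD('n) * (LINT w|lebesgue_on (ball 0 r :: (complex ^ 'n) set). cutoff e b (defect r w))
    = (LINT w|lebesgue_on (ball 0 r :: (complex ^ 'n) set). of_real ((norm w)\<^sup>2) * cutoff' e b (defect r w))"
    (is "_ * ?I = ?J")
proof -
  let ?M = "lebesgue_on (ball 0 r :: (complex ^ 'n) set)"
  let ?x = "\<lambda>w :: complex ^ 'n. defect r w"
  have int1: "integrable ?M (\<lambda>w. cutoff e b (?x w))"
    by (intro integrable_continuous_cball continuous_on_compose2[OF continuous_on_cutoff(1)[OF e]] continuous_intros) auto
  have int2: "integrable ?M (\<lambda>w. 2 * of_real ((inner w v)\<^sup>2) * cutoff' e b (?x w))" for v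
    by (intro integrable_continuous_cball continuous_on_compose2[OF continuous_on_cutoff(2)[OF e]] continuous_intros) auto
  have "?I = (LINT w|?M. 2 * of_real ((inner w v)\<^sup>2) * cutoff' e b (?x w))" if v: "v \<in> Basis" for v
  proof -
    have "(LINT w|?M. of_real (inner v v) * cutoff e b (?x w) - 2 * of_real (inner w v) * of_real (inner w v) * cutoff' e b (?x w)) = 0"
      by (rule cutoff_integration_by_parts[OF open_UNIV _ r e, where G' = "\<lambda>w h. of_real (inner h v)"])
         (auto intro!: derivative_eq_intros has_derivative_of_real continuous_intros)
    then have "(LINT w|?M. cutoff e b (?x w) - 2 * of_real ((inner w v)\<^sup>2) * cutoff' e b (?x w)) = 0"
      using v by (simp add: power2_eq_square mult.assoc)
    then show ?thesis using int1 int2 by simp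
  qed
  then have "(\<Sum>v\<in>(Basis :: (complex ^ 'n) set). ?I)
      = (\<Sum>v\<in>Basis. LINT w|?M. 2 * of_real ((inner w v)\<^sup>2) * cutoff' e b (?x w))"
    by (rule sum.cong[OF refl])
  also have "\<dots> = (LINT w|?M. (\<Sum>v\<in>Basis. 2 * of_real ((inner w v)\<^sup>2) * cutoff' e b (?x w)))"
    using int2 by (subst Bochner_Integration.integral_sum) auto
  also have "(\<lambda>w. (\<Sum>v\<in>Basis. 2 * of_real ((inner w v)\<^sup>2) * cutoff' e b (?x w)))
      = (\<lambda>w :: complex ^ 'n. 2 * (of_real ((norm w)\<^sup>2) * cutoff' e b (?x w)))"
    unfolding sum_distrib_right[symmetric] sum_distrib_left[symmetric] of_real_sum[symmetric] sum_inner_Basis_square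
    by (simp add: mult.assoc)
  also have "(\<Sum>v\<in>(Basis :: (complex ^ 'n) set). ?I) = 2 * (of_nat CARD('n) * ?I)" by simp
  finally show ?thesis by simp
qed

lemma finite_measure_lebesgue_on_ball: "finite_measure (lebesgue_on (ball 0 r :: 'a :: euclidean_space set))"
  by (rule finite_measure_lebesgue_on) simp

text \<open>
  For negative \<open>t\<close> the weight is unbounded. The derivative of the cutoff is at least
  \<open>(t + 1) max 0 (x - e) x powr (t - 1)\<close>, which increases to \<open>(t + 1) x powr t\<close>, whereas
  \<open>cutoff_mass_identity\<close> bounds the integral of \<open>|w|\<^sup>2\<close> times this derivative independently of \<open>e\<close>.
  Fatou's lemma then gives integrability away from the centre, where \<open>|w|\<^sup>2\<close> vanishes but the
  weight is bounded.
\<close>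

lemma integrable_defect_powr:
  assumes r: "r > 0" and t: "t > -1"
  shows "integrable (lebesgue_on (ball 0 r)) (\<lambda>w :: complex ^ 'n. (defect r w) powr t)"
proof -
  let ?M = "lebesgue_on (ball 0 r :: (complex ^ 'n) set)"
  let ?x = "\<lambda>w :: complex ^ 'n. defect r w"
  interpret finite_measure ?M by (rule finite_measure_lebesgue_on_ball)
  have meas: "(\<lambda>w. ?x w powr s) \<in> borel_measurable ?M" for s
  proof (rule continuous_imp_measurable_on_sets_lebesgue)
    have nz: "?x w \<noteq> 0" if "w \<in> ball 0 r" for w using defect_pos[OF that] by simp
    show "continuous_on (ball 0 r) (\<lambda>w. ?x w powr s)"
      using nz by (intro continuous_intros) auto
  qed simp
  show ?thesis
  proof (cases "t \<ge> 0")
    case True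
    show ?thesis
    proof (rule integrable_const_bound[of _ "r\<^sup>2 powr t"], intro AE_I2)
      fix w assume "w \<in> space ?M"
      then have "?x w > 0" using defect_pos by auto
      then show "norm (?x w powr t) \<le> r\<^sup>2 powr t"
        using True powr_mono2[of t "?x w" "r\<^sup>2"] by simp
    qed (rule meas)
  next
    case False
    define f where "f = (\<lambda>k w. (norm w)\<^sup>2 * (max 0 (?x w - 1 / real (Suc k)) * ?x w powr (t - 1)))"
    define D where "D = CARD('n) * (measure ?M (space ?M) * r\<^sup>2 powr (t + 1)) / (t + 1)"
    have f_nonneg: "f k w \<ge> 0" for k w by (simp add: f_def)
    have f_meas: "f k \<in> borel_measurable ?M" for k
      unfolding f_def
      by (intro borel_measurable_times borel_measurable_max borel_measurable_diff borel_measurable_const meas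
           continuous_imp_measurable_on_sets_lebesgue continuous_intros) auto
    have f_bound: "(\<integral>\<^sup>+w. ennreal (f k w) \<partial>?M) \<le> ennreal D" for k
    proof -
      let ?e = "1 / real (Suc k)"
      have e: "?e > 0" by simp
      have int_c: "integrable ?M (\<lambda>w. cutoff ?e t (?x w))"
        by (intro integrable_continuous_cball continuous_on_compose2[OF continuous_on_cutoff(1)[OF e]] continuous_intros) auto
      have int_c': "integrable ?M (\<lambda>w. of_real ((norm w)\<^sup>2) * cutoff' ?e t (?x w))"
        by (intro integrable_continuous_cball continuous_on_compose2[OF continuous_on_cutoff(2)[OF e]] continuous_intros) auto
      have le: "(t + 1) * f k w \<le> Re (of_real ((norm w)\<^sup>2) * cutoff' ?e t (?x w))" if "w \<in> ball 0 r" for w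
      proof -
        have x: "?x w > 0" by (rule defect_pos[OF that])
        let ?m = "max 0 (?x w - ?e)"
        have m: "0 \<le> ?m" "?m \<le> ?x w" using x by auto
        have P: "?x w * ?x w powr (t - 2) = ?x w powr (t - 1)"
          using x powr_add[of "?x w" 1 "t - 2"] by simp
        have "Re (cutoff' ?e t (?x w)) = 2 * ?m * ?x w powr (t - 1) + ?m\<^sup>2 * ((t - 1) * ?x w powr (t - 2))"
        proof -
          have 1: "complex_of_real (?x w) powr (of_real t - 1) = of_real (?x w powr (t - 1))"
            using powr_of_real[of "?x w" "t - 1"] x by simp
          have 2: "complex_of_real (?x w) powr (of_real t - 2) = of_real (?x w powr (t - 2))"
            using powr_of_real[of "?x w" "t - 2"] x by simp
          have "cutoff' ?e t (?x w) = of_real (2 * ?m * ?x w powr (t - 1) + ?m\<^sup>2 * ((t - 1) * ?x w powr (t - 2)))"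
            unfolding cutoff'_def 1 2 by simp
          then show ?thesis by simp
        qed
        moreover have "?m * ((1 - t) * ?m * ?x w powr (t - 2)) \<le> ?m * ((1 - t) * ?x w * ?x w powr (t - 2))"
          using m False by (intro mult_left_mono mult_right_mono) auto
        then have "?m * ((1 - t) * ?m * ?x w powr (t - 2)) \<le> ?m * ((1 - t) * ?x w powr (t - 1))"
          by (simp only: mult.assoc P)
        ultimately have "Re (cutoff' ?e t (?x w)) \<ge> (t + 1) * (?m * ?x w powr (t - 1))"
          by (simp add: power2_eq_square algebra_simps)
        then have "(norm w)\<^sup>2 * ((t + 1) * (?m * ?x w powr (t - 1))) \<le> (norm w)\<^sup>2 * Re (cutoff' ?e t (?x w))"
          by (intro mult_left_mono) auto
        then show ?thesis by (simp add: f_def algebra_simps)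
      qed
      have norm_f: "norm ((t + 1) * f k w) \<le> norm (of_real ((norm w)\<^sup>2) * cutoff' ?e t (?x w))" if "w \<in> ball 0 r" for w
      proof -
        have "norm ((t + 1) * f k w) = (t + 1) * f k w" using t f_nonneg[of k w] by simp
        also have "\<dots> \<le> norm (of_real ((norm w)\<^sup>2) * cutoff' ?e t (?x w))"
          using le[OF that] complex_Re_le_cmod order_trans by blast
        finally show ?thesis .
      qed
      have int_f: "integrable ?M (\<lambda>w. (t + 1) * f k w)"
        by (rule Bochner_Integration.integrable_bound[OF int_c'])
           (use f_meas norm_f in \<open>auto intro!: AE_I2\<close>)
      have "(LINT w|?M. (t + 1) * f k w) \<le> (LINT w|?M. Re (of_real ((norm w)\<^sup>2) * cutoff' ?e t (?x w)))"
        by (rule integral_mono[OF int_f integrable_Re[OF int_c']]) (use le in auto)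
      also have "\<dots> = Re (LINT w|?M. of_real ((norm w)\<^sup>2) * cutoff' ?e t (?x w))"
        by (rule integral_Re[OF int_c'])
      also have "\<dots> = CARD('n) * Re (LINT w|?M. cutoff ?e t (?x w))"
        unfolding cutoff_mass_identity[OF r e, symmetric] by simp
      also have "\<dots> \<le> CARD('n) * (LINT w|?M. r\<^sup>2 powr (t + 1))"
      proof -
        have "Re (LINT w|?M. cutoff ?e t (?x w)) = (LINT w|?M. Re (cutoff ?e t (?x w)))"
          by (rule integral_Re[OF int_c, symmetric])
        also have "\<dots> \<le> (LINT w|?M. r\<^sup>2 powr (t + 1))"
        proof (rule integral_mono[OF integrable_Re[OF int_c]])
          fix w assume "w \<in> space ?M"
          then have x: "?x w > 0" using defect_pos by auto
          have "Re (cutoff ?e t (?x w)) \<le> ?x w powr (t + 1)"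
            using norm_cutoff_le(1)[OF x, of ?e t] complex_Re_le_cmod[of "cutoff ?e t (?x w)"] by simp
          also have "\<dots> \<le> r\<^sup>2 powr (t + 1)" using x t by (intro powr_mono2) auto
          finally show "Re (cutoff ?e t (?x w)) \<le> r\<^sup>2 powr (t + 1)" .
        qed simp
        finally show ?thesis by (rule mult_left_mono) simp
      qed
      finally have "(t + 1) * (LINT w|?M. f k w) \<le> D * (t + 1)" using t by (simp add: D_def)
      then have "(LINT w|?M. f k w) \<le> D" using t by (simp add: mult.commute)
      moreover have "integrable ?M (f k)" using int_f t by simp
      ultimately show ?thesis
        using f_nonneg by (subst nn_integral_eq_integral) (auto intro: ennreal_leI)
    qed
    have f_lim: "(\<lambda>k. f k w) \<longlonglongrightarrow> (norm w)\<^sup>2 * ?x w powr t" if "w \<in> ball 0 r" for w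
    proof -
      have 0: "(\<lambda>n. 1 / real (Suc n)) \<longlonglongrightarrow> 0"
        using LIMSEQ_inverse_real_of_nat by (simp add: inverse_eq_divide)
      have x: "?x w > 0" by (rule defect_pos[OF that])
      have P: "?x w * ?x w powr (t - 1) = ?x w powr t"
        using x powr_add[of "?x w" 1 "t - 1"] by simp
      have "(\<lambda>k. f k w) \<longlonglongrightarrow> (norm w)\<^sup>2 * (max 0 (?x w - 0) * ?x w powr (t - 1))"
        unfolding f_def by (intro tendsto_intros 0)
      then show ?thesis using x P by simp
    qed
    have "(\<integral>\<^sup>+w. ennreal ((norm w)\<^sup>2 * ?x w powr t) \<partial>?M) = (\<integral>\<^sup>+w. liminf (\<lambda>k. ennreal (f k w)) \<partial>?M)"
    proof (rule nn_integral_cong)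
      fix w assume "w \<in> space ?M"
      then have "(\<lambda>k. ennreal (f k w)) \<longlonglongrightarrow> ennreal ((norm w)\<^sup>2 * ?x w powr t)"
        using f_lim by (intro tendsto_ennrealI) auto
      then show "ennreal ((norm w)\<^sup>2 * ?x w powr t) = liminf (\<lambda>k. ennreal (f k w))"
        by (simp add: lim_imp_Liminf)
    qed
    also have "\<dots> \<le> liminf (\<lambda>k. \<integral>\<^sup>+w. ennreal (f k w) \<partial>?M)"
      using f_meas by (intro nn_integral_liminf) auto
    also have "\<dots> \<le> ennreal D"
      using Liminf_mono[of "\<lambda>k. \<integral>\<^sup>+w. ennreal (f k w) \<partial>?M" "\<lambda>_. ennreal D" sequentially] f_bound
      by (simp add: Liminf_const)
    finally have "(\<integral>\<^sup>+w. ennreal ((norm w)\<^sup>2 * ?x w powr t) \<partial>?M) < \<infinity>"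
      by (rule order.strict_trans1) simp
    then have int1: "integrable ?M (\<lambda>w. (norm w)\<^sup>2 * ?x w powr t)"
      by (intro integrableI_nonneg borel_measurable_times meas continuous_imp_measurable_on_sets_lebesgue continuous_intros) auto
    have "integrable ?M (\<lambda>w. (r\<^sup>2 / 2) powr t + 2 / r\<^sup>2 * ((norm w)\<^sup>2 * ?x w powr t))"
      by (intro Bochner_Integration.integrable_add integrable_mult_right int1) simp
    then show ?thesis
    proof (rule Bochner_Integration.integrable_bound[OF _ meas], intro AE_I2)
      fix w assume "w \<in> space ?M"
      then have x: "?x w > 0" using defect_pos by auto
      have "?x w powr t \<le> (r\<^sup>2 / 2) powr t + 2 / r\<^sup>2 * ((norm w)\<^sup>2 * ?x w powr t)"
      proof (cases "?x w \<ge> r\<^sup>2 / 2")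
        case True
        then have "?x w powr t \<le> (r\<^sup>2 / 2) powr t"
          using x r False by (intro powr_mono2') auto
        then show ?thesis by (simp add: add_increasing2)
      next
        case False
        then have "1 \<le> 2 / r\<^sup>2 * (norm w)\<^sup>2" using r by (simp add: field_simps)
        then have "1 * ?x w powr t \<le> (2 / r\<^sup>2 * (norm w)\<^sup>2) * ?x w powr t"
          by (rule mult_right_mono) simp
        then show ?thesis by (simp add: add_increasing)
      qed
      then show "norm (?x w powr t) \<le> norm ((r\<^sup>2 / 2) powr t + 2 / r\<^sup>2 * ((norm w)\<^sup>2 * ?x w powr t))"
        by simp
    qed
  qed
qed

abbreviation rho :: "complex ^ 'n \<Rightarrow> real"
  where "rho w \<equiv> 1 - (norm w)\<^sup>2"

definition bweight :: "real \<Rightarrow> complex \<Rightarrow> complex ^ 'n \<Rightarrow> complex"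
  where "bweight r b w = of_real (defect r w) powr b"

text \<open>
  The total mass of the weight; for complex \<open>b\<close> it is a complex number. The radius is kept general
  because functions that are holomorphic only on the open unit ball are first treated on smaller
  balls.
\<close>

definition bmass :: "(complex ^ 'n) itself \<Rightarrow> real \<Rightarrow> complex \<Rightarrow> complex"
  where "bmass _ r b = (LINT w|lebesgue_on (ball 0 r :: (complex ^ 'n) set). bweight r b w)"

lemma continuous_on_bweight: "continuous_on (ball 0 r) (bweight r b)"
proof -
  have "continuous_on {0<..} (\<lambda>x. complex_of_real x powr b)"
    by (intro continuous_intros) (auto simp: complex_nonpos_Reals_iff)
  then show ?thesis unfolding bweight_def[abs_def]
    by (rule continuous_on_compose2) (auto intro!: continuous_intros dest: defect_pos simp del: mem_ball)
qed

lemma norm_bweight: "w \<in> ball 0 r \<Longrightarrow> norm (bweight r b w) = (defect r w) powr Re b"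
  using defect_pos[of w r] by (simp only: bweight_def norm_of_real_powr less_imp_le)

lemma bweight_add_1: "w \<in> ball 0 r \<Longrightarrow> bweight r (b + 1) w = of_real (defect r w) * bweight r b w"
  using defect_pos[of w r] unfolding bweight_def by (subst powr_add) (auto simp: mult.commute)

lemma integrable_bweight_mult:
  fixes G :: "complex ^ 'n \<Rightarrow> complex"
  assumes r: "r > 0" and b: "Re b > -1" and G: "continuous_on (cball 0 r) G"
  shows "integrable (lebesgue_on (ball 0 r)) (\<lambda>w. G w * bweight r b w)"
proof -
  obtain C where C: "C > 0" "\<And>w. w \<in> cball 0 r \<Longrightarrow> norm (G w) \<le> C"
    using compact_imp_bounded[OF compact_continuous_image[OF G compact_cball]] by (auto simp: bounded_pos)
  have "integrable (lebesgue_on (ball 0 r)) (\<lambda>w :: complex ^ 'n. C * (defect r w) powr Re b)"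
    by (intro integrable_mult_right integrable_defect_powr r b)
  then show ?thesis
  proof (rule Bochner_Integration.integrable_bound)
    show "(\<lambda>w. G w * bweight r b w) \<in> borel_measurable (lebesgue_on (ball 0 r))"
      by (intro continuous_imp_measurable_on_sets_lebesgue continuous_intros continuous_on_bweight
          continuous_on_subset[OF G]) auto
    show "AE w in lebesgue_on (ball 0 r). norm (G w * bweight r b w)
        \<le> norm (C * (defect r w) powr Re b)"
      using C by (intro AE_I2) (auto simp: norm_mult norm_bweight intro!: mult_right_mono)
  qed
qed

text \<open>
  The limit \<open>e \<rightarrow> 0\<close> of the identity for the cutoffs; the boundary term disappears as long as the
  weight with exponent \<open>b\<close> is integrable.
\<close>

lemma weighted_integration_by_parts:
  fixes G :: "complex ^ 'n \<Rightarrow> complex"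
  assumes S: "open S" "cball 0 r \<subseteq> S" and r: "r > 0" and b: "Re b > -1"
    and der: "\<And>w. w \<in> S \<Longrightarrow> (G has_derivative G' w) (at w)"
    and cont: "continuous_on S (\<lambda>w. G' w v)"
  shows "(LINT w|lebesgue_on (ball 0 r). G' w v * bweight r (b + 1) w)
    = 2 * (b + 1) * (LINT w|lebesgue_on (ball 0 r). G w * of_real (inner w v) * bweight r b w)"
proof -
  let ?M = "lebesgue_on (ball 0 r :: (complex ^ 'n) set)"
  let ?x = "\<lambda>w :: complex ^ 'n. defect r w"
  have contG: "continuous_on S G"
    by (rule continuous_at_imp_continuous_on) (use der has_derivative_continuous in blast)
  have c1: "continuous_on (cball 0 r) (\<lambda>w. G' w v)" by (rule continuous_on_subset[OF cont S(2)])
  have c2: "continuous_on (cball 0 r) (\<lambda>w. 2 * G w * of_real (inner w v))"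
    by (intro continuous_intros continuous_on_subset[OF contG S(2)])
  obtain A where A: "A > 0" "\<And>w. w \<in> cball 0 r \<Longrightarrow> norm (G' w v) \<le> A"
    using compact_imp_bounded[OF compact_continuous_image[OF c1 compact_cball]] by (auto simp: bounded_pos)
  obtain B where B: "B > 0" "\<And>w. w \<in> cball 0 r \<Longrightarrow> norm (2 * G w * of_real (inner w v)) \<le> B"
    using compact_imp_bounded[OF compact_continuous_image[OF c2 compact_cball]] unfolding bounded_pos by auto
  let ?s = "\<lambda>k w. G' w v * cutoff (1 / real (Suc k)) b (?x w)
      - 2 * G w * of_real (inner w v) * cutoff' (1 / real (Suc k)) b (?x w)"
  let ?L = "\<lambda>w. G' w v * bweight r (b + 1) w - 2 * G w * of_real (inner w v) * ((b + 1) * bweight r b w)"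
  let ?d = "\<lambda>w. A * ?x w powr (Re b + 1) + B * ((2 + norm (b - 1)) * ?x w powr Re b)"
  have "(\<lambda>k. LINT w|?M. ?s k w) \<longlonglongrightarrow> (LINT w|?M. ?L w)"
  proof (rule integral_dominated_convergence[where w = ?d])
    show "?L \<in> borel_measurable ?M"
      by (intro continuous_imp_measurable_on_sets_lebesgue continuous_intros continuous_on_bweight
          continuous_on_subset[OF c1] continuous_on_subset[OF contG]) (use S in auto)
    show "?s k \<in> borel_measurable ?M" for k
      by (intro continuous_imp_measurable_on_sets_lebesgue continuous_intros
          continuous_on_subset[OF c1] continuous_on_subset[OF contG]
          continuous_on_compose2[OF continuous_on_cutoff(1)] continuous_on_compose2[OF continuous_on_cutoff(2)]) (use S in auto)
    show "integrable ?M ?d"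
      using b by (intro Bochner_Integration.integrable_add integrable_mult_right integrable_defect_powr r) auto
    show "AE w in ?M. (\<lambda>k. ?s k w) \<longlonglongrightarrow> ?L w"
    proof (intro AE_I2)
      fix w assume "w \<in> space ?M"
      then have "?x w > 0" using defect_pos by auto
      from cutoff_tendsto[OF this]
      show "(\<lambda>k. ?s k w) \<longlonglongrightarrow> ?L w"
        unfolding bweight_def by (intro tendsto_intros)
    qed
    show "AE w in ?M. norm (?s k w) \<le> ?d w" for k
    proof (intro AE_I2)
      fix w assume "w \<in> space ?M"
      then have w: "w \<in> cball 0 r" "?x w > 0" using defect_pos by auto
      have "norm (?s k w) \<le> norm (G' w v) * norm (cutoff (1 / real (Suc k)) b (?x w))
        + norm (2 * G w * of_real (inner w v)) * norm (cutoff' (1 / real (Suc k)) b (?x w))"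
        by (rule order_trans[OF norm_triangle_ineq4]) (simp add: norm_mult)
      also have "\<dots> \<le> ?d w"
        using A B w norm_cutoff_le[OF w(2), of "1 / real (Suc k)" b]
        by (intro add_mono mult_mono) auto
      finally show "norm (?s k w) \<le> ?d w" .
    qed
  qed
  moreover have "(LINT w|?M. ?s k w) = 0" for k
    by (rule cutoff_integration_by_parts[OF S r _ der cont]) auto
  ultimately have "(LINT w|?M. ?L w) = 0" by (simp add: LIMSEQ_const_iff)
  moreover have "(LINT w|?M. ?L w) = (LINT w|?M. G' w v * bweight r (b + 1) w)
      - (LINT w|?M. (2 * (b + 1)) * (G w * of_real (inner w v) * bweight r b w))"
  proof (subst Bochner_Integration.integral_diff[symmetric])
    show "integrable ?M (\<lambda>w. G' w v * bweight r (b + 1) w)"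
      using b by (intro integrable_bweight_mult r c1) auto
    show "integrable ?M (\<lambda>w. (2 * (b + 1)) * (G w * of_real (inner w v) * bweight r b w))"
      by (intro integrable_mult_right integrable_bweight_mult r b continuous_intros continuous_on_subset[OF contG S(2)])
  qed (simp add: algebra_simps)
  ultimately show ?thesis by simp
qed

lemma integrable_bweight:
  assumes "r > 0" "Re b > -1"
  shows "integrable (lebesgue_on (ball 0 r :: (complex ^ 'n) set)) (bweight r b)"
  using integrable_bweight_mult[OF assms, of "\<lambda>_. 1"] by simp

lemma pochhammer_neq_0: "Re a > 0 \<Longrightarrow> pochhammer a m \<noteq> 0"
  by (auto simp: pochhammer_eq_0_iff)

text \<open>
  Integration by parts in all coordinate directions for the linear vector field \<open>A\<close>. It is used
  for \<open>A = \<i>\<close> and for the identity.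
\<close>

lemma weighted_divergence_formula:
  fixes F :: "complex ^ 'n \<Rightarrow> complex"
  assumes F: "F holomorphic_sev_on ball 0 R" and r: "0 < r" "r < R" and b: "Re b > -1"
    and A: "bounded_linear A"
  shows "(LINT w|lebesgue_on (ball 0 r).
      (dirderiv F (A w) w + of_real (\<Sum>v\<in>Basis. inner (A v) v) * F w) * bweight r (b + 1) w)
    = 2 * (b + 1) * (LINT w|lebesgue_on (ball 0 r). F w * of_real (inner (A w) w) * bweight r b w)"
proof -
  let ?M = "lebesgue_on (ball 0 r :: (complex ^ 'n) set)"
  let ?c = "\<lambda>w v. complex_of_real (inner (A w) v)"
  let ?S = "ball 0 R :: (complex ^ 'n) set"
  let ?L = "\<lambda>v w. (?c w v * dirderiv F v w + ?c v v * F w) * bweight r (b + 1) w"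
  let ?R = "\<lambda>v w. ?c w v * F w * of_real (inner w v) * bweight r b w"
  have sub: "cball 0 r \<subseteq> ?S" using r by auto
  note contF = holomorphic_sev_on_imp_continuous_on[OF F]
  have der: "((\<lambda>w. ?c w v * F w) has_derivative (\<lambda>h. ?c w v * dirderiv F h w + ?c h v * F w)) (at w)"
    if "w \<in> ?S" for w v
    by (rule has_derivative_mult[OF _ holomorphic_sev_has_derivative(1)[OF F that]])
       (intro has_derivative_of_real has_derivative_inner_left bounded_linear_imp_has_derivative A)
  have contA: "continuous_on T A" for T by (rule linear_continuous_on[OF A])
  have cont: "continuous_on ?S (\<lambda>w. ?c w v * dirderiv F h w + ?c h v * F w)" for v h
    by (intro continuous_intros continuous_on_dirderiv[OF F] contF contA) auto
  have 1: "integrable ?M (?L v)" for v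
    using b by (intro integrable_bweight_mult r continuous_on_subset[OF cont sub]) auto
  have 2: "integrable ?M (?R v)" for v
    by (intro integrable_bweight_mult r b continuous_intros contA continuous_on_subset[OF contF sub])
  have "(LINT w|?M. ?L v w) = 2 * (b + 1) * (LINT w|?M. ?R v w)" for v
    by (rule weighted_integration_by_parts[OF open_ball sub r(1) b der cont])
  then have "(\<Sum>v\<in>Basis. LINT w|?M. ?L v w) = (\<Sum>v\<in>Basis. 2 * (b + 1) * (LINT w|?M. ?R v w))"
    by (rule sum.cong[OF refl])
  also have "\<dots> = 2 * (b + 1) * (LINT w|?M. (\<Sum>v\<in>Basis. ?R v w))"
    using 2 by (subst Bochner_Integration.integral_sum) (auto simp: sum_distrib_left)
  also have "(\<lambda>w. \<Sum>v\<in>Basis. ?R v w) = (\<lambda>w. F w * of_real (inner (A w) w) * bweight r b w)"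
  proof
    fix w
    have "complex_of_real (inner (A w) w) = (\<Sum>v\<in>Basis. ?c w v * of_real (inner w v))"
      by (subst euclidean_inner) simp
    then show "(\<Sum>v\<in>Basis. ?R v w) = F w * of_real (inner (A w) w) * bweight r b w"
      by (simp add: sum_distrib_left sum_distrib_right mult_ac)
  qed
  also have "(\<Sum>v\<in>Basis. LINT w|?M. ?L v w) = (LINT w|?M. (\<Sum>v\<in>Basis. ?L v w))"
    by (rule Bochner_Integration.integral_sum[symmetric, OF 1])
  also have "\<dots> = (LINT w|?M. (dirderiv F (A w) w + of_real (\<Sum>v\<in>Basis. inner (A v) v) * F w) * bweight r (b + 1) w)"
  proof (rule Bochner_Integration.integral_cong[OF refl])
    fix w assume "w \<in> space ?M"
    then have w: "w \<in> ?S" using r by auto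
    have "dirderiv F (\<Sum>v\<in>Basis. inner (A w) v *\<^sub>R v) w = (\<Sum>v\<in>Basis. inner (A w) v *\<^sub>R dirderiv F v w)"
      by (simp add: linear_sum[OF dirderiv_linear[OF F w]] linear_cmul[OF dirderiv_linear[OF F w]])
    then have "(\<Sum>v\<in>Basis. ?c w v * dirderiv F v w) = dirderiv F (A w) w"
      unfolding euclidean_representation by (simp add: scaleR_conv_of_real)
    then show "(\<Sum>v\<in>Basis. ?L v w) = (dirderiv F (A w) w + of_real (\<Sum>v\<in>Basis. inner (A v) v) * F w) * bweight r (b + 1) w"
      by (simp add: sum_distrib_right[symmetric] sum.distrib)
  qed
  finally show ?thesis .
qed

text \<open>
  For the field \<open>A w = \<i> w\<close> the trace vanishes and so does the derivative of the weight along it,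
  while \<open>F\<close> contributes \<open>\<i>\<close> times its radial derivative. This is the infinitesimal form of the
  invariance under rotations \<open>w \<mapsto> e\<^bsup>\<i>\<theta>\<^esup> w\<close>.
\<close>

lemma integral_radial_deriv_eq_0:
  fixes F :: "complex ^ 'n \<Rightarrow> complex"
  assumes F: "F holomorphic_sev_on ball 0 R" and r: "0 < r" "r < R" and b: "Re b > -1"
  shows "(LINT w|lebesgue_on (ball 0 r). dirderiv F w w * bweight r (b + 1) w) = 0"
proof -
  have "(LINT w|lebesgue_on (ball 0 r). \<i> * (dirderiv F w w * bweight r (b + 1) w))
     = (LINT w|lebesgue_on (ball 0 r). (dirderiv F (\<i> *s w) w
          + of_real (\<Sum>v\<in>(Basis :: (complex ^ 'n) set). inner (\<i> *s v) v) * F w) * bweight r (b + 1) w)"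
    by (rule Bochner_Integration.integral_cong[OF refl])
       (use r in \<open>simp add: inner_imag_mult_self holomorphic_sev_has_derivative(2)[OF F]\<close>)
  also have "\<dots> = 0"
    using weighted_divergence_formula[OF F r b bounded_linear_vector_cmult[of \<i>]] by (simp add: inner_imag_mult_self)
  finally show ?thesis by simp
qed

lemma continuous_dirderiv_radial:
  assumes "F holomorphic_sev_on S" "open S"
  shows "continuous_on S (\<lambda>w. dirderiv F w w)"
  using holomorphic_sev_on_imp_continuous_on[OF holomorphic_sev_on_radial_deriv[OF assms]]
  by (rule continuous_on_eq) (simp add: radial_deriv_eq[OF assms(1)])

text \<open>
  The field \<open>A w = w\<close> links the exponents \<open>b\<close> and \<open>b + 1\<close>, since \<open>|w|\<^sup>2\<close> is \<open>r\<^sup>2\<close> minus the defect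
  and the radial derivative integrates to \<open>0\<close>.
\<close>

lemma weighted_euler_identity:
  fixes F :: "complex ^ 'n \<Rightarrow> complex"
  assumes F: "F holomorphic_sev_on ball 0 R" and r: "0 < r" "r < R" and b: "Re b > -1"
  shows "(of_nat CARD('n) + b + 1) * (LINT w|lebesgue_on (ball 0 r). F w * bweight r (b + 1) w)
    = (b + 1) * of_real (r\<^sup>2) * (LINT w|lebesgue_on (ball 0 r). F w * bweight r b w)"
proof -
  let ?M = "lebesgue_on (ball 0 r :: (complex ^ 'n) set)"
  let ?I = "\<lambda>b. LINT w|?M. F w * bweight r b w"
  let ?D = "\<lambda>w. dirderiv F w w * bweight r (b + 1) w"
  have sub: "cball 0 r \<subseteq> ball 0 R" using r by auto
  have 1: "integrable ?M (\<lambda>w. F w * bweight r c w)" if "Re c > -1" for c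
    by (intro integrable_bweight_mult r that continuous_on_subset[OF holomorphic_sev_on_imp_continuous_on[OF F] sub])
  have 2: "integrable ?M ?D"
    using b by (intro integrable_bweight_mult r continuous_on_subset[OF continuous_dirderiv_radial[OF F] sub]) auto
  have "2 * of_nat CARD('n) * ?I (b + 1) = (LINT w|?M. ?D w + 2 * of_nat CARD('n) * (F w * bweight r (b + 1) w))"
    using 1[of "b + 1"] 2 b integral_radial_deriv_eq_0[OF F r b] by simp
  also have "\<dots> = (LINT w|?M. (dirderiv F w w + of_real (\<Sum>v\<in>(Basis :: (complex ^ 'n) set). inner v v) * F w) * bweight r (b + 1) w)"
    by (rule Bochner_Integration.integral_cong) (simp_all add: algebra_simps)
  also have "\<dots> = 2 * (b + 1) * (LINT w|?M. F w * of_real (inner w w) * bweight r b w)"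
    by (rule weighted_divergence_formula[OF F r b bounded_linear_ident])
  also have "(LINT w|?M. F w * of_real (inner w w) * bweight r b w)
      = (LINT w|?M. of_real (r\<^sup>2) * (F w * bweight r b w) - F w * bweight r (b + 1) w)"
  proof (rule Bochner_Integration.integral_cong[OF refl])
    fix w assume "w \<in> space ?M"
    then have "bweight r (b + 1) w = of_real (defect r w) * bweight r b w"
      by (intro bweight_add_1) simp
    then show "F w * of_real (inner w w) * bweight r b w
      = of_real (r\<^sup>2) * (F w * bweight r b w) - F w * bweight r (b + 1) w"
      by (simp add: power2_norm_eq_inner[symmetric] left_diff_distrib right_diff_distrib mult_ac)
  qed
  also have "\<dots> = of_real (r\<^sup>2) * ?I b - ?I (b + 1)"
    using 1[of b] 1[of "b + 1"] b by (subst Bochner_Integration.integral_diff) auto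
  finally have "2 * (of_nat CARD('n) * ?I (b + 1)) = 2 * ((b + 1) * (of_real (r\<^sup>2) * ?I b - ?I (b + 1)))"
    by (simp add: algebra_simps)
  then have "of_nat CARD('n) * ?I (b + 1) = (b + 1) * (of_real (r\<^sup>2) * ?I b - ?I (b + 1))"
    by (simp only: mult_left_cancel[OF zero_neq_numeral[symmetric]])
  then show ?thesis by (simp only: left_diff_distrib right_diff_distrib distrib_right mult.assoc) simp
qed

lemma bmass_add_1:
  assumes r: "r > 0" and b: "Re b > -1"
  shows "(of_nat CARD('n) + b + 1) * bmass TYPE(complex ^ 'n) r (b + 1)
    = (b + 1) * of_real (r\<^sup>2) * bmass TYPE(complex ^ 'n) r b"
  using weighted_euler_identity[OF holomorphic_sev_on_const[of 1], where r = r and R = "r + 1" and 'n = 'n] assms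
  by (simp only: bmass_def mult_1_left less_add_one simp_thms)

lemma bmass_add:
  assumes r: "r > 0" and b: "Re b > -1"
  shows "pochhammer (of_nat CARD('n) + b + 1) m * bmass TYPE(complex ^ 'n) r (b + of_nat m)
    = pochhammer (b + 1) m * of_real (r ^ (2 * m)) * bmass TYPE(complex ^ 'n) r b"
proof (induction m)
  case (Suc m)
  let ?V = "bmass TYPE(complex ^ 'n) r"
  have *: "(of_nat CARD('n) + (b + of_nat m) + 1) * ?V (b + of_nat m + 1)
    = (b + of_nat m + 1) * of_real (r\<^sup>2) * ?V (b + of_nat m)"
    by (rule bmass_add_1[OF r]) (use b in simp)
  have "pochhammer (of_nat CARD('n) + b + 1) (Suc m) * ?V (b + of_nat (Suc m))
    = pochhammer (of_nat CARD('n) + b + 1) m * ((of_nat CARD('n) + (b + of_nat m) + 1) * ?V (b + of_nat m + 1))"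
    by (simp add: pochhammer_Suc algebra_simps)
  also have "\<dots> = (b + of_nat m + 1) * of_real (r\<^sup>2) * (pochhammer (of_nat CARD('n) + b + 1) m * ?V (b + of_nat m))"
    unfolding * by (simp add: algebra_simps)
  also have "\<dots> = pochhammer (b + 1) (Suc m) * of_real (r ^ (2 * Suc m)) * ?V b"
    unfolding Suc.IH by (simp add: pochhammer_Suc algebra_simps power2_eq_square)
  finally show ?case .
qed simp

lemma bmass_real:
  assumes "r > 0" "t > -1"
  shows "bmass TYPE(complex ^ 'n) r (of_real t)
     = of_real (LINT w|lebesgue_on (ball 0 r :: (complex ^ 'n) set). (defect r w) powr t)"
proof -
  have "bmass TYPE(complex ^ 'n) r (of_real t)
     = (LINT w|lebesgue_on (ball 0 r :: (complex ^ 'n) set). of_real ((defect r w) powr t))"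
    unfolding bmass_def bweight_def
  proof (rule Bochner_Integration.integral_cong[OF refl])
    fix w assume "w \<in> space (lebesgue_on (ball 0 r :: (complex ^ 'n) set))"
    then have "defect r w \<ge> 0" using defect_pos[of w r] by simp
    then show "complex_of_real (defect r w) powr of_real t = of_real ((defect r w) powr t)"
      by (rule powr_of_real)
  qed
  then show ?thesis by simp
qed

lemma defect_integral_pos:
  assumes r: "r > 0" and t: "t > -1"
  shows "(LINT w|lebesgue_on (ball 0 r :: (complex ^ 'n) set). (defect r w) powr t) > 0"
proof -
  let ?M = "lebesgue_on (ball 0 r :: (complex ^ 'n) set)"
  have "(LINT w|?M. (defect r w) powr t) \<noteq> 0"
  proof
    assume "(LINT w|?M. (defect r w) powr t) = 0"
    then have "AE w in ?M. (defect r w) powr t = 0"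
      using integral_nonneg_eq_0_iff_AE[OF integrable_defect_powr[OF r t, where 'n = 'n]] by simp
    then have "AE w in ?M. False"
    proof (rule AE_mp, intro AE_I2 impI)
      fix w assume "w \<in> space ?M" "(defect r w) powr t = 0"
      then show False using defect_pos[of w r] by simp
    qed
    then have "emeasure ?M (space ?M) = 0"
      by (simp only: eventually_False ae_filter_eq_bot_iff)
    then have "emeasure lebesgue (ball 0 r :: (complex ^ 'n) set) = 0"
      by (simp add: emeasure_restrict_space)
    then have "negligible (ball 0 r :: (complex ^ 'n) set)"
      by (subst negligible_iff_emeasure0) auto
    then show False using open_not_negligible[of "ball 0 r :: (complex ^ 'n) set"] r by simp
  qed
  moreover have "(LINT w|?M. (defect r w) powr t) \<ge> 0" by (rule integral_nonneg_AE) simp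
  ultimately show ?thesis by linarith
qed

lemma norm_exp_i_minus_1_le: "norm (exp (\<i> * of_real u) - 1) \<le> \<bar>u\<bar>"
proof -
  have "norm (exp (\<i> * of_real u) - 1) = 2 * \<bar>sin (u / 2)\<bar>"
    by (metis dist_exp_i_1 dist_norm)
  also have "\<dots> \<le> \<bar>u\<bar>" using abs_sin_x_le_abs_x[of "u / 2"] by simp
  finally show ?thesis .
qed

lemma norm_of_real_powr_diff_le:
  assumes x: "0 < x" "x \<le> 1"
  shows "norm (complex_of_real x powr b - of_real (x powr Re b)) \<le> \<bar>Im b\<bar> * (x powr (Re b - 1) - x powr Re b)"
proof -
  have e: "complex_of_real x powr b = of_real (x powr Re b) * exp (\<i> * of_real (Im b * ln x))"
  proof -
    have "b * of_real (ln x) = of_real (Re b * ln x) + \<i> * of_real (Im b * ln x)"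
      by (simp add: complex_eq_iff)
    then show ?thesis
      using x by (simp add: powr_def exp_add exp_of_real[symmetric] Ln_of_real)
  qed
  have "norm (complex_of_real x powr b - of_real (x powr Re b)) = x powr Re b * norm (exp (\<i> * of_real (Im b * ln x)) - 1)"
  proof -
    have "complex_of_real x powr b - of_real (x powr Re b) = of_real (x powr Re b) * (exp (\<i> * of_real (Im b * ln x)) - 1)"
      unfolding e by (simp add: algebra_simps)
    then show ?thesis by (simp only: norm_mult norm_of_real) simp
  qed
  also have "\<dots> \<le> x powr Re b * \<bar>Im b * ln x\<bar>"
    by (intro mult_left_mono norm_exp_i_minus_1_le) auto
  also have "\<dots> \<le> x powr Re b * (\<bar>Im b\<bar> * (1 / x - 1))"
  proof -
    have "\<bar>ln x\<bar> \<le> 1 / x - 1"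
      using ln_le_minus_one[of "1 / x"] x by (simp add: ln_div)
    then show ?thesis by (simp add: abs_mult mult_left_mono)
  qed
  also have "\<dots> = \<bar>Im b\<bar> * (x powr (Re b - 1) - x powr Re b)"
    using x by (simp add: powr_diff field_simps)
  finally show ?thesis .
qed

text \<open>
  For real \<open>b\<close> the mass is positive. The recursion reduces the complex case to large \<open>Re b\<close>. There
  the weight concentrates at the centre, where the imaginary part of the exponent is harmless: the
  relative difference to the real mass is at most \<open>|Im b| n / Re b\<close>.
\<close>

lemma bmass_nonzero:
  assumes b: "Re b > -1"
  shows "bmass TYPE(complex ^ 'n) 1 b \<noteq> 0"
proof -
  let ?M = "lebesgue_on (ball 0 1 :: (complex ^ 'n) set)"
  let ?V = "bmass TYPE(complex ^ 'n) 1"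
  define L where "L = (\<lambda>t. LINT w|?M. (defect 1 w) powr t)"
  have L_pos: "L t > 0" if "t > -1" for t
    unfolding L_def by (rule defect_integral_pos) (use that in auto)
  have L_rec: "(CARD('n) + t) * L t = t * L (t - 1)" if "t > 0" for t :: real
  proof -
    have "complex_of_real ((CARD('n) + t) * L t) = of_real (t * L (t - 1))"
      using bmass_add_1[of 1 "of_real (t - 1)", where 'n = 'n] bmass_real[of 1 "t - 1", where 'n = 'n]
        bmass_real[of 1 t, where 'n = 'n] that
      by (simp add: L_def)
    then show ?thesis by (simp only: of_real_eq_iff)
  qed
  \<comment> \<open>The summand 1 makes up for \<open>Re b\<close>, which may be close to \<open>-1\<close>.\<close>
  obtain m :: nat where m: "real m > \<bar>Im b\<bar> * CARD('n) + 1"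
    using reals_Archimedean2 by blast
  define c where "c = b + of_nat m"
  have c: "Re c > \<bar>Im c\<bar> * CARD('n)" "Im c = Im b" "Re c > 0"
  proof -
    show "Re c > \<bar>Im c\<bar> * CARD('n)" using m b by (simp add: c_def)
    moreover have "\<bar>Im c\<bar> * CARD('n) \<ge> 0" by simp
    ultimately show "Re c > 0" by linarith
  qed (simp add: c_def)
  have "?V c - of_real (L (Re c)) = (LINT w|?M. bweight 1 c w - of_real ((defect 1 w) powr Re c))"
    unfolding L_def bmass_def using integrable_bweight[of 1 c, where 'n = 'n] integrable_defect_powr[of 1 "Re c", where 'n = 'n] c
    by (subst Bochner_Integration.integral_diff) auto
  also have "norm \<dots> \<le> (LINT w|?M. \<bar>Im c\<bar> * ((defect 1 w) powr (Re c - 1) - (defect 1 w) powr Re c))"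
  proof (rule Bochner_Integration.integral_norm_bound_integral)
    show "integrable ?M (\<lambda>w. bweight 1 c w - of_real ((defect 1 w) powr Re c))"
      using integrable_bweight[of 1 c, where 'n = 'n] integrable_defect_powr[of 1 "Re c", where 'n = 'n] c by auto
    show "integrable ?M (\<lambda>w. \<bar>Im c\<bar> * ((defect 1 w) powr (Re c - 1) - (defect 1 w) powr Re c))"
      using c by (intro integrable_mult_right Bochner_Integration.integrable_diff integrable_defect_powr) auto
    fix w assume "w \<in> space ?M"
    then have "0 < defect 1 w" using defect_pos[of w 1] by simp
    then show "norm (bweight 1 c w - of_real ((defect 1 w) powr Re c))
      \<le> \<bar>Im c\<bar> * ((defect 1 w) powr (Re c - 1) - (defect 1 w) powr Re c)"
      unfolding bweight_def by (intro norm_of_real_powr_diff_le) auto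
  qed
  also have "\<dots> = \<bar>Im c\<bar> * (L (Re c - 1) - L (Re c))"
    unfolding L_def using c integrable_defect_powr[of 1 "Re c", where 'n = 'n] integrable_defect_powr[of 1 "Re c - 1", where 'n = 'n]
    by simp
  also have "\<dots> < L (Re c)"
  proof -
    have "Re c * (\<bar>Im c\<bar> * (L (Re c - 1) - L (Re c))) = \<bar>Im c\<bar> * CARD('n) * L (Re c)"
    proof -
      have "Re c * (L (Re c - 1) - L (Re c)) = CARD('n) * L (Re c)"
        using L_rec[OF c(3)] by (simp add: algebra_simps)
      then show ?thesis by (metis mult.left_commute mult.assoc)
    qed
    also have "\<dots> < Re c * L (Re c)" using c L_pos[of "Re c"] by (intro mult_strict_right_mono) auto
    finally show ?thesis using c(3) by (simp only: mult_less_cancel_left_pos)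
  qed
  finally have "?V c \<noteq> 0" using L_pos[of "Re c"] c(3) by auto
  then have "pochhammer (of_nat CARD('n) + b + 1) m * ?V c \<noteq> 0"
    using b by (simp add: pochhammer_neq_0)
  then show ?thesis using bmass_add[OF _ b, of 1 m, where 'n = 'n] by (auto simp: c_def)
qed

lemma holomorphic_sev_on_dilate:
  assumes F: "F holomorphic_sev_on ball 0 R" and c: "norm c * R' \<le> R" and R: "R > 0"
  shows "(\<lambda>w. F (c *s w)) holomorphic_sev_on ball 0 R'"
    and "w \<in> ball 0 R' \<Longrightarrow> dirderiv (\<lambda>w. F (c *s w)) v w = c * dirderiv F v (c *s w)"
proof -
  have in_R: "c *s w \<in> ball 0 R" if "w \<in> ball 0 R'" for w
  proof (cases "c = 0")
    case False
    then have "norm c * norm w < norm c * R'" using that by simp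
    then show ?thesis using c by (simp add: norm_vector_cmult)
  qed (use R in simp)
  have der: "((\<lambda>w. F (c *s w)) has_derivative (\<lambda>v. dirderiv F (c *s v) (c *s w))) (at w)"
    if "w \<in> ball 0 R'" for w
    by (rule has_derivative_compose[OF bounded_linear_imp_has_derivative[OF bounded_linear_vector_cmult]
          holomorphic_sev_has_derivative(1)[OF F in_R[OF that]]])
  show hol: "(\<lambda>w. F (c *s w)) holomorphic_sev_on ball 0 R'"
    by (rule holomorphic_sev_onI[OF der])
       (simp_all add: holomorphic_sev_has_derivative(2)[OF F in_R])
  show "dirderiv (\<lambda>w. F (c *s w)) v w = c * dirderiv F v (c *s w)" if "w \<in> ball 0 R'"
    using holomorphic_sev_dirderiv_eq[OF der[OF that]] that
    by (simp add: holomorphic_sev_has_derivative(2)[OF F in_R])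
qed

text \<open>
  A bound that is uniform in the direction, obtained from the coordinate directions.
\<close>

lemma dirderiv_bounded:
  assumes F: "F holomorphic_sev_on S" "open S" and K: "compact K" "K \<subseteq> S"
  shows "\<exists>C\<ge>0. \<forall>w\<in>K. \<forall>v. norm (dirderiv F v w) \<le> C * norm v"
proof -
  have "\<exists>C. \<forall>w\<in>K. norm (dirderiv F e w) \<le> C" for e
    using compact_imp_bounded[OF compact_continuous_image[OF
          continuous_on_subset[OF continuous_on_dirderiv[OF F] K(2)] K(1)], of e]
    by (auto simp: bounded_iff)
  then obtain C where C: "\<And>e w. w \<in> K \<Longrightarrow> norm (dirderiv F e w) \<le> C e" by metis
  show ?thesis
  proof (intro exI conjI ballI allI)
    show "(\<Sum>e\<in>Basis. \<bar>C e\<bar>) \<ge> 0" by (intro sum_nonneg) auto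
    fix w v assume w: "w \<in> K"
    then have wS: "w \<in> S" using K by auto
    have "dirderiv F v w = dirderiv F (\<Sum>e\<in>Basis. inner v e *\<^sub>R e) w" by (simp only: euclidean_representation)
    also have "\<dots> = (\<Sum>e\<in>Basis. inner v e *\<^sub>R dirderiv F e w)"
      by (simp add: linear_sum[OF dirderiv_linear[OF F(1) wS]] linear_cmul[OF dirderiv_linear[OF F(1) wS]])
    also have "norm \<dots> \<le> (\<Sum>e\<in>Basis. \<bar>C e\<bar> * norm v)"
    proof (rule sum_norm_le)
      fix e :: "complex ^ 'a" assume e: "e \<in> Basis"
      have "norm (inner v e *\<^sub>R dirderiv F e w) \<le> norm v * \<bar>C e\<bar>"
        unfolding norm_scaleR using C[OF w, of e] Basis_le_norm[OF e, of v]
        by (intro mult_mono) auto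
      then show "norm (inner v e *\<^sub>R dirderiv F e w) \<le> \<bar>C e\<bar> * norm v" by (simp add: mult.commute)
    qed
    finally show "norm (dirderiv F v w) \<le> (\<Sum>e\<in>Basis. \<bar>C e\<bar>) * norm v"
      by (simp add: sum_distrib_right)
  qed
qed

text \<open>
  The integral of the dilate \<open>F (t w)\<close> against the weight is constant in \<open>t\<close>, because its
  \<open>t\<close>-derivative is the integral of a radial derivative divided by \<open>t\<close>. Compare \<open>t = 1\<close> with
  \<open>t = 0\<close>.
\<close>

lemma weighted_mean_value_shifted:
  fixes F :: "complex ^ 'n \<Rightarrow> complex"
  assumes F: "F holomorphic_sev_on ball 0 R" and r: "0 < r" "r < R" and b: "Re b > 0"
  shows "(LINT w|lebesgue_on (ball 0 r). F w * bweight r b w) = bmass TYPE(complex ^ 'n) r b * F 0"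
proof -
  let ?M = "lebesgue_on (ball 0 r :: (complex ^ 'n) set)"
  let ?S = "ball 0 R :: (complex ^ 'n) set"
  define q where "q = R / r"
  have q: "q > 1" using r by (simp add: q_def)
  define s where "s = (q + 1) / 2"
  have s: "1 < s" "s < q" using q by (auto simp: s_def)
  have sR: "s * r < R" using s r by (simp add: q_def field_simps)
  have in_K: "of_real t *s w \<in> cball 0 (s * r)" if "\<bar>t\<bar> \<le> s" "w \<in> cball 0 r" for t and w :: "complex ^ 'n"
    using that s r by (auto simp: norm_vector_cmult intro!: mult_mono)
  have K: "cball 0 (s * r) \<subseteq> ?S" using sR by auto
  note contF = holomorphic_sev_on_imp_continuous_on[OF F]
  obtain C where C: "C \<ge> 0" "\<And>w v. w \<in> cball 0 (s * r) \<Longrightarrow> norm (dirderiv F v w) \<le> C * norm v"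
    using dirderiv_bounded[OF F open_ball compact_cball K] by blast
  define M where "M = (\<lambda>t::real. LINT w|?M. F (of_real t *s w) * bweight r b w)"
  have int: "integrable ?M (\<lambda>w. F (of_real t *s w) * bweight r b w)" if "\<bar>t\<bar> \<le> s" for t
    by (rule integrable_bweight_mult[OF r(1)])
       (use b in_K[OF that] K in \<open>auto intro!: continuous_intros continuous_on_compose2[OF contF]\<close>)
  have Mder: "(M has_vector_derivative (LINT w|?M. dirderiv F w (of_real t *s w) * bweight r b w)) (at t)"
    if t: "\<bar>t\<bar> < s" for t
    unfolding M_def
  proof (rule has_vector_derivative_lebesgue_integral(1)[where
        B = "\<lambda>w. C * r * (defect r w) powr Re b"])
    show "s - \<bar>t\<bar> > 0" using t by simp
    show "integrable ?M (\<lambda>w. C * r * (defect r w) powr Re b)"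
      using b by (intro integrable_mult_right integrable_defect_powr r) auto
    fix u assume "\<bar>u - t\<bar> < s - \<bar>t\<bar>"
    then have u: "\<bar>u\<bar> \<le> s" by auto
    show "integrable ?M (\<lambda>w. F (of_real u *s w) * bweight r b w)" by (rule int[OF u])
    fix w assume w: "w \<in> space ?M"
    then have uw: "of_real u *s w \<in> cball 0 (s * r)" using in_K[OF u, of w] by auto
    then have uw': "0 + of_real u *s w \<in> ?S" using K by auto
    have "((\<lambda>t. F (0 + t *s w)) has_field_derivative dirderiv F w (0 + of_real u *s w)) (at (of_real u))"
      by (rule holomorphic_sev_line[OF F uw'])
    from field_vector_diff_chain_at[OF has_vector_derivative_of_real[OF DERIV_ident] this]
    have "((\<lambda>t. F (of_real t *s w)) has_vector_derivative dirderiv F w (of_real u *s w)) (at u)"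
      by (simp add: o_def)
    then show "((\<lambda>t. F (of_real t *s w) * bweight r b w) has_vector_derivative
        dirderiv F w (of_real u *s w) * bweight r b w) (at u)"
      by (rule has_vector_derivative_mult_left)
    have "norm (dirderiv F w (of_real u *s w)) \<le> C * r"
      using C(2)[OF uw, of w] C(1) w mult_left_mono[of "norm w" r C] by auto
    then show "norm (dirderiv F w (of_real u *s w) * bweight r b w) \<le> C * r * (defect r w) powr Re b"
      unfolding norm_mult using w by (simp add: norm_bweight mult_right_mono)
  qed
  have zero: "(LINT w|?M. dirderiv F w (of_real t *s w) * bweight r b w) = 0" if t: "0 < t" "t < s" for t
  proof -
    have c: "norm (complex_of_real t) * (R / t) \<le> R" using t by simp
    have R: "R > 0" using r by simp
    have "t * r < s * r" using t r by (intro mult_strict_right_mono) auto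
    then have rt: "r < R / t" using t sR by (simp add: field_simps)
    have "(LINT w|?M. dirderiv (\<lambda>w. F (of_real t *s w)) w w * bweight r (b - 1 + 1) w) = 0"
      by (rule integral_radial_deriv_eq_0[OF holomorphic_sev_on_dilate(1)[OF F c R] r(1) rt]) (use b in simp)
    also have "(LINT w|?M. dirderiv (\<lambda>w. F (of_real t *s w)) w w * bweight r (b - 1 + 1) w)
      = (LINT w|?M. of_real t * (dirderiv F w (of_real t *s w) * bweight r b w))"
      by (rule Bochner_Integration.integral_cong[OF refl], subst holomorphic_sev_on_dilate(2)[OF F c R])
         (use rt in auto)
    finally show ?thesis using t by simp
  qed
  have "M 1 = M 0"
  proof (rule has_derivative_zero_unique_strong_interval[where k = "{0}" and a = 0 and b = 1 and f = M])
    show "continuous_on {0..1} M"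
    proof (rule continuous_at_imp_continuous_on, rule ballI)
      fix t :: real assume "t \<in> {0..1}"
      then show "isCont M t" using Mder[of t] s has_vector_derivative_continuous by fastforce
    qed
    fix t :: real assume t: "t \<in> {0..1} - {0}"
    then have "(M has_vector_derivative 0) (at t)"
      using Mder[of t] zero[of t] s by auto
    then show "(M has_derivative (\<lambda>h. 0)) (at t within {0..1})"
      by (auto simp: has_vector_derivative_def intro: has_derivative_at_withinI)
  qed auto
  then show ?thesis by (simp add: M_def bmass_def mult.commute)
qed

text \<open>
  The Euler identity for \<open>F\<close> and for the constant \<open>1\<close> transfers the mean value property from
  \<open>b + 1\<close> to \<open>b\<close>, which reaches all exponents with \<open>Re b > -1\<close>.
\<close>

lemma weighted_mean_value:
  fixes F :: "complex ^ 'n \<Rightarrow> complex"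
  assumes F: "F holomorphic_sev_on ball 0 R" and r: "0 < r" "r < R" and b: "Re b > -1"
  shows "(LINT w|lebesgue_on (ball 0 r). F w * bweight r b w) = bmass TYPE(complex ^ 'n) r b * F 0"
proof -
  let ?I = "\<lambda>b. LINT w|lebesgue_on (ball 0 r). F w * bweight r b w"
  let ?V = "bmass TYPE(complex ^ 'n) r"
  have b1: "Re (b + 1) > 0" using b by simp
  have "((b + 1) * of_real (r\<^sup>2)) * ?I b = (of_nat CARD('n) + b + 1) * ?I (b + 1)"
    by (rule weighted_euler_identity[OF F r b, symmetric])
  also have "\<dots> = ((of_nat CARD('n) + b + 1) * ?V (b + 1)) * F 0"
    unfolding weighted_mean_value_shifted[OF F r b1] by simp
  also have "\<dots> = ((b + 1) * of_real (r\<^sup>2)) * (?V b * F 0)"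
    unfolding bmass_add_1[OF r(1) b] by simp
  finally have *: "((b + 1) * of_real (r\<^sup>2)) * ?I b = ((b + 1) * of_real (r\<^sup>2)) * (?V b * F 0)" .
  have "b + 1 \<noteq> 0" using b1 by (metis zero_complex.simps(1) less_irrefl)
  then have nz: "(b + 1) * of_real (r\<^sup>2) \<noteq> 0" using r by simp
  show ?thesis using * mult_left_cancel[OF nz] by blast
qed

text \<open>
  Each factor \<open>\<langle>z, w\<rangle>\<close> can be traded for a holomorphic derivative in direction \<open>z\<close>, because
  \<open>\<langle>z, w\<rangle>\<close> times the weight with exponent \<open>b\<close> is, up to a constant, the corresponding derivative
  of the weight with exponent \<open>b + 1\<close>.
\<close>

lemma moment_step:
  fixes F :: "complex ^ 'n \<Rightarrow> complex"
  assumes F: "F holomorphic_sev_on ball 0 R" and r: "0 < r" "r < R" and b: "Re b > -1"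
  shows "(b + 1) * (LINT w|lebesgue_on (ball 0 r). F w * herm z w ^ Suc m * bweight r b w)
     = (LINT w|lebesgue_on (ball 0 r). dirderiv F z w * herm z w ^ m * bweight r (b + 1) w)"
proof -
  let ?M = "lebesgue_on (ball 0 r :: (complex ^ 'n) set)"
  let ?S = "ball 0 R :: (complex ^ 'n) set"
  have sub: "cball 0 r \<subseteq> ?S" using r by auto
  note contF = holomorphic_sev_on_imp_continuous_on[OF F]
  define G where "G = (\<lambda>w. F w * herm z w ^ m)"
  define G' where "G' = (\<lambda>w h. F w * (of_nat m * herm z h * herm z w ^ (m - 1)) + dirderiv F h w * herm z w ^ m)"
  have der: "(G has_derivative G' w) (at w)" if "w \<in> ?S" for w
    unfolding G_def G'_def
    by (rule has_derivative_mult[OF holomorphic_sev_has_derivative(1)[OF F that]])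
       (intro has_derivative_power bounded_linear_imp_has_derivative bounded_linear_herm_right)
  have contG': "continuous_on ?S (\<lambda>w. G' w v)" for v
    unfolding G'_def by (intro continuous_intros contF continuous_on_dirderiv[OF F]) auto
  have contG: "continuous_on ?S G"
    unfolding G_def by (intro continuous_intros contF)
  have ibp: "(LINT w|?M. G' w v * bweight r (b + 1) w)
     = 2 * (b + 1) * (LINT w|?M. G w * of_real (inner w v) * bweight r b w)" for v
    by (rule weighted_integration_by_parts[OF open_ball sub r(1) b der contG'])
  have i1: "integrable ?M (\<lambda>w. G' w v * bweight r (b + 1) w)" for v
    using b by (intro integrable_bweight_mult r continuous_on_subset[OF contG' sub]) auto
  have i2: "integrable ?M (\<lambda>w. G w * of_real (inner w v) * bweight r b w)" for v
    by (intro integrable_bweight_mult r b continuous_intros continuous_on_subset[OF contG sub])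
  \<comment> \<open>The combination of the directions \<open>z\<close> and \<open>\<i> z\<close> that annihilates antiholomorphic factors.\<close>
  have "(LINT w|?M. (G' w z * bweight r (b + 1) w - \<i> * (G' w (\<i> *s z) * bweight r (b + 1) w)))
     = 2 * (b + 1) * (LINT w|?M. (G w * of_real (inner w z) * bweight r b w - \<i> * (G w * of_real (inner w (\<i> *s z)) * bweight r b w)))"
    using i1 i2 ibp[of z] ibp[of "\<i> *s z"] by (simp add: right_diff_distrib)
  also have "(LINT w|?M. (G' w z * bweight r (b + 1) w - \<i> * (G' w (\<i> *s z) * bweight r (b + 1) w)))
     = (LINT w|?M. 2 * (dirderiv F z w * herm z w ^ m * bweight r (b + 1) w))"
  proof (rule Bochner_Integration.integral_cong[OF refl])
    fix w assume "w \<in> space ?M"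
    then have w: "w \<in> ?S" using r by auto
    have h: "herm z (\<i> *s z) = - (\<i> * herm z z)" by (simp add: herm_cmult_right)
    have "G' w z - \<i> * G' w (\<i> *s z) = 2 * (dirderiv F z w * herm z w ^ m)"
      unfolding G'_def h holomorphic_sev_has_derivative(2)[OF F w] by (simp add: algebra_simps)
    then show "G' w z * bweight r (b + 1) w - \<i> * (G' w (\<i> *s z) * bweight r (b + 1) w)
      = 2 * (dirderiv F z w * herm z w ^ m * bweight r (b + 1) w)"
      by (metis left_diff_distrib mult.assoc)
  qed
  also have "(\<lambda>w. G w * of_real (inner w z) * bweight r b w - \<i> * (G w * of_real (inner w (\<i> *s z)) * bweight r b w))
     = (\<lambda>w. F w * herm z w ^ Suc m * bweight r b w)"
  proof
    fix w
    have h: "herm z w = of_real (inner w z) - \<i> * of_real (inner w (\<i> *s z))"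
      unfolding cnj_herm[of w z, symmetric]
      by (simp add: complex_eq_iff Re_herm[symmetric] herm_cmult_right)
    show "G w * of_real (inner w z) * bweight r b w - \<i> * (G w * of_real (inner w (\<i> *s z)) * bweight r b w)
      = F w * herm z w ^ Suc m * bweight r b w"
      unfolding power_Suc G_def by (subst (2) h) (simp add: algebra_simps)
  qed
  finally have "2 * (LINT w|?M. dirderiv F z w * herm z w ^ m * bweight r (b + 1) w)
      = 2 * ((b + 1) * (LINT w|?M. F w * herm z w ^ Suc m * bweight r b w))"
    by (simp add: algebra_simps)
  then show ?thesis
    by (simp only: mult_left_cancel[OF zero_neq_numeral[symmetric]])
qed

text \<open>
  After \<open>m\<close> such steps no antiholomorphic factor is left and the mean value property applies to the
  \<open>m\<close>-th derivative of \<open>F\<close> in direction \<open>z\<close>.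
\<close>

lemma moment_formula:
  fixes F :: "complex ^ 'n \<Rightarrow> complex"
  assumes F: "F holomorphic_sev_on ball 0 R" and r: "0 < r" "r < R" and b: "Re b > -1"
  shows "pochhammer (of_nat CARD('n) + b + 1) m * (LINT w|lebesgue_on (ball 0 r). F w * herm z w ^ m * bweight r b w)
     = of_real (r ^ (2 * m)) * bmass TYPE(complex ^ 'n) r b * (fact m * slice_coeff F m z)"
proof -
  let ?V = "bmass TYPE(complex ^ 'n) r"
  have R: "R > 0" using r by simp
  have *: "pochhammer (b + 1) m * (LINT w|lebesgue_on (ball 0 r). F w * herm z w ^ m * bweight r b w)
     = ?V (b + of_nat m) * (deriv ^^ m) (\<lambda>t. F (t *s z)) 0"
    using F b
  proof (induction m arbitrary: F b)
    case 0
    then show ?case using weighted_mean_value[OF 0(1) r 0(2)] by simp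
  next
    case (Suc m)
    have "pochhammer (b + 1) (Suc m) * (LINT w|lebesgue_on (ball 0 r). F w * herm z w ^ Suc m * bweight r b w)
      = pochhammer (b + 1 + 1) m * ((b + 1) * (LINT w|lebesgue_on (ball 0 r). F w * herm z w ^ Suc m * bweight r b w))"
      by (simp add: pochhammer_rec mult_ac)
    also have "\<dots> = pochhammer (b + 1 + 1) m * (LINT w|lebesgue_on (ball 0 r). dirderiv F z w * herm z w ^ m * bweight r (b + 1) w)"
      unfolding moment_step[OF Suc.prems(1) r Suc.prems(2)] ..
    also have "\<dots> = ?V (b + 1 + of_nat m) * (deriv ^^ m) (\<lambda>t. dirderiv F z (t *s z)) 0"
      by (rule Suc.IH[OF holomorphic_sev_on_dirderiv[OF Suc.prems(1) open_ball]]) (use Suc.prems in simp)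
    also have "(deriv ^^ m) (\<lambda>t. dirderiv F z (t *s z)) 0 = (deriv ^^ Suc m) (\<lambda>t. F (t *s z)) 0"
      by (rule slice_coeff_dirderiv[OF Suc.prems(1) R])
    finally show ?case by (simp add: add_ac)
  qed
  have nz: "pochhammer (b + 1) m \<noteq> 0" using b by (simp add: pochhammer_neq_0)
  have "pochhammer (b + 1) m * (pochhammer (of_nat CARD('n) + b + 1) m * (LINT w|lebesgue_on (ball 0 r). F w * herm z w ^ m * bweight r b w))
     = (pochhammer (of_nat CARD('n) + b + 1) m * ?V (b + of_nat m)) * (deriv ^^ m) (\<lambda>t. F (t *s z)) 0"
    using * by (simp add: mult_ac)
  also have "\<dots> = pochhammer (b + 1) m * (of_real (r ^ (2 * m)) * ?V b * (fact m * slice_coeff F m z))"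
    unfolding bmass_add[OF r(1) b] by (simp add: slice_coeff_def)
  finally show ?thesis by (simp only: mult_left_cancel[OF nz])
qed

text \<open>
  The moment formula on balls of radius \<open>r < 1\<close> passes to the limit \<open>r \<rightarrow> 1\<close>: for \<open>Re b \<ge> 0\<close> the
  weights increase with \<open>r\<close>, so that the integrand for \<open>r = 1\<close> dominates.
\<close>

lemma moment_formula_integrable:
  fixes F :: "complex ^ 'n \<Rightarrow> complex"
  assumes F: "F holomorphic_sev_on \<B>" and b: "Re b \<ge> 0"
    and int: "integrable (lebesgue_on \<B>) (\<lambda>w. F w * bweight 1 b w)"
  shows "pochhammer (of_nat CARD('n) + b + 1) m * (LINT w|lebesgue_on \<B>. F w * herm z w ^ m * bweight 1 b w)
     = bmass TYPE(complex ^ 'n) 1 b * (fact m * slice_coeff F m z)"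
proof -
  let ?M = "lebesgue_on \<B> :: (complex ^ 'n) measure"
  let ?V = "bmass TYPE(complex ^ 'n)"
  define r where "r = (\<lambda>k::nat. 1 - 1 / real (Suc (Suc k)))"
  have r01: "0 < r k" "r k < 1" for k by (auto simp: r_def)
  have r_lim: "r \<longlonglongrightarrow> 1"
  proof -
    have "(\<lambda>k. 1 - inverse (real (Suc (Suc k)))) \<longlonglongrightarrow> 1 - 0"
      by (intro tendsto_intros LIMSEQ_Suc[OF LIMSEQ_inverse_real_of_nat])
    then show ?thesis by (simp add: r_def inverse_eq_divide)
  qed
  have b1: "Re b > -1" using b by simp
  have lim: "(\<lambda>k. LINT w|lebesgue_on (ball 0 (r k)). G w * bweight (r k) b w) \<longlonglongrightarrow> (LINT w|?M. G w * bweight 1 b w)"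
    if G: "continuous_on \<B> G" and Gint: "integrable ?M (\<lambda>w. G w * bweight 1 b w)" for G :: "complex ^ 'n \<Rightarrow> complex"
  proof -
    have "(\<lambda>k. LINT w|?M. indicator (ball 0 (r k)) w *\<^sub>R (G w * bweight (r k) b w)) \<longlonglongrightarrow> (LINT w|?M. G w * bweight 1 b w)"
    proof (rule integral_dominated_convergence[where w = "\<lambda>w. norm (G w * bweight 1 b w)"])
      show "(\<lambda>w. G w * bweight 1 b w) \<in> borel_measurable ?M" using Gint by simp
      show "integrable ?M (\<lambda>w. norm (G w * bweight 1 b w))" using Gint by simp
      fix k
      have "continuous_on (ball 0 (r k)) (\<lambda>w. G w * bweight (r k) b w)"
        using r01[of k] by (intro continuous_intros continuous_on_bweight continuous_on_subset[OF G]) auto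
      then have "(\<lambda>w. G w * bweight (r k) b w) \<in> borel_measurable (lebesgue_on (ball 0 (r k)))"
        by (rule continuous_imp_measurable_on_sets_lebesgue) simp
      then have m: "(\<lambda>w. indicator (ball 0 (r k)) w *\<^sub>R (G w * bweight (r k) b w)) \<in> borel_measurable lebesgue"
        by (subst (asm) borel_measurable_restrict_space_iff) auto
      show "(\<lambda>w. indicator (ball 0 (r k)) w *\<^sub>R (G w * bweight (r k) b w)) \<in> borel_measurable ?M"
        by (rule measurable_restrict_space1[OF m])
      show "AE w in ?M. norm (indicator (ball 0 (r k)) w *\<^sub>R (G w * bweight (r k) b w)) \<le> norm (G w * bweight 1 b w)"
      proof (intro AE_I2)
        fix w assume "w \<in> space ?M"
        show "norm (indicator (ball 0 (r k)) w *\<^sub>R (G w * bweight (r k) b w)) \<le> norm (G w * bweight 1 b w)"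
        proof (cases "w \<in> ball 0 (r k)")
          case True
          then have w1: "w \<in> ball 0 1" using r01[of k] by auto
          have le: "(r k)\<^sup>2 - (norm w)\<^sup>2 \<le> defect 1 w" using r01[of k] by (simp add: power_le_one)
          have "norm (bweight (r k) b w) \<le> norm (bweight 1 b w)"
            unfolding norm_bweight[OF True] norm_bweight[OF w1]
            using defect_pos[OF True] b by (intro powr_mono2 le) auto
          then show ?thesis using True by (simp add: norm_mult mult_left_mono)
        qed simp
      qed
    next
      show "AE w in ?M. (\<lambda>k. indicator (ball 0 (r k)) w *\<^sub>R (G w * bweight (r k) b w)) \<longlonglongrightarrow> G w * bweight 1 b w"
      proof (intro AE_I2)
        fix w assume "w \<in> space ?M"
        then have w: "norm w < 1" by simp
        have "\<forall>\<^sub>F k in sequentially. r k > norm w" using order_tendstoD(1)[OF r_lim w] .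
        then have ev: "\<forall>\<^sub>F k in sequentially. G w * bweight (r k) b w = indicator (ball 0 (r k)) w *\<^sub>R (G w * bweight (r k) b w)"
          by eventually_elim simp
        have "complex_of_real (defect 1 w) \<notin> \<real>\<^sub>\<le>\<^sub>0"
          using defect_pos[of w 1] w by (subst complex_nonpos_Reals_iff) (simp del: of_real_diff of_real_power)
        then have "(\<lambda>k. G w * bweight (r k) b w) \<longlonglongrightarrow> G w * bweight 1 b w"
          unfolding bweight_def by (intro tendsto_intros r_lim disjI1)
        then show "(\<lambda>k. indicator (ball 0 (r k)) w *\<^sub>R (G w * bweight (r k) b w)) \<longlonglongrightarrow> G w * bweight 1 b w"
          by (rule Lim_transform_eventually[OF _ ev])
      qed
    qed
    moreover have "(LINT w|?M. indicator (ball 0 (r k)) w *\<^sub>R (G w * bweight (r k) b w))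
       = (LINT w|lebesgue_on (ball 0 (r k)). G w * bweight (r k) b w)" for k
      using r01[of k] by (intro integral_lebesgue_on_subset[symmetric]) auto
    ultimately show ?thesis by simp
  qed
  note contF = holomorphic_sev_on_imp_continuous_on[OF F]
  have int_m: "integrable ?M (\<lambda>w. F w * herm z w ^ m * bweight 1 b w)"
  proof (rule Bochner_Integration.integrable_bound)
    show "integrable ?M (\<lambda>w. of_real (norm z ^ m) * (F w * bweight 1 b w))"
      by (intro integrable_mult_right int)
    show "(\<lambda>w. F w * herm z w ^ m * bweight 1 b w) \<in> borel_measurable ?M"
      by (intro continuous_imp_measurable_on_sets_lebesgue continuous_intros continuous_on_bweight contF) auto
    show "AE w in ?M. norm (F w * herm z w ^ m * bweight 1 b w) \<le> norm (of_real (norm z ^ m) * (F w * bweight 1 b w))"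
    proof (intro AE_I2)
      fix w assume "w \<in> space ?M"
      then have w: "norm w \<le> 1" by simp
      have "norm (herm z w) \<le> norm z * 1"
        using norm_herm_le[of z w] mult_left_mono[OF w, of "norm z"] by simp
      then have "norm (herm z w) ^ m \<le> norm z ^ m" by (intro power_mono) auto
      then have "norm (herm z w) ^ m * norm (F w * bweight 1 b w) \<le> norm z ^ m * norm (F w * bweight 1 b w)"
        by (rule mult_right_mono) simp
      then show "norm (F w * herm z w ^ m * bweight 1 b w) \<le> norm (of_real (norm z ^ m) * (F w * bweight 1 b w))"
        by (simp add: norm_mult norm_power mult_ac)
    qed
  qed
  have L1: "(\<lambda>k. LINT w|lebesgue_on (ball 0 (r k)). F w * herm z w ^ m * bweight (r k) b w)
      \<longlonglongrightarrow> (LINT w|?M. F w * herm z w ^ m * bweight 1 b w)"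
    by (rule lim[OF _ int_m]) (intro continuous_intros contF)
  have L2: "(\<lambda>k. ?V (r k) b) \<longlonglongrightarrow> ?V 1 b"
    using lim[of "\<lambda>_. 1"] integrable_bweight[of 1 b, where 'n = 'n] b1 by (simp add: bmass_def)
  have "(\<lambda>k. pochhammer (of_nat CARD('n) + b + 1) m * (LINT w|lebesgue_on (ball 0 (r k)). F w * herm z w ^ m * bweight (r k) b w))
      \<longlonglongrightarrow> pochhammer (of_nat CARD('n) + b + 1) m * (LINT w|?M. F w * herm z w ^ m * bweight 1 b w)"
    by (intro tendsto_intros L1)
  moreover have "(\<lambda>k. of_real (r k ^ (2 * m)) * ?V (r k) b * (fact m * slice_coeff F m z))
      \<longlonglongrightarrow> of_real (1 ^ (2 * m)) * ?V 1 b * (fact m * slice_coeff F m z)"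
    by (intro tendsto_intros L2 r_lim)
  ultimately show ?thesis
    unfolding moment_formula[OF F r01 b1] using LIMSEQ_unique by fastforce
qed

section \<open>Kernel functions\<close>

text \<open>
  For fixed \<open>z\<close> in the ball \<open>|\<langle>z, w\<rangle>| \<le> |z| < 1\<close>, so a power series in \<open>\<langle>z, w\<rangle>\<close> converges
  uniformly in \<open>w\<close> and may be integrated term by term.
\<close>

lemma sums_integral_herm_power:
  fixes \<mu> :: "complex ^ 'n \<Rightarrow> complex"
  assumes \<mu>: "integrable (lebesgue_on \<B>) \<mu>" and z: "z \<in> \<B>"
    and \<Phi>: "\<And>x. norm x < 1 \<Longrightarrow> (\<lambda>m. a m * x ^ m) sums \<Phi> x"
  shows "integrable (lebesgue_on \<B>) (\<lambda>w. \<mu> w * \<Phi> (herm z w))"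
    and "(\<lambda>m. a m * (LINT w|lebesgue_on \<B>. \<mu> w * herm z w ^ m)) sums (LINT w|lebesgue_on \<B>. \<mu> w * \<Phi> (herm z w))"
proof -
  let ?M = "lebesgue_on \<B> :: (complex ^ 'n) measure"
  have bd: "norm (herm z w) \<le> norm z" if "w \<in> space ?M" for w
    using norm_herm_le[of z w] mult_left_le[of "norm w" "norm z"] that by auto
  have meas: "(\<lambda>w. herm z w ^ m) \<in> borel_measurable ?M" for m
    by (intro continuous_imp_measurable_on_sets_lebesgue continuous_intros) auto
  have le: "norm (\<mu> w * herm z w ^ m) \<le> norm z ^ m * norm (\<mu> w)" if "w \<in> space ?M" for w m
  proof -
    have "norm (herm z w) ^ m \<le> norm z ^ m" using bd[OF that] by (intro power_mono) auto
    from mult_right_mono[OF this, of "norm (\<mu> w)"] show ?thesis by (simp add: norm_mult norm_power mult_ac)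
  qed
  have int0: "integrable ?M (\<lambda>w. \<mu> w * herm z w ^ m)" for m
  proof (rule Bochner_Integration.integrable_bound[of ?M "\<lambda>w. norm z ^ m * norm (\<mu> w)"])
    show "integrable ?M (\<lambda>w. norm z ^ m * norm (\<mu> w))"
      by (intro integrable_mult_right integrable_norm \<mu>)
    show "(\<lambda>w. \<mu> w * herm z w ^ m) \<in> borel_measurable ?M"
      using \<mu> by (intro borel_measurable_times meas) auto
    show "AE w in ?M. norm (\<mu> w * herm z w ^ m) \<le> norm (norm z ^ m * norm (\<mu> w))"
      using le by (intro AE_I2) auto
  qed
  define q where "q = (1 + norm z) / 2"
  have q: "norm z < q" "q < 1" using z by (auto simp: q_def)
  have "summable (\<lambda>m. a m * of_real q ^ m)"
    using \<Phi>[of "of_real q"] q norm_ge_zero[of z] by (auto simp: sums_iff)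
  then have "summable (\<lambda>m. norm (a m * of_real (norm z) ^ m))"
    by (rule powser_insidea) (use q norm_ge_zero[of z] in auto)
  then have sm: "summable (\<lambda>m. norm (a m) * norm z ^ m)" by (simp add: norm_mult norm_power)
  define f where "f = (\<lambda>m w. a m * (\<mu> w * herm z w ^ m))"
  have int: "integrable ?M (f m)" for m unfolding f_def by (intro integrable_mult_right int0)
  have f_le: "norm (f m w) \<le> norm (a m) * norm z ^ m * norm (\<mu> w)" if "w \<in> space ?M" for m w
    unfolding f_def norm_mult[of "a m"] mult.assoc by (intro mult_left_mono le that) simp
  have s1: "AE w in ?M. summable (\<lambda>m. norm (f m w))"
  proof (intro AE_I2)
    fix w assume "w \<in> space ?M"
    then show "summable (\<lambda>m. norm (f m w))"
      using f_le by (intro summable_comparison_test'[OF summable_mult2[OF sm, of "norm (\<mu> w)"], of 0]) auto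
  qed
  have s2: "summable (\<lambda>m. LINT w|?M. norm (f m w))"
  proof (rule summable_comparison_test'[of _ 0])
    show "summable (\<lambda>m. norm (a m) * norm z ^ m * (LINT w|?M. norm (\<mu> w)))"
      by (rule summable_mult2[OF sm])
    fix m
    have "(LINT w|?M. norm (f m w)) \<le> (LINT w|?M. norm (a m) * norm z ^ m * norm (\<mu> w))"
      by (rule integral_mono) (use int \<mu> f_le in auto)
    then show "norm (LINT w|?M. norm (f m w)) \<le> norm (a m) * norm z ^ m * (LINT w|?M. norm (\<mu> w))"
      by (simp add: integral_nonneg_AE)
  qed
  have eq: "(\<Sum>m. f m w) = \<mu> w * \<Phi> (herm z w)" if "w \<in> space ?M" for w
  proof -
    have "(\<lambda>m. \<mu> w * (a m * herm z w ^ m)) sums (\<mu> w * \<Phi> (herm z w))"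
      using norm_herm_less_1[OF z, of w] that by (intro sums_mult \<Phi>) auto
    then show ?thesis by (simp add: f_def mult_ac sums_iff)
  qed
  show "integrable ?M (\<lambda>w. \<mu> w * \<Phi> (herm z w))"
    using integrable_suminf[OF int s1 s2] by (simp only: eq cong: Bochner_Integration.integrable_cong)
  have "(\<lambda>m. LINT w|?M. f m w) sums (LINT w|?M. (\<Sum>m. f m w))" by (rule sums_integral[OF int s1 s2])
  also have "(LINT w|?M. (\<Sum>m. f m w)) = (LINT w|?M. \<mu> w * \<Phi> (herm z w))"
    by (rule Bochner_Integration.integral_cong[OF refl eq])
  finally show "(\<lambda>m. a m * (LINT w|?M. \<mu> w * herm z w ^ m)) sums (LINT w|?M. \<mu> w * \<Phi> (herm z w))"
    by (simp add: f_def)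
qed

definition pow_kernel :: "complex \<Rightarrow> complex \<Rightarrow> complex"
  where "pow_kernel \<sigma> x = (1 - x) powr (- \<sigma>)"

lemma pow_kernel_sums:
  assumes "norm x < 1"
  shows "(\<lambda>m. pochhammer \<sigma> m / fact m * x ^ m) sums pow_kernel \<sigma> x"
proof -
  have "(\<lambda>m. ((- \<sigma>) gchoose m) * (- x) ^ m) sums (1 + (- x)) powr (- \<sigma>)"
    by (rule gen_binomial_complex) (use assms in simp)
  moreover have "((- \<sigma>) gchoose m) * (- x) ^ m = pochhammer \<sigma> m / fact m * x ^ m" for m
  proof -
    have "((- \<sigma>) gchoose m) * (- x) ^ m = ((- 1) ^ m * (- 1) ^ m) * (pochhammer \<sigma> m / fact m * x ^ m)"
      unfolding gbinomial_pochhammer power_minus[of x] by (simp only: minus_minus) (simp only: mult_ac times_divide_eq_left times_divide_eq_right)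
    also have "(- 1) ^ m * (- 1) ^ m = (1 :: complex)"
      by (simp only: power_mult_distrib[symmetric]) simp
    finally show ?thesis by simp
  qed
  ultimately show ?thesis by (simp add: pow_kernel_def)
qed

lemma norm_pow_kernel_le:
  assumes "norm x < 1"
  shows "norm (pow_kernel \<tau> x) \<le> exp (\<bar>Im \<tau>\<bar> * pi) * norm (1 - x) powr (- Re \<tau>)"
proof -
  have nz: "1 - x \<noteq> 0" using assms by auto
  have "norm (pow_kernel \<tau> x) = exp (- Re \<tau> * ln (norm (1 - x)) + Im \<tau> * Im (Ln (1 - x)))"
    using nz by (simp add: pow_kernel_def powr_def)
  also have "\<dots> \<le> exp (- Re \<tau> * ln (norm (1 - x)) + \<bar>Im \<tau>\<bar> * pi)"
  proof -
    have "\<bar>Im (Ln (1 - x))\<bar> \<le> pi" using Im_Ln_le_pi[OF nz] mpi_less_Im_Ln[OF nz] by auto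
    then have "Im \<tau> * Im (Ln (1 - x)) \<le> \<bar>Im \<tau>\<bar> * pi"
      by (metis abs_ge_self abs_ge_zero abs_mult mult_left_mono order_trans)
    then show ?thesis by simp
  qed
  also have "\<dots> = exp (\<bar>Im \<tau>\<bar> * pi) * norm (1 - x) powr (- Re \<tau>)"
    using nz by (simp add: powr_def exp_add[symmetric] add.commute)
  finally show ?thesis .
qed

text \<open>
  The operator \<open>x d/dx\<close> maps \<open>(1 - x) powr -\<sigma>\<close> to
  \<open>\<sigma> (1 - x) powr -(\<sigma> + 1) - \<sigma> (1 - x) powr -\<sigma>\<close>. This is the iterated version on the level of
  Taylor coefficients.
\<close>

lemma power_mult_pochhammer_expand:
  fixes \<sigma> :: complex
  shows "\<exists>c. \<forall>m. of_nat m ^ k * pochhammer \<sigma> m = (\<Sum>i\<le>k. c i * pochhammer (\<sigma> + of_nat i) m)"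
proof (induction k)
  case 0
  show ?case by (rule exI[of _ "\<lambda>_. 1"]) simp
next
  case (Suc k)
  then obtain c where c: "\<And>m. of_nat m ^ k * pochhammer \<sigma> m = (\<Sum>i\<le>k. c i * pochhammer (\<sigma> + of_nat i) m)"
    by auto
  have step: "of_nat m * pochhammer \<tau> m = \<tau> * pochhammer (\<tau> + 1) m - \<tau> * pochhammer \<tau> m" for \<tau> :: complex and m
    using pochhammer_rec[of \<tau> m] pochhammer_Suc[of \<tau> m] by (simp add: algebra_simps)
  define d where "d = (\<lambda>i. c i * (\<sigma> + of_nat i))"
  define c' where "c' = (\<lambda>i. (if i = 0 then 0 else d (i - 1)) - (if i \<le> k then d i else 0))"
  have "of_nat m ^ Suc k * pochhammer \<sigma> m = (\<Sum>i\<le>Suc k. c' i * pochhammer (\<sigma> + of_nat i) m)" for m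
  proof -
    let ?P = "\<lambda>i. pochhammer (\<sigma> + of_nat i) m"
    have "of_nat m ^ Suc k * pochhammer \<sigma> m = (\<Sum>i\<le>k. c i * (of_nat m * ?P i))"
      using c[of m] by (simp add: sum_distrib_left mult_ac)
    also have "\<dots> = (\<Sum>i\<le>k. d i * ?P (Suc i)) - (\<Sum>i\<le>k. d i * ?P i)"
      unfolding step sum_subtractf[symmetric] by (rule sum.cong) (auto simp: d_def algebra_simps)
    also have "(\<Sum>i\<le>k. d i * ?P (Suc i)) = (\<Sum>i\<le>Suc k. (if i = 0 then 0 else d (i - 1)) * ?P i)"
      by (simp only: sum.atMost_Suc_shift) simp
    also have "(\<Sum>i\<le>k. d i * ?P i) = (\<Sum>i\<le>Suc k. (if i \<le> k then d i else 0) * ?P i)"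
      by simp
    finally show ?thesis unfolding sum_subtractf[symmetric] c'_def left_diff_distrib .
  qed
  then show ?case by blast
qed

text \<open>
  The function \<open>\<psi>\<close> is \<open>(x d/dx)\<^sup>k\<close> applied to the kernel. By the expansion above it is a
  combination of kernels with exponents \<open>\<sigma>, \<dots>, \<sigma> + k\<close>, the last of which is the largest up to a
  constant.
\<close>

lemma kernel_derivative_bound:
  "\<exists>\<psi> C. C \<ge> 0 \<and> (\<forall>x. norm x < 1 \<longrightarrow>
      (\<lambda>m. of_nat m ^ k * (pochhammer \<sigma> m / fact m) * x ^ m) sums \<psi> x \<and>
      norm (\<psi> x) \<le> C * norm (1 - x) powr (- (Re \<sigma> + real k)))"
proof -
  obtain c where c: "\<And>m. of_nat m ^ k * pochhammer \<sigma> m = (\<Sum>i\<le>k. c i * pochhammer (\<sigma> + of_nat i) m)"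
    using power_mult_pochhammer_expand by blast
  define \<psi> where "\<psi> = (\<lambda>x. \<Sum>i\<le>k. c i * pow_kernel (\<sigma> + of_nat i) x)"
  define C where "C = (\<Sum>i\<le>k. norm (c i) * (exp (\<bar>Im \<sigma>\<bar> * pi) * 2 ^ k))"
  show ?thesis
  proof (intro exI conjI allI impI)
    show "C \<ge> 0" unfolding C_def by (intro sum_nonneg) auto
    fix x :: complex assume x: "norm x < 1"
    have "(\<lambda>m. \<Sum>i\<le>k. c i * (pochhammer (\<sigma> + of_nat i) m / fact m * x ^ m)) sums \<psi> x"
      unfolding \<psi>_def by (intro sums_sum sums_mult pow_kernel_sums x)
    also have "(\<lambda>m. \<Sum>i\<le>k. c i * (pochhammer (\<sigma> + of_nat i) m / fact m * x ^ m))
        = (\<lambda>m. of_nat m ^ k * (pochhammer \<sigma> m / fact m) * x ^ m)"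
    proof
      fix m
      have "(\<Sum>i\<le>k. c i * (pochhammer (\<sigma> + of_nat i) m / fact m * x ^ m))
         = (\<Sum>i\<le>k. c i * pochhammer (\<sigma> + of_nat i) m) / fact m * x ^ m"
        unfolding sum_distrib_right sum_divide_distrib by (rule sum.cong) auto
      then show "(\<Sum>i\<le>k. c i * (pochhammer (\<sigma> + of_nat i) m / fact m * x ^ m))
         = of_nat m ^ k * (pochhammer \<sigma> m / fact m) * x ^ m" by (simp add: c[symmetric])
    qed
    finally show "(\<lambda>m. of_nat m ^ k * (pochhammer \<sigma> m / fact m) * x ^ m) sums \<psi> x" .
    have nz: "norm (1 - x) > 0" "norm (1 - x) \<le> 2"
      using x norm_triangle_ineq4[of 1 x] by auto
    have "norm (\<psi> x) \<le> (\<Sum>i\<le>k. norm (c i) * (exp (\<bar>Im \<sigma>\<bar> * pi) * 2 ^ k) * norm (1 - x) powr (- (Re \<sigma> + real k)))"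
      unfolding \<psi>_def
    proof (rule sum_norm_le)
      fix i assume "i \<in> {..k}"
      then have i: "i \<le> k" by simp
      have "norm (1 - x) powr (- Re (\<sigma> + of_nat i)) = norm (1 - x) powr real (k - i) * norm (1 - x) powr (- (Re \<sigma> + real k))"
        using i by (simp add: powr_add[symmetric] of_nat_diff algebra_simps)
      also have "\<dots> \<le> 2 ^ k * norm (1 - x) powr (- (Re \<sigma> + real k))"
      proof (rule mult_right_mono)
        have "norm (1 - x) powr real (k - i) \<le> 2 powr real (k - i)" using nz by (intro powr_mono2) auto
        also have "\<dots> \<le> 2 powr real k" by (intro powr_mono) auto
        finally show "norm (1 - x) powr real (k - i) \<le> 2 ^ k" by (simp add: powr_realpow)
      qed simp
      finally have le: "exp (\<bar>Im \<sigma>\<bar> * pi) * norm (1 - x) powr (- Re (\<sigma> + of_nat i))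
          \<le> exp (\<bar>Im \<sigma>\<bar> * pi) * (2 ^ k * norm (1 - x) powr (- (Re \<sigma> + real k)))"
        by (rule mult_left_mono) simp
      have "norm (pow_kernel (\<sigma> + of_nat i) x) \<le> exp (\<bar>Im \<sigma>\<bar> * pi) * norm (1 - x) powr (- Re (\<sigma> + of_nat i))"
        using norm_pow_kernel_le[OF x, of "\<sigma> + of_nat i"] by simp
      also note le
      finally have "norm (pow_kernel (\<sigma> + of_nat i) x) \<le> exp (\<bar>Im \<sigma>\<bar> * pi) * (2 ^ k * norm (1 - x) powr (- (Re \<sigma> + real k)))" .
      then show "norm (c i * pow_kernel (\<sigma> + of_nat i) x)
          \<le> norm (c i) * (exp (\<bar>Im \<sigma>\<bar> * pi) * 2 ^ k) * norm (1 - x) powr (- (Re \<sigma> + real k))"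
        unfolding norm_mult mult.assoc by (rule mult_left_mono) simp
    qed
    then show "norm (\<psi> x) \<le> C * norm (1 - x) powr (- (Re \<sigma> + real k))"
      by (simp only: C_def sum_distrib_right)
  qed
qed

lemma slice_coeff_radial_deriv_iterate:
  assumes "F holomorphic_sev_on \<B>"
  shows "slice_coeff ((radial_deriv ^^ k) F) m z = of_nat m ^ k * slice_coeff F m z"
  by (induction k)
     (simp_all add: slice_coeff_radial_deriv[OF holomorphic_sev_on_radial_deriv_iterate[OF assms open_ball]])

lemma iterated_radial_deriv_sums:
  assumes "F holomorphic_sev_on \<B>" "z \<in> \<B>"
  shows "(\<lambda>m. of_nat m ^ k * slice_coeff F m z) sums (radial_deriv ^^ k) F z"
  using slice_coeff_sums[OF holomorphic_sev_on_radial_deriv_iterate[OF assms(1) open_ball] assms(2), of k]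
  by (simp add: slice_coeff_radial_deriv_iterate[OF assms(1)])

lemma in_unit_ball_cmult: "z \<in> \<B> \<Longrightarrow> norm t < 1 \<Longrightarrow> t *s z \<in> \<B>"
proof -
  assume "z \<in> \<B>" "norm t < 1"
  then have "norm t * norm z \<le> 1 * norm z" by (intro mult_right_mono) auto
  then show ?thesis using \<open>z \<in> \<B>\<close> by (simp add: norm_vector_cmult)
qed

abbreviation kdecay :: "real \<Rightarrow> complex ^ 'n \<Rightarrow> complex ^ 'n \<Rightarrow> real"
  where "kdecay s z w \<equiv> norm (1 - herm z w) powr (- s)"

text \<open>
  Comparing Taylor coefficients moves radial derivatives from the integral onto the kernel, without
  differentiating under the integral sign.
\<close>

lemma radial_deriv_kernel_integral:
  fixes f :: "complex ^ 'n \<Rightarrow> complex"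
  assumes f: "f holomorphic_sev_on \<B>"
    and \<mu>: "integrable (lebesgue_on \<B>) \<mu>"
    and rep: "\<And>z. z \<in> \<B> \<Longrightarrow> f z = (LINT w|lebesgue_on \<B>. \<mu> w * pow_kernel \<sigma> (herm z w))"
  shows "\<exists>C\<ge>0. \<forall>z\<in>\<B>. ennreal (norm ((radial_deriv ^^ k) f z))
      \<le> (\<integral>\<^sup>+w. ennreal (C * (norm (\<mu> w) * kdecay (Re \<sigma> + real k) z w)) \<partial>lebesgue_on \<B>)"
proof -
  let ?M = "lebesgue_on \<B> :: (complex ^ 'n) measure"
  obtain \<psi> C where C: "C \<ge> 0"
    and \<psi>: "\<And>x. norm x < 1 \<Longrightarrow> (\<lambda>m. of_nat m ^ k * (pochhammer \<sigma> m / fact m) * x ^ m) sums \<psi> x"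
    and le: "\<And>x. norm x < 1 \<Longrightarrow> norm (\<psi> x) \<le> C * norm (1 - x) powr (- (Re \<sigma> + real k))"
    using kernel_derivative_bound[of k \<sigma>] by blast
  show ?thesis
  proof (intro exI conjI ballI)
    fix z :: "complex ^ 'n" assume z: "z \<in> \<B>"
    have coeff: "slice_coeff f m z = pochhammer \<sigma> m / fact m * (LINT w|?M. \<mu> w * herm z w ^ m)" for m
    proof (rule slice_coeff_unique[OF f zero_less_one zero_less_one])
      fix t :: complex assume t: "norm t < 1"
      have tz: "t *s z \<in> \<B>" by (rule in_unit_ball_cmult[OF z t])
      have "(\<lambda>m. pochhammer \<sigma> m / fact m * (LINT w|?M. \<mu> w * herm (t *s z) w ^ m)) sums f (t *s z)"
        unfolding rep[OF tz] by (rule sums_integral_herm_power(2)[OF \<mu> tz pow_kernel_sums])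
      moreover have "(LINT w|?M. \<mu> w * herm (t *s z) w ^ m) = (LINT w|?M. \<mu> w * herm z w ^ m) * t ^ m" for m
        by (subst integral_mult_left_zero[symmetric]) (simp add: herm_cmult_left power_mult_distrib mult_ac)
      ultimately show "(\<lambda>m. pochhammer \<sigma> m / fact m * (LINT w|?M. \<mu> w * herm z w ^ m) * t ^ m) sums f (t *s z)"
        by (simp add: mult.assoc)
    qed
    have "(\<lambda>m. of_nat m ^ k * (pochhammer \<sigma> m / fact m) * (LINT w|?M. \<mu> w * herm z w ^ m)) sums (radial_deriv ^^ k) f z"
      using iterated_radial_deriv_sums[OF f z, of k] unfolding coeff by (simp add: mult.assoc)
    moreover have "(\<lambda>m. of_nat m ^ k * (pochhammer \<sigma> m / fact m) * (LINT w|?M. \<mu> w * herm z w ^ m)) sums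
        (LINT w|?M. \<mu> w * \<psi> (herm z w))"
      by (rule sums_integral_herm_power(2)[OF \<mu> z \<psi>])
    ultimately have "(radial_deriv ^^ k) f z = (LINT w|?M. \<mu> w * \<psi> (herm z w))"
      by (rule sums_unique2)
    then have "ennreal (norm ((radial_deriv ^^ k) f z)) \<le> (\<integral>\<^sup>+w. ennreal (norm (\<mu> w * \<psi> (herm z w))) \<partial>?M)"
      using integral_norm_bound_ennreal[OF sums_integral_herm_power(1)[OF \<mu> z \<psi>]] by simp
    also have "\<dots> \<le> (\<integral>\<^sup>+w. ennreal (C * (norm (\<mu> w) * kdecay (Re \<sigma> + real k) z w)) \<partial>?M)"
    proof (intro nn_integral_mono ennreal_leI)
      fix w assume "w \<in> space ?M"
      then have "norm (\<psi> (herm z w)) \<le> C * kdecay (Re \<sigma> + real k) z w"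
        by (intro le norm_herm_less_1 z) auto
      from mult_left_mono[OF this, of "norm (\<mu> w)"]
      show "norm (\<mu> w * \<psi> (herm z w)) \<le> C * (norm (\<mu> w) * kdecay (Re \<sigma> + real k) z w)"
        by (simp add: norm_mult mult_ac)
    qed
    finally show "ennreal (norm ((radial_deriv ^^ k) f z))
      \<le> (\<integral>\<^sup>+w. ennreal (C * (norm (\<mu> w) * kdecay (Re \<sigma> + real k) z w)) \<partial>?M)" .
  qed (rule C)
qed

text \<open>
  Pairing with the kernel of exponent \<open>\<sigma>\<close> multiplies the \<open>m\<close>-th Taylor coefficient by
  \<open>(\<sigma>)\<^sub>m / (n + b + 1)\<^sub>m\<close> and by the total mass. The choice \<open>\<sigma> = n + b + 1\<close> gives the reproducing
  formula; other choices of \<open>\<sigma>\<close> represent a function by a transform of it.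
\<close>

lemma kernel_integral_sums:
  fixes F :: "complex ^ 'n \<Rightarrow> complex"
  assumes F: "F holomorphic_sev_on \<B>" and b: "Re b \<ge> 0"
    and int: "integrable (lebesgue_on \<B>) (\<lambda>w. F w * bweight 1 b w)" and z: "z \<in> \<B>"
  shows "(\<lambda>m. bmass TYPE(complex ^ 'n) 1 b * (pochhammer \<sigma> m / pochhammer (of_nat CARD('n) + b + 1) m * slice_coeff F m z))
      sums (LINT w|lebesgue_on \<B>. F w * bweight 1 b w * pow_kernel \<sigma> (herm z w))"
proof -
  have "(\<lambda>m. pochhammer \<sigma> m / fact m * (LINT w|lebesgue_on \<B>. F w * bweight 1 b w * herm z w ^ m))
    sums (LINT w|lebesgue_on \<B>. F w * bweight 1 b w * pow_kernel \<sigma> (herm z w))"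
    by (rule sums_integral_herm_power(2)[OF int z pow_kernel_sums])
  moreover have "pochhammer \<sigma> m / fact m * (LINT w|lebesgue_on \<B>. F w * bweight 1 b w * herm z w ^ m)
     = bmass TYPE(complex ^ 'n) 1 b * (pochhammer \<sigma> m / pochhammer (of_nat CARD('n) + b + 1) m * slice_coeff F m z)" for m
  proof -
    have nz: "pochhammer (of_nat CARD('n) + b + 1) m \<noteq> 0" using b by (intro pochhammer_neq_0) simp
    have "(LINT w|lebesgue_on \<B>. F w * bweight 1 b w * herm z w ^ m) = (LINT w|lebesgue_on \<B>. F w * herm z w ^ m * bweight 1 b w)"
      by (simp add: mult_ac)
    also have "\<dots> = bmass TYPE(complex ^ 'n) 1 b * (fact m * slice_coeff F m z) / pochhammer (of_nat CARD('n) + b + 1) m"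
      using moment_formula_integrable[OF F b int, of m z] nz by (simp add: field_simps)
    finally show ?thesis by (simp add: field_simps)
  qed
  ultimately show ?thesis by (simp only:)
qed

lemma reproducing_formula:
  fixes F :: "complex ^ 'n \<Rightarrow> complex"
  assumes F: "F holomorphic_sev_on \<B>" and b: "Re b \<ge> 0"
    and int: "integrable (lebesgue_on \<B>) (\<lambda>w. F w * bweight 1 b w)" and z: "z \<in> \<B>"
  shows "(LINT w|lebesgue_on \<B>. F w * bweight 1 b w * pow_kernel (of_nat CARD('n) + b + 1) (herm z w))
     = bmass TYPE(complex ^ 'n) 1 b * F z"
proof -
  have nz: "pochhammer (of_nat CARD('n) + b + 1) m \<noteq> 0" for m using b by (intro pochhammer_neq_0) simp
  have 1: "(\<lambda>m. bmass TYPE(complex ^ 'n) 1 b * slice_coeff F m z) sums (bmass TYPE(complex ^ 'n) 1 b * F z)"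
    by (intro sums_mult slice_coeff_sums[OF F z])
  have "(\<lambda>m. bmass TYPE(complex ^ 'n) 1 b * slice_coeff F m z) sums
      (LINT w|lebesgue_on \<B>. F w * bweight 1 b w * pow_kernel (of_nat CARD('n) + b + 1) (herm z w))"
    using kernel_integral_sums[OF assms, of "of_nat CARD('n) + b + 1"] nz by simp
  from sums_unique2[OF this 1] show ?thesis .
qed

section \<open>The Forelli--Rudin estimate\<close>

text \<open>
  The quotient of the two sides converges to \<open>\<Gamma>(A) \<Gamma>(B) / \<Gamma>(s)\<^sup>2\<close>, as the powers of \<open>m\<close> in
  Gauss's product cancel.
\<close>

lemma pochhammer_square_le:
  fixes A B s :: real
  assumes "A > 0" "B > 0" "2 * s = A + B"
  shows "\<exists>C. \<forall>m. (pochhammer s m)\<^sup>2 \<le> C * (pochhammer A m * pochhammer B m)"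
proof -
  have s: "s > 0" using assms by simp
  have "(\<lambda>m. Gamma_series' A m * Gamma_series' B m / (Gamma_series' s m)\<^sup>2) \<longlonglongrightarrow> Gamma A * Gamma B / (Gamma s)\<^sup>2"
    using Gamma_real_pos[OF s] by (intro tendsto_intros Gamma_series'_LIMSEQ) auto
  then have "Bseq (\<lambda>m. Gamma_series' A m * Gamma_series' B m / (Gamma_series' s m)\<^sup>2)"
    by (intro convergent_imp_Bseq convergentI)
  then obtain K where K: "\<And>m. norm (Gamma_series' A m * Gamma_series' B m / (Gamma_series' s m)\<^sup>2) \<le> K"
    by (auto simp: Bseq_def)
  show ?thesis
  proof (intro exI allI)
    fix m
    have p: "pochhammer A m > 0" "pochhammer B m > 0" "pochhammer s m > 0"
      using assms s by (auto intro!: pochhammer_pos)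
    have alg: "(f * X / a) * (f * Y / b) / (f * Z / c)\<^sup>2 = (X * Y / Z\<^sup>2) * (c\<^sup>2 / (a * b))"
      if "f \<noteq> 0" for f X Y Z a b c :: real
      using that by (simp add: field_simps power2_eq_square)
    have e: "exp (A * u) * exp (B * u) = (exp (s * u))\<^sup>2" for u
      using assms(3) by (simp add: power2_eq_square exp_add[symmetric] ring_distribs[symmetric])
    have "Gamma_series' A m * Gamma_series' B m / (Gamma_series' s m)\<^sup>2
      = (exp (A * ln (real m)) * exp (B * ln (real m)) / (exp (s * ln (real m)))\<^sup>2)
        * ((pochhammer s m)\<^sup>2 / (pochhammer A m * pochhammer B m))"
      using alg[of "fact (m - 1)"] by (simp add: Gamma_series'_def)
    also have "\<dots> = (pochhammer s m)\<^sup>2 / (pochhammer A m * pochhammer B m)"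
      unfolding e by simp
    finally have "(pochhammer s m)\<^sup>2 / (pochhammer A m * pochhammer B m) \<le> K"
      using K[of m] by (metis abs_ge_self order_trans real_norm_def)
    then show "(pochhammer s m)\<^sup>2 \<le> K * (pochhammer A m * pochhammer B m)"
      using p by (simp add: field_simps)
  qed
qed

lemma one_minus_nonpos: "norm x < 1 \<Longrightarrow> 1 - x \<notin> \<real>\<^sub>\<le>\<^sub>0" for x :: complex
  using complex_Re_le_cmod[of x] by (auto simp: complex_nonpos_Reals_iff)

lemma pow_kernel_holomorphic: "pow_kernel \<sigma> holomorphic_on ball 0 1"
  unfolding pow_kernel_def[abs_def] by (intro holomorphic_intros) (auto simp: one_minus_nonpos)

lemma cnj_pow_kernel: "norm x < 1 \<Longrightarrow> cnj (pow_kernel \<sigma> x) = pow_kernel (cnj \<sigma>) (cnj x)"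
  using one_minus_nonpos[of x] unfolding pow_kernel_def
  by (subst cnj_powr) (auto simp: complex_nonpos_Reals_iff)

lemma norm_pow_kernel_real:
  assumes "norm x < 1"
  shows "norm (pow_kernel (of_real s) x) = norm (1 - x) powr (- s)"
proof -
  have "1 - x \<noteq> 0" using assms by auto
  then show ?thesis by (simp add: pow_kernel_def powr_def)
qed

lemma pow_kernel_real_sums:
  fixes x :: real
  assumes "0 \<le> x" "x < 1"
  shows "(\<lambda>m. pochhammer c m / fact m * x ^ m) sums (1 - x) powr (- c)"
proof -
  have "(\<lambda>m. pochhammer (of_real c) m / fact m * of_real x ^ m) sums pow_kernel (of_real c) (of_real x)"
    by (rule pow_kernel_sums) (use assms in simp)
  moreover have "pochhammer (of_real c) m / fact m * of_real x ^ m = complex_of_real (pochhammer c m / fact m * x ^ m)" for m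
    by (simp add: pochhammer_of_real)
  moreover have "pow_kernel (of_real c) (of_real x) = of_real ((1 - x) powr (- c))"
    using powr_of_real[of "1 - x" "- c"] assms by (simp add: pow_kernel_def)
  ultimately show ?thesis by (simp only: sums_of_real_iff)
qed

lemma slice_coeff_kernel:
  fixes z :: "complex ^ 'n"
  assumes z: "z \<in> \<B>" and F: "(\<lambda>w. pow_kernel \<sigma> (herm w z)) holomorphic_sev_on ball 0 R" "R > 0"
  shows "slice_coeff (\<lambda>w. pow_kernel \<sigma> (herm w z)) m z = pochhammer \<sigma> m / fact m * of_real ((norm z)\<^sup>2) ^ m"
proof (rule slice_coeff_unique[OF F zero_less_one])
  fix t :: complex assume t: "norm t < 1"
  have "norm (t * of_real ((norm z)\<^sup>2)) < 1"
  proof -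
    have "(norm z)\<^sup>2 \<le> 1" using z by (intro power_le_one) auto
    then have "norm t * (norm z)\<^sup>2 \<le> norm t * 1" by (intro mult_left_mono) auto
    then show ?thesis using t by (simp add: norm_mult norm_power)
  qed
  from pow_kernel_sums[OF this, of \<sigma>]
  show "(\<lambda>m. pochhammer \<sigma> m / fact m * of_real ((norm z)\<^sup>2) ^ m * t ^ m) sums pow_kernel \<sigma> (herm (t *s z) z)"
    by (simp add: herm_cmult_left herm_self power_mult_distrib mult_ac)
qed

text \<open>
  Half of the kernel, \<open>(1 - \<langle>w, z\<rangle>) powr -s\<close>, is holomorphic in \<open>w\<close> across the closed ball and the
  other half is its conjugate, a series in \<open>\<langle>z, w\<rangle>\<close>. The moment formula evaluates the integral as
  the series with terms \<open>(s)\<^sub>m\<^sup>2 / (m! (n + t + 1)\<^sub>m) |z|\<^bsup>2m\<^esup>\<close>, up to the mass. Since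
  \<open>2 s = (n + t + 1) + c\<close>, it is dominated by the binomial series of \<open>(1 - |z|\<^sup>2) powr -c\<close>.
\<close>

lemma forelli_rudin:
  fixes t c :: real
  assumes t: "t > -1" and c: "c > 0"
  shows "\<exists>C>0. \<forall>z\<in>\<B> :: (complex ^ 'n) set.
    (\<integral>\<^sup>+w. ennreal (rho w powr t * kdecay (real CARD('n) + 1 + t + c) z w) \<partial>lebesgue_on \<B>)
      \<le> ennreal (C * rho z powr (- c))"
proof -
  let ?M = "lebesgue_on \<B> :: (complex ^ 'n) measure"
  let ?n = "real CARD('n)"
  define s where "s = (?n + 1 + t + c) / 2"
  define v where "v = (LINT w|?M. (defect 1 w) powr t)"
  have v: "v > 0" unfolding v_def by (rule defect_integral_pos) (use t in auto)
  have V: "bmass TYPE(complex ^ 'n) 1 (of_real t) = of_real v"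
    unfolding v_def by (rule bmass_real) (use t in auto)
  have A: "?n + t + 1 > 0" using t by simp
  obtain K where K: "\<And>m. (pochhammer s m)\<^sup>2 \<le> K * (pochhammer (?n + t + 1) m * pochhammer c m)"
    using pochhammer_square_le[OF A c, of s] by (auto simp: s_def)
  have K0: "K > 0" using K[of 0] by simp
  show ?thesis
  proof (intro exI conjI ballI)
    show "v * K > 0" using v K0 by simp
    fix z :: "complex ^ 'n" assume z: "z \<in> \<B>"
    obtain R where R: "R > 1" "R * norm z \<le> 1"
    proof (cases "z = 0")
      case True then show ?thesis using that[of 2] by simp
    next
      case False then show ?thesis using that[of "1 / norm z"] z by simp
    qed
    define F where "F = (\<lambda>w. pow_kernel (of_real s) (herm w z))"
    have F: "F holomorphic_sev_on ball 0 R"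
      unfolding F_def
    proof (rule holomorphic_sev_on_compose[OF pow_kernel_holomorphic open_ball])
      fix w :: "complex ^ 'n" assume w: "w \<in> ball 0 R"
      show "herm w z \<in> ball 0 1"
      proof (cases "z = 0")
        case False
        then have "norm w * norm z < R * norm z" using w by simp
        then show ?thesis using norm_herm_le[of w z] R by simp
      qed simp
    qed
    define \<mu> where "\<mu> = (\<lambda>w. F w * bweight 1 (of_real t) w)"
    have \<mu>: "integrable ?M \<mu>" unfolding \<mu>_def
      using R t by (intro integrable_bweight_mult continuous_on_subset[OF holomorphic_sev_on_imp_continuous_on[OF F]]) auto
    have eq: "\<mu> w * pow_kernel (of_real s) (herm z w)
        = of_real (rho w powr t * kdecay (?n + 1 + t + c) z w)"
      if "w \<in> space ?M" for w
    proof -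
      have w: "w \<in> \<B>" using that by simp
      have x: "norm (herm z w) < 1" by (rule norm_herm_less_1[OF z w])
      have "F w = cnj (pow_kernel (of_real s) (herm z w))"
        using cnj_pow_kernel[OF x, of "of_real s"] by (simp add: F_def cnj_herm)
      then have "F w * pow_kernel (of_real s) (herm z w) = of_real ((norm (pow_kernel (of_real s) (herm z w)))\<^sup>2)"
        by (simp only: complex_norm_square mult.commute)
      also have "(norm (pow_kernel (of_real s) (herm z w)))\<^sup>2 = kdecay (?n + 1 + t + c) z w"
        unfolding norm_pow_kernel_real[OF x] power2_eq_square powr_add[symmetric] by (simp add: s_def)
      moreover have "bweight 1 (of_real t) w = of_real (rho w powr t)"
        using powr_of_real[of "1 - (norm w)\<^sup>2" t] defect_pos[of w 1] w by (simp add: bweight_def)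
      ultimately show ?thesis by (simp add: \<mu>_def mult_ac)
    qed
    have mom: "(LINT w|?M. \<mu> w * herm z w ^ m)
        = of_real (v * pochhammer s m / pochhammer (?n + t + 1) m * ((norm z)\<^sup>2) ^ m)" for m
    proof -
      have "pochhammer (of_nat CARD('n) + of_real t + 1) m * (LINT w|?M. F w * herm z w ^ m * bweight 1 (of_real t) w)
        = of_real (1 ^ (2 * m)) * bmass TYPE(complex ^ 'n) 1 (of_real t) * (fact m * slice_coeff F m z)"
        by (rule moment_formula[OF F]) (use R t in auto)
      also have "slice_coeff F m z = pochhammer (of_real s) m / fact m * of_real ((norm z)\<^sup>2) ^ m"
        using slice_coeff_kernel[OF z F[unfolded F_def]] R by (simp add: F_def)
      also have "(LINT w|?M. F w * herm z w ^ m * bweight 1 (of_real t) w) = (LINT w|?M. \<mu> w * herm z w ^ m)"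
        by (simp add: \<mu>_def mult_ac)
      finally have e: "of_real (pochhammer (?n + t + 1) m) * (LINT w|?M. \<mu> w * herm z w ^ m)
        = of_real (v * pochhammer s m * ((norm z)\<^sup>2) ^ m)"
        unfolding V by (simp add: pochhammer_of_real[symmetric])
      have nz: "pochhammer (?n + t + 1) m \<noteq> 0" using pochhammer_pos[OF A, of m] by simp
      then have "(LINT w|?M. \<mu> w * herm z w ^ m) = of_real (v * pochhammer s m * ((norm z)\<^sup>2) ^ m) / of_real (pochhammer (?n + t + 1) m)"
        using e by (simp add: field_simps)
      then show ?thesis by simp
    qed
    define I where "I = (LINT w|?M. rho w powr t * kdecay (?n + 1 + t + c) z w)"
    define a where "a = (\<lambda>m. pochhammer s m / fact m * (v * pochhammer s m / pochhammer (?n + t + 1) m * ((norm z)\<^sup>2) ^ m))"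
    have "(\<lambda>m. pochhammer (of_real s) m / fact m * (LINT w|?M. \<mu> w * herm z w ^ m)) sums
       (LINT w|?M. \<mu> w * pow_kernel (of_real s) (herm z w))"
      by (rule sums_integral_herm_power(2)[OF \<mu> z pow_kernel_sums])
    also have "(LINT w|?M. \<mu> w * pow_kernel (of_real s) (herm z w)) = of_real I"
      unfolding I_def integral_complex_of_real[symmetric] by (rule Bochner_Integration.integral_cong[OF refl eq])
    also have "(\<lambda>m. pochhammer (of_real s) m / fact m * (LINT w|?M. \<mu> w * herm z w ^ m)) = (\<lambda>m. of_real (a m))"
      unfolding mom a_def by (simp add: pochhammer_of_real)
    finally have a_sums: "a sums I" by (simp only: sums_of_real_iff)
    have z2: "0 \<le> (norm z)\<^sup>2" "(norm z)\<^sup>2 < 1" using defect_pos[of z 1] z by auto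
    have "(\<lambda>m. v * K * (pochhammer c m / fact m * ((norm z)\<^sup>2) ^ m)) sums (v * K * rho z powr (- c))"
      by (intro sums_mult pow_kernel_real_sums z2)
    moreover have a_le: "a m \<le> v * K * (pochhammer c m / fact m * ((norm z)\<^sup>2) ^ m)" for m
    proof -
      have P: "pochhammer (?n + t + 1) m > 0" by (rule pochhammer_pos[OF A])
      have "(pochhammer s m)\<^sup>2 / pochhammer (?n + t + 1) m \<le> K * pochhammer c m"
        using K[of m] P by (simp add: divide_le_eq mult_ac)
      then have "v / fact m * ((norm z)\<^sup>2) ^ m * ((pochhammer s m)\<^sup>2 / pochhammer (?n + t + 1) m)
          \<le> v / fact m * ((norm z)\<^sup>2) ^ m * (K * pochhammer c m)"
        using v by (intro mult_left_mono) auto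
      then show ?thesis by (simp add: a_def power2_eq_square mult_ac)
    qed
    ultimately have I_le: "I \<le> v * K * rho z powr (- c)"
      using sums_le[OF a_le a_sums] by blast
    have "integrable ?M (\<lambda>w. complex_of_real (rho w powr t * kdecay (?n + 1 + t + c) z w))"
      using sums_integral_herm_power(1)[OF \<mu> z pow_kernel_sums, of "of_real s"] eq
      by (simp only: cong: Bochner_Integration.integrable_cong)
    then have int: "integrable ?M (\<lambda>w. rho w powr t * kdecay (?n + 1 + t + c) z w)"
      using complex_of_real_integrable_eq by blast
    have "(\<integral>\<^sup>+w. ennreal (rho w powr t * kdecay (?n + 1 + t + c) z w) \<partial>?M) = ennreal I"
      unfolding I_def by (rule nn_integral_eq_integral[OF int]) simp
    also have "\<dots> \<le> ennreal (v * K * rho z powr (- c))" by (rule ennreal_leI[OF I_le])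
    finally show "(\<integral>\<^sup>+w. ennreal (rho w powr t * kdecay (?n + 1 + t + c) z w) \<partial>?M)
      \<le> ennreal (v * K * rho z powr (- c))" .
  qed
qed

section \<open>A Schur test\<close>

lemma powr_tangent_le:
  fixes y c p :: real
  assumes "y \<ge> 0" "c > 0" "p \<ge> 1"
  shows "p * c powr (p - 1) * y \<le> y powr p + (p - 1) * c powr p"
proof (cases "p = 1")
  case False
  then have p: "p > 1" using assms by simp
  have "y * c powr (p - 1) \<le> y powr p / p + (c powr (p - 1)) powr (p / (p - 1)) / (p / (p - 1))"
    by (rule Youngs_inequality) (use p assms in \<open>auto simp: field_simps\<close>)
  also have "(c powr (p - 1)) powr (p / (p - 1)) = c powr p" using p by (simp add: powr_powr)
  finally have "p * (y * c powr (p - 1)) \<le> p * (y powr p / p + c powr p / (p / (p - 1)))"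
    using p by (intro mult_left_mono) auto
  also have "\<dots> = y powr p + (p - 1) * c powr p" using p by (simp add: distrib_left)
  finally show ?thesis by (simp add: mult_ac)
qed (use assms in auto)

text \<open>
  The convex function \<open>y powr p\<close> lies above its tangent at \<open>c\<close>. Used pointwise, this linear form of
  Hoelder's inequality treats \<open>p = 1\<close> and \<open>p > 1\<close> alike.
\<close>

lemma powr_tangent_weighted_le:
  fixes u \<eta> c p :: real
  assumes "u \<ge> 0" "c > 0" "p \<ge> 1" "\<eta> > 0"
  shows "p * c powr (p - 1) * u \<le> u powr p * \<eta> powr (1 - p) + (p - 1) * c powr p * \<eta>"
proof -
  have "p * c powr (p - 1) * (u / \<eta>) \<le> (u / \<eta>) powr p + (p - 1) * c powr p"
    by (rule powr_tangent_le) (use assms in auto)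
  then have "p * c powr (p - 1) * (u / \<eta>) * \<eta> \<le> ((u / \<eta>) powr p + (p - 1) * c powr p) * \<eta>"
    by (rule mult_right_mono) (use assms in auto)
  also have "\<dots> = u powr p * \<eta> powr (1 - p) + (p - 1) * c powr p * \<eta>"
    using assms by (simp add: powr_divide powr_diff distrib_right)
  finally show ?thesis using assms by simp
qed

text \<open>
  The test function of the Schur test is \<open>\<rho> powr -\<delta>\<close>. The Forelli--Rudin estimate in either variable
  constrains \<open>\<delta>\<close>, and the constraints are compatible exactly under these hypotheses.
\<close>

lemma schur_exponent:
  fixes p A B :: real
  assumes "p \<ge> 1" "p * A > -1" "p * (B + 1) > 1"
  shows "\<exists>\<delta>. - A < \<delta> \<and> \<delta> < B + 1 \<and> \<delta> * (p - 1) < A + 1 \<and> - B < \<delta> * (p - 1)"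
proof (cases "p = 1")
  case True
  then show ?thesis using assms by (intro exI[of _ 1]) auto
next
  case False
  then have p: "p > 1" using assms by simp
  have "p * (A + B + 1) > 0" using assms by (simp add: algebra_simps)
  then have AB: "A + B + 1 > 0" using p by (simp add: zero_less_mult_iff)
  have m: "p - 1 > 0" using p by simp
  have "- A * (p - 1) < A + 1" "- B < (B + 1) * (p - 1)"
    using assms(2,3) by (simp_all add: algebra_simps)
  then have "- A < (A + 1) / (p - 1)" "- B / (p - 1) < B + 1"
    by (simp_all only: pos_less_divide_eq[OF m] pos_divide_less_eq[OF m])
  moreover have "- B / (p - 1) < (A + 1) / (p - 1)"
    using p AB by (intro divide_strict_right_mono) auto
  ultimately have "max (- A) (- B / (p - 1)) < min (B + 1) ((A + 1) / (p - 1))"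
    using AB by simp
  then obtain \<delta> where "max (- A) (- B / (p - 1)) < \<delta>" "\<delta> < min (B + 1) ((A + 1) / (p - 1))"
    using dense by blast
  then show ?thesis using p by (intro exI[of _ \<delta>]) (auto simp: field_simps)
qed

lemma rho_pos: "w \<in> \<B> \<Longrightarrow> rho w > 0"
  using defect_pos[of w 1] by simp

lemma measurable_continuous_ball:
  fixes f :: "complex ^ 'n \<Rightarrow> 'b :: euclidean_space"
  shows "continuous_on \<B> f \<Longrightarrow> f \<in> borel_measurable (lebesgue_on \<B>)"
  by (rule continuous_imp_measurable_on_sets_lebesgue) simp_all

lemma continuous_on_rho_powr: "continuous_on \<B> (\<lambda>w. rho w powr t)"
  using rho_pos by (intro continuous_intros) fastforce

lemma nn_integral_rho_powr_finite:
  assumes "t > -1"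
  shows "(\<integral>\<^sup>+w. ennreal (rho (w :: complex ^ 'n) powr t) \<partial>lebesgue_on \<B>) < \<infinity>"
  using integrable_defect_powr[of 1 t, where 'n = 'n] assms
  by (simp add: integrable_iff_bounded)

text \<open>
  This plays the role of Hoelder's inequality: for \<open>p > 1\<close> the hypothesis on \<open>B\<close> says that
  \<open>\<rho> powr B\<close> belongs to the dual \<open>L\<^sup>q\<close>, and for \<open>p = 1\<close> it implies boundedness.
\<close>

lemma nn_integral_rho_powr_Lp:
  fixes u :: "complex ^ 'n \<Rightarrow> real"
  assumes p: "p \<ge> 1" and B: "p * (B + 1) > 1"
    and u: "u \<in> borel_measurable (lebesgue_on \<B>)" "\<And>w. u w \<ge> 0"
    and fin: "(\<integral>\<^sup>+w. ennreal (u w powr p) \<partial>lebesgue_on \<B>) < \<infinity>"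
  shows "(\<integral>\<^sup>+w. ennreal (u w * rho w powr B) \<partial>lebesgue_on \<B>) < \<infinity>"
proof -
  let ?M = "lebesgue_on \<B> :: (complex ^ 'n) measure"
  obtain \<delta> where d: "\<delta> < B + 1" "- B < \<delta> * (p - 1)"
    using schur_exponent[OF p _ B, of 0] by auto
  have "(\<integral>\<^sup>+w. ennreal (u w * rho w powr B) \<partial>?M)
      \<le> (\<integral>\<^sup>+w. ennreal (u w powr p) + ennreal (p - 1) * ennreal (rho w powr (B - \<delta>)) \<partial>?M)"
  proof (rule nn_integral_mono)
    fix w assume "w \<in> space ?M"
    then have r: "rho w > 0" using rho_pos by auto
    have "1 * u w \<le> p * u w" using p u(2) by (intro mult_right_mono) auto
    also have "\<dots> \<le> u w powr p * (rho w powr (- \<delta>)) powr (1 - p) + (p - 1) * (rho w powr (- \<delta>))"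
      using powr_tangent_weighted_le[OF u(2), of 1 p "rho w powr (- \<delta>)" w] p r by simp
    finally have "u w * rho w powr B \<le> (u w powr p * (rho w powr (- \<delta>)) powr (1 - p) + (p - 1) * (rho w powr (- \<delta>))) * rho w powr B"
      by (intro mult_right_mono) auto
    also have "\<dots> = u w powr p * rho w powr (B + \<delta> * (p - 1)) + (p - 1) * rho w powr (B - \<delta>)"
      using r by (simp add: powr_powr distrib_right mult.assoc powr_add[symmetric] algebra_simps)
    also have "\<dots> \<le> u w powr p * 1 + (p - 1) * rho w powr (B - \<delta>)"
      using d r by (intro add_right_mono mult_left_mono powr_le1) auto
    finally show "ennreal (u w * rho w powr B) \<le> ennreal (u w powr p) + ennreal (p - 1) * ennreal (rho w powr (B - \<delta>))"
      using p by (simp add: ennreal_mult[symmetric] ennreal_plus[symmetric] ennreal_leI del: ennreal_plus)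
  qed
  also have "\<dots> = (\<integral>\<^sup>+w. ennreal (u w powr p) \<partial>?M) + ennreal (p - 1) * (\<integral>\<^sup>+w. ennreal (rho w powr (B - \<delta>)) \<partial>?M)"
  proof -
    have "(\<lambda>w. rho w powr (B - \<delta>)) \<in> borel_measurable ?M"
      by (rule measurable_continuous_ball[OF continuous_on_rho_powr])
    then show ?thesis using u(1) by (subst nn_integral_add) (auto simp: nn_integral_cmult)
  qed
  also have "\<dots> < \<infinity>"
    using fin nn_integral_rho_powr_finite[of "B - \<delta>", where 'n = 'n] d
    by (simp add: ennreal_mult_less_top)
  finally show ?thesis .
qed

text \<open>
  Jensen's inequality for the measure \<open>k \<eta> M\<close>, of mass at most \<open>W\<close>, and the function \<open>u / \<eta>\<close>.
\<close>

lemma jensen_nn_integral: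
  fixes u \<eta> k :: "'a \<Rightarrow> real" and p W h :: real
  assumes p: "p \<ge> 1"
    and m: "k \<in> borel_measurable M" "u \<in> borel_measurable M" "\<eta> \<in> borel_measurable M"
    and k: "\<And>w. k w \<ge> 0" and u: "\<And>w. u w \<ge> 0" and \<eta>: "\<And>w. w \<in> space M \<Longrightarrow> \<eta> w > 0"
    and W: "W > 0" "(\<integral>\<^sup>+w. ennreal (k w * \<eta> w) \<partial>M) \<le> ennreal W"
    and h: "h \<ge> 0" "ennreal h \<le> (\<integral>\<^sup>+w. ennreal (k w * u w) \<partial>M)"
  shows "ennreal (h powr p)
    \<le> ennreal (W powr (p - 1)) * (\<integral>\<^sup>+w. ennreal (k w * (u w powr p * \<eta> w powr (1 - p))) \<partial>M)"
    (is "_ \<le> _ * ?J")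
proof (cases "h = 0 \<or> ?J = \<infinity>")
  case True
  then show ?thesis
  proof
    assume "?J = \<infinity>"
    then show ?thesis using W by (simp add: ennreal_mult_top)
  qed simp
next
  case False
  then have h_pos: "h > 0" using h by simp
  obtain j where j: "?J = ennreal j" "j \<ge> 0" using False by (cases ?J) auto
  \<comment> \<open>The tangent point that makes the pointwise inequality sharp for constant \<open>u / \<eta>\<close>.\<close>
  define c where "c = h / W"
  have c: "c > 0" using h_pos W by (simp add: c_def)
  have "ennreal (p * c powr (p - 1) * h) = ennreal (p * c powr (p - 1)) * ennreal h"
    using p h by (simp add: ennreal_mult)
  also have "\<dots> \<le> ennreal (p * c powr (p - 1)) * (\<integral>\<^sup>+w. ennreal (k w * u w) \<partial>M)"
    using h by (intro mult_left_mono) auto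
  also have "\<dots> = (\<integral>\<^sup>+w. ennreal (p * c powr (p - 1)) * ennreal (k w * u w) \<partial>M)"
    using m by (intro nn_integral_cmult[symmetric]) measurable
  also have "\<dots> \<le> (\<integral>\<^sup>+w. ennreal (k w * (u w powr p * \<eta> w powr (1 - p)))
      + ennreal ((p - 1) * c powr p) * ennreal (k w * \<eta> w) \<partial>M)"
  proof (rule nn_integral_mono)
    fix w assume w: "w \<in> space M"
    have "k w * (p * c powr (p - 1) * u w) \<le> k w * (u w powr p * \<eta> w powr (1 - p) + (p - 1) * c powr p * \<eta> w)"
      by (intro mult_left_mono powr_tangent_weighted_le k) (use u p c \<eta>[OF w] in auto)
    then have "p * c powr (p - 1) * (k w * u w) \<le> k w * (u w powr p * \<eta> w powr (1 - p)) + (p - 1) * c powr p * (k w * \<eta> w)"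
      by (simp add: algebra_simps)
    then show "ennreal (p * c powr (p - 1)) * ennreal (k w * u w)
      \<le> ennreal (k w * (u w powr p * \<eta> w powr (1 - p))) + ennreal ((p - 1) * c powr p) * ennreal (k w * \<eta> w)"
      using p u[of w] k[of w] \<eta>[OF w]
      by (simp add: ennreal_mult[symmetric] ennreal_plus[symmetric] ennreal_leI del: ennreal_plus)
  qed
  also have "\<dots> = ?J + ennreal ((p - 1) * c powr p) * (\<integral>\<^sup>+w. ennreal (k w * \<eta> w) \<partial>M)"
    using m by (simp add: nn_integral_add nn_integral_cmult)
  also have "\<dots> \<le> ennreal j + ennreal ((p - 1) * c powr p) * ennreal W"
    unfolding j(1) by (intro add_left_mono mult_left_mono W) auto
  also have "\<dots> = ennreal (j + (p - 1) * c powr p * W)"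
    using j(2) p W by (simp add: ennreal_mult[symmetric])
  finally have le: "p * c powr (p - 1) * h \<le> j + (p - 1) * c powr p * W"
    using j(2) p W by (subst (asm) ennreal_le_iff) (auto intro!: add_nonneg_nonneg mult_nonneg_nonneg)
  have eq: "c powr p * W = c powr (p - 1) * h"
  proof -
    have "c powr p = c * c powr (p - 1)" using c powr_add[of c 1 "p - 1"] by simp
    moreover have "c * W = h" using W by (simp add: c_def)
    ultimately show ?thesis by (simp add: mult_ac)
  qed
  have "p * (c powr (p - 1) * h) \<le> j + (p - 1) * (c powr (p - 1) * h)"
    using le by (simp only: mult.assoc eq)
  then have "c powr (p - 1) * h \<le> j" by (simp add: left_diff_distrib)
  then have "W powr (p - 1) * (c powr (p - 1) * h) \<le> W powr (p - 1) * j"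
    by (rule mult_left_mono) simp
  moreover have "W powr (p - 1) * (c powr (p - 1) * h) = h powr p"
  proof -
    have "W powr (p - 1) * c powr (p - 1) = h powr (p - 1)"
      using W h_pos by (simp add: c_def powr_mult[symmetric])
    then show ?thesis using h_pos powr_add[of h "p - 1" 1] by (simp add: mult.assoc[symmetric])
  qed
  ultimately have "h powr p \<le> W powr (p - 1) * j" by simp
  then show ?thesis using j by (simp add: ennreal_mult[symmetric] ennreal_leI)
qed

text \<open>
  The kernel of the integral operator that, after the substitution \<open>u = |g| \<rho> powr (Re \<lambda> / p)\<close>, has to
  be bounded on \<open>L\<^sup>p\<close> with respect to Lebesgue measure.
\<close>

definition schur_kernel :: "real \<Rightarrow> real \<Rightarrow> complex ^ 'n \<Rightarrow> complex ^ 'n \<Rightarrow> real"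
  where "schur_kernel A B z w = rho z powr A * rho w powr B * kdecay (real CARD('n) + 1 + A + B) z w"

lemma schur_kernel_nonneg: "schur_kernel A B z w \<ge> 0"
  by (simp add: schur_kernel_def)

lemma schur_kernel_swap: "schur_kernel A B z w = schur_kernel B A w z"
proof -
  have "norm (1 - herm z w) = norm (1 - herm w z)"
    by (metis cnj_herm complex_cnj_diff complex_cnj_one complex_mod_cnj)
  then show ?thesis by (simp add: schur_kernel_def add_ac mult_ac)
qed

lemma measurable_schur_kernel:
  "(\<lambda>x. schur_kernel A B (fst x) (snd x)) \<in> borel_measurable (lebesgue_on \<B> \<Otimes>\<^sub>M lebesgue_on \<B> :: ((complex ^ 'n) \<times> (complex ^ 'n)) measure)"
proof -
  let ?M = "lebesgue_on \<B> :: (complex ^ 'n) measure"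
  have id_m: "(\<lambda>x. x) \<in> borel_measurable ?M" by (rule measurable_continuous_ball) (rule continuous_on_id)
  have cont_m: "(\<lambda>x. f (g x)) \<in> borel_measurable N" if "continuous_on UNIV f" "g \<in> borel_measurable N"
    for f :: "complex ^ 'n \<Rightarrow> 'z :: {topological_space}" and g and N :: "'y measure"
    using measurable_compose[OF that(2) borel_measurable_continuous_onI[OF that(1)]] .
  have fst_m: "(\<lambda>x. fst x) \<in> borel_measurable (?M \<Otimes>\<^sub>M ?M)" and snd_m: "(\<lambda>x. snd x) \<in> borel_measurable (?M \<Otimes>\<^sub>M ?M)"
    using measurable_compose[OF measurable_fst id_m] measurable_compose[OF measurable_snd id_m] by auto
  have "(\<lambda>x. herm (fst x) (snd x)) \<in> borel_measurable (?M \<Otimes>\<^sub>M ?M)"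
    unfolding herm_def
    by (intro borel_measurable_sum borel_measurable_times cont_m[OF _ fst_m] cont_m[OF _ snd_m] continuous_intros)
  moreover have "(\<lambda>x. rho (fst x)) \<in> borel_measurable (?M \<Otimes>\<^sub>M ?M)" "(\<lambda>x. rho (snd x)) \<in> borel_measurable (?M \<Otimes>\<^sub>M ?M)"
    by (intro cont_m[OF _ fst_m] cont_m[OF _ snd_m] continuous_intros)+
  ultimately show ?thesis unfolding schur_kernel_def by measurable
qed

lemma measurable_schur_kernel_section: "z \<in> \<B> \<Longrightarrow> schur_kernel A B z \<in> borel_measurable (lebesgue_on \<B>)"
  using measurable_Pair2[OF measurable_schur_kernel, of z] by simp

text \<open>
  The Forelli--Rudin estimate in the form required by the Schur test: powers of \<open>\<rho>\<close> are, up to a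
  constant, supersolutions of the kernel. The other variable is covered by the symmetry above.
\<close>

lemma schur_kernel_weight:
  assumes "B - \<delta> > -1" "A + \<delta> > 0"
  obtains C where "C > 0" "\<And>z :: complex ^ 'n. z \<in> \<B> \<Longrightarrow>
    (\<integral>\<^sup>+w. ennreal (schur_kernel A B z w * rho w powr (- \<delta>)) \<partial>lebesgue_on \<B>) \<le> ennreal (C * rho z powr (- \<delta>))"
proof -
  let ?g = "\<lambda>z w. rho w powr (B - \<delta>) * kdecay (real CARD('n) + 1 + (B - \<delta>) + (A + \<delta>)) z w"
  obtain C where C: "C > 0" and C_le: "\<And>z :: complex ^ 'n. z \<in> \<B> \<Longrightarrow>
    (\<integral>\<^sup>+w. ennreal (?g z w) \<partial>lebesgue_on \<B>) \<le> ennreal (C * rho z powr (- (A + \<delta>)))"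
    using forelli_rudin[OF assms, where 'n = 'n] by auto
  have "(\<integral>\<^sup>+w. ennreal (schur_kernel A B z w * rho w powr (- \<delta>)) \<partial>lebesgue_on \<B>) \<le> ennreal (C * rho z powr (- \<delta>))"
    if z: "z \<in> \<B>" for z :: "complex ^ 'n"
  proof -
    have eq: "schur_kernel A B z w * rho w powr (- \<delta>) = rho z powr A * ?g z w" for w
      by (simp add: schur_kernel_def powr_add[symmetric] algebra_simps)
    have "(\<lambda>w. rho w powr (B - \<delta>)) \<in> borel_measurable (lebesgue_on \<B> :: (complex ^ 'n) measure)"
      by (rule measurable_continuous_ball[OF continuous_on_rho_powr])
    moreover have "(\<lambda>w. norm (1 - herm z w)) \<in> borel_measurable (lebesgue_on \<B>)"
      by (intro measurable_continuous_ball continuous_intros)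
    ultimately have "(\<lambda>w. ennreal (?g z w)) \<in> borel_measurable (lebesgue_on \<B>)" by measurable
    then have "(\<integral>\<^sup>+w. ennreal (schur_kernel A B z w * rho w powr (- \<delta>)) \<partial>lebesgue_on \<B>)
        = ennreal (rho z powr A) * (\<integral>\<^sup>+w. ennreal (?g z w) \<partial>lebesgue_on \<B>)"
      unfolding eq by (subst nn_integral_cmult[symmetric]) (simp_all add: ennreal_mult)
    also have "\<dots> \<le> ennreal (rho z powr A) * ennreal (C * rho z powr (- (A + \<delta>)))"
      by (intro mult_left_mono C_le z) auto
    also have "\<dots> = ennreal (C * rho z powr (- \<delta>))"
      using C powr_add[of "rho z" A "- (A + \<delta>)"] by (simp add: ennreal_mult[symmetric])
    finally show ?thesis .
  qed
  with C that show ?thesis by blast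
qed

lemma schur_test:
  fixes u h :: "complex ^ 'n \<Rightarrow> real"
  assumes p: "p \<ge> 1" and A: "p * A > -1" and B: "p * (B + 1) > 1"
    and u: "u \<in> borel_measurable (lebesgue_on \<B>)" "\<And>w. u w \<ge> 0"
    and fin: "(\<integral>\<^sup>+w. ennreal (u w powr p) \<partial>lebesgue_on \<B>) < \<infinity>"
    and h: "\<And>z. h z \<ge> 0"
    and le: "\<And>z. z \<in> \<B> \<Longrightarrow> ennreal (h z) \<le> (\<integral>\<^sup>+w. ennreal (schur_kernel A B z w * u w) \<partial>lebesgue_on \<B>)"
  shows "(\<integral>\<^sup>+z. ennreal (h z powr p) \<partial>lebesgue_on \<B>) < \<infinity>"
proof -
  let ?M = "lebesgue_on \<B> :: (complex ^ 'n) measure"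
  obtain \<delta> where d: "- A < \<delta>" "\<delta> < B + 1" "\<delta> * (p - 1) < A + 1" "- B < \<delta> * (p - 1)"
    using schur_exponent[OF p A B] by blast
  then have d': "B - \<delta> > -1" "A + \<delta> > 0" and d'': "A - \<delta> * (p - 1) > -1" "B + \<delta> * (p - 1) > 0"
    by linarith+
  obtain C1 where C1: "C1 > 0" and C1_le: "\<And>z :: complex ^ 'n. z \<in> \<B> \<Longrightarrow>
      (\<integral>\<^sup>+w. ennreal (schur_kernel A B z w * rho w powr (- \<delta>)) \<partial>?M) \<le> ennreal (C1 * rho z powr (- \<delta>))"
    using schur_kernel_weight[OF d', where 'n = 'n] by blast
  obtain C2 where C2: "C2 > 0" and C2_le: "\<And>w :: complex ^ 'n. w \<in> \<B> \<Longrightarrow>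
      (\<integral>\<^sup>+z. ennreal (schur_kernel B A w z * rho z powr (- (\<delta> * (p - 1)))) \<partial>?M) \<le> ennreal (C2 * rho w powr (- (\<delta> * (p - 1))))"
    using schur_kernel_weight[OF d'', where 'n = 'n] by blast
  have rho_m: "(\<lambda>w. rho w powr t) \<in> borel_measurable ?M" for t
    by (rule measurable_continuous_ball[OF continuous_on_rho_powr])
  note K_m = measurable_schur_kernel[of A B, where 'n = 'n]
  interpret finite_measure ?M by (rule finite_measure_lebesgue_on_ball)
  interpret P: pair_sigma_finite ?M ?M ..
  define v where "v = (\<lambda>w. u w powr p * rho w powr (\<delta> * (p - 1)))"
  define y where "y = (\<lambda>z :: complex ^ 'n. C1 powr (p - 1) * rho z powr (- (\<delta> * (p - 1))))"
  have v_m: "v \<in> borel_measurable ?M" unfolding v_def using u(1) rho_m[of "\<delta> * (p - 1)"] by measurable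
  have y_m: "y \<in> borel_measurable ?M" unfolding y_def using rho_m[of "- (\<delta> * (p - 1))"] by measurable
  have vy: "v w \<ge> 0" "y w \<ge> 0" for w by (auto simp: v_def y_def)
  define L where "L = (\<lambda>z w. ennreal (y z) * ennreal (schur_kernel A B z w * v w))"
  have L_m: "(\<lambda>x. L (fst x) (snd x)) \<in> borel_measurable (?M \<Otimes>\<^sub>M ?M)"
    unfolding L_def using K_m measurable_compose[OF measurable_fst y_m] measurable_compose[OF measurable_snd v_m] by measurable
  have "(\<integral>\<^sup>+z. ennreal (h z powr p) \<partial>?M) \<le> (\<integral>\<^sup>+z. (\<integral>\<^sup>+w. L z w \<partial>?M) \<partial>?M)"
  proof (rule nn_integral_mono)
    fix z assume "z \<in> space ?M"
    then have z: "z \<in> \<B>" by simp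
    note Kz = measurable_schur_kernel_section[OF z, of A B]
    have "ennreal (h z powr p) \<le> ennreal ((C1 * rho z powr (- \<delta>)) powr (p - 1))
        * (\<integral>\<^sup>+w. ennreal (schur_kernel A B z w * (u w powr p * (rho w powr (- \<delta>)) powr (1 - p))) \<partial>?M)"
    proof (rule jensen_nn_integral[OF p Kz u(1) rho_m schur_kernel_nonneg u(2) _ _ C1_le[OF z] h le[OF z]])
      show "C1 * rho z powr (- \<delta>) > 0" using C1 rho_pos[OF z] by simp
      show "rho w powr (- \<delta>) > 0" if "w \<in> space ?M" for w using rho_pos[of w] that by simp
    qed
    also have "(C1 * rho z powr (- \<delta>)) powr (p - 1) = y z"
      using C1 by (simp add: y_def powr_mult powr_powr)
    also have "(\<lambda>w. ennreal (schur_kernel A B z w * (u w powr p * (rho w powr (- \<delta>)) powr (1 - p))))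
        = (\<lambda>w. ennreal (schur_kernel A B z w * v w))"
      by (simp add: v_def powr_powr algebra_simps)
    also have "ennreal (y z) * (\<integral>\<^sup>+w. ennreal (schur_kernel A B z w * v w) \<partial>?M) = (\<integral>\<^sup>+w. L z w \<partial>?M)"
      unfolding L_def using Kz v_m by (intro nn_integral_cmult[symmetric]) measurable
    finally show "ennreal (h z powr p) \<le> (\<integral>\<^sup>+w. L z w \<partial>?M)" .
  qed
  also have "\<dots> = (\<integral>\<^sup>+w. (\<integral>\<^sup>+z. L z w \<partial>?M) \<partial>?M)"
    using P.Fubini'[of L] L_m by (simp add: split_beta')
  also have "\<dots> \<le> (\<integral>\<^sup>+w. ennreal (C1 powr (p - 1) * C2) * ennreal (u w powr p) \<partial>?M)"
  proof (rule nn_integral_mono)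
    fix w assume "w \<in> space ?M"
    then have w: "w \<in> \<B>" by simp
    let ?k = "C1 powr (p - 1) * v w"
    have "(\<integral>\<^sup>+z. L z w \<partial>?M) = (\<integral>\<^sup>+z. ennreal ?k * ennreal (schur_kernel B A w z * rho z powr (- (\<delta> * (p - 1)))) \<partial>?M)"
      unfolding L_def schur_kernel_swap[of A B _ w]
      by (intro nn_integral_cong) (simp add: y_def vy schur_kernel_nonneg ennreal_mult[symmetric] mult_ac)
    also have "\<dots> = ennreal ?k * (\<integral>\<^sup>+z. ennreal (schur_kernel B A w z * rho z powr (- (\<delta> * (p - 1)))) \<partial>?M)"
      using measurable_schur_kernel_section[OF w, of B A] rho_m[of "- (\<delta> * (p - 1))"]
      by (intro nn_integral_cmult) measurable
    also have "\<dots> \<le> ennreal ?k * ennreal (C2 * rho w powr (- (\<delta> * (p - 1))))"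
      by (intro mult_left_mono C2_le w) auto
    also have "\<dots> = ennreal (C1 powr (p - 1) * C2) * ennreal (u w powr p)"
      using C2 rho_pos[OF w] powr_add[of "rho w" "\<delta> * (p - 1)" "- (\<delta> * (p - 1))"]
      by (simp add: v_def ennreal_mult[symmetric] mult_ac)
    finally show "(\<integral>\<^sup>+z. L z w \<partial>?M) \<le> ennreal (C1 powr (p - 1) * C2) * ennreal (u w powr p)" .
  qed
  also have "\<dots> = ennreal (C1 powr (p - 1) * C2) * (\<integral>\<^sup>+w. ennreal (u w powr p) \<partial>?M)"
    using u(1) by (intro nn_integral_cmult) measurable
  also have "\<dots> < \<infinity>" using fin by (simp add: ennreal_mult_less_top)
  finally show ?thesis .
qed

section \<open>Weighted integrability and growth\<close>

text \<open>
  Membership in the weighted \<open>L\<^sup>p\<close> space as finiteness of a nonnegative integral, separated from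
  measurability.
\<close>

definition finite_Lp :: "real \<Rightarrow> real \<Rightarrow> (complex ^ 'n \<Rightarrow> complex) \<Rightarrow> bool"
  where "finite_Lp p t F \<longleftrightarrow> (\<integral>\<^sup>+w. ennreal (norm (F w) powr p * rho w powr t) \<partial>lebesgue_on \<B>) < \<infinity>"

lemma rho_powr_mono: "w \<in> \<B> \<Longrightarrow> s \<le> t \<Longrightarrow> rho w powr t \<le> rho w powr s"
  using rho_pos[of w] by (intro powr_mono') auto

lemma finite_Lp_mono:
  assumes "finite_Lp p s F" "s \<le> t"
  shows "finite_Lp p t F"
proof -
  have "(\<integral>\<^sup>+w. ennreal (norm (F w) powr p * rho w powr t) \<partial>lebesgue_on \<B>)
     \<le> (\<integral>\<^sup>+w. ennreal (norm (F w) powr p * rho w powr s) \<partial>lebesgue_on \<B>)"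
    using assms(2) by (intro nn_integral_mono ennreal_leI mult_left_mono rho_powr_mono) auto
  then show ?thesis using assms(1) unfolding finite_Lp_def by (rule le_less_trans)
qed

lemma finite_Lp_meas:
  fixes F :: "complex ^ 'n \<Rightarrow> complex"
  assumes "F \<in> borel_measurable (lebesgue_on \<B>)"
  shows "(\<lambda>w. norm (F w) powr p * rho w powr t) \<in> borel_measurable (lebesgue_on \<B>)"
proof -
  have "(\<lambda>w. rho w powr t) \<in> borel_measurable (lebesgue_on \<B> :: (complex ^ 'n) measure)"
    by (rule measurable_continuous_ball[OF continuous_on_rho_powr])
  then show ?thesis using assms by measurable
qed

lemma finite_Lp_cmult:
  fixes F :: "complex ^ 'n \<Rightarrow> complex"
  assumes "finite_Lp p t F" "F \<in> borel_measurable (lebesgue_on \<B>)"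
  shows "finite_Lp p t (\<lambda>w. c * F w)"
proof -
  have "(\<integral>\<^sup>+w. ennreal (norm (c * F w) powr p * rho w powr t) \<partial>lebesgue_on \<B>)
     = (\<integral>\<^sup>+w. ennreal (norm c powr p) * ennreal (norm (F w) powr p * rho w powr t) \<partial>lebesgue_on \<B>)"
    by (intro nn_integral_cong) (simp add: norm_mult powr_mult ennreal_mult[symmetric] mult.assoc)
  also have "\<dots> = ennreal (norm c powr p) * (\<integral>\<^sup>+w. ennreal (norm (F w) powr p * rho w powr t) \<partial>lebesgue_on \<B>)"
    by (intro nn_integral_cmult measurable_compose[OF finite_Lp_meas[OF assms(2)] measurable_ennreal])
  also have "\<dots> < \<infinity>" using assms(1) by (simp add: finite_Lp_def ennreal_mult_less_top)
  finally show ?thesis by (simp add: finite_Lp_def)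
qed

lemma finite_Lp_add:
  fixes F G :: "complex ^ 'n \<Rightarrow> complex"
  assumes p: "p \<ge> 1" and F: "finite_Lp p t F" "F \<in> borel_measurable (lebesgue_on \<B>)"
    and G: "finite_Lp p t G" "G \<in> borel_measurable (lebesgue_on \<B>)"
  shows "finite_Lp p t (\<lambda>w. F w + G w)"
proof -
  have le: "norm (a + b) powr p \<le> 2 powr p * (norm a powr p + norm b powr p)" for a b :: complex
  proof -
    let ?m = "max (norm a) (norm b)"
    have "norm (a + b) \<le> 2 * ?m" using norm_triangle_ineq[of a b] by simp
    then have "norm (a + b) powr p \<le> (2 * ?m) powr p" using p by (intro powr_mono2) auto
    also have "\<dots> = 2 powr p * ?m powr p" by (simp add: powr_mult)
    also have "?m powr p \<le> norm a powr p + norm b powr p" by (simp add: max_def)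
    finally show ?thesis by simp
  qed
  have "(\<integral>\<^sup>+w. ennreal (norm (F w + G w) powr p * rho w powr t) \<partial>lebesgue_on \<B>)
     \<le> (\<integral>\<^sup>+w. ennreal (2 powr p) * (ennreal (norm (F w) powr p * rho w powr t) + ennreal (norm (G w) powr p * rho w powr t)) \<partial>lebesgue_on \<B>)"
  proof (rule nn_integral_mono)
    fix w :: "complex ^ 'n"
    have "norm (F w + G w) powr p * rho w powr t \<le> 2 powr p * (norm (F w) powr p + norm (G w) powr p) * rho w powr t"
      by (intro mult_right_mono le) auto
    also have "\<dots> = 2 powr p * (norm (F w) powr p * rho w powr t + norm (G w) powr p * rho w powr t)"
      by (simp add: algebra_simps)
    finally show "ennreal (norm (F w + G w) powr p * rho w powr t)
      \<le> ennreal (2 powr p) * (ennreal (norm (F w) powr p * rho w powr t) + ennreal (norm (G w) powr p * rho w powr t))"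
      by (simp add: ennreal_mult[symmetric] ennreal_plus[symmetric] ennreal_leI del: ennreal_plus)
  qed
  also have "\<dots> = ennreal (2 powr p) * ((\<integral>\<^sup>+w. ennreal (norm (F w) powr p * rho w powr t) \<partial>lebesgue_on \<B>)
      + (\<integral>\<^sup>+w. ennreal (norm (G w) powr p * rho w powr t) \<partial>lebesgue_on \<B>))"
    using finite_Lp_meas[OF F(2), of p t] finite_Lp_meas[OF G(2), of p t]
    by (subst nn_integral_cmult, measurable, subst nn_integral_add) auto
  also have "\<dots> < \<infinity>" using F(1) G(1) by (simp add: finite_Lp_def ennreal_mult_less_top)
  finally show ?thesis by (simp add: finite_Lp_def)
qed

lemma finite_Lp_sum:
  fixes F :: "'i \<Rightarrow> complex ^ 'n \<Rightarrow> complex"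
  assumes "p \<ge> 1" "finite I" "\<And>i. i \<in> I \<Longrightarrow> finite_Lp p t (F i) \<and> F i \<in> borel_measurable (lebesgue_on \<B>)"
  shows "finite_Lp p t (\<lambda>w. \<Sum>i\<in>I. F i w)"
  using assms(2,3)
proof (induction I rule: finite_induct)
  case empty
  then show ?case by (simp add: finite_Lp_def)
next
  case (insert i I)
  then show ?case
    using finite_Lp_add[OF assms(1), of t "F i" "\<lambda>w. \<Sum>i\<in>I. F i w"] by (simp add: borel_measurable_sum)
qed

lemma Lp_ball_iff:
  fixes F :: "complex ^ 'n \<Rightarrow> complex"
  assumes "F \<in> borel_measurable (lebesgue_on \<B>)"
  shows "F \<in> Lp_ball p lam \<longleftrightarrow> finite_Lp p (Re lam) F"
  using assms finite_Lp_meas[OF assms, of p "Re lam"]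
  by (auto simp: Lp_ball_def finite_Lp_def integrable_iff_bounded)

lemma norm_bweight_rho: "w \<in> \<B> \<Longrightarrow> norm (bweight 1 b w) = rho w powr Re b"
  using norm_bweight[of w 1 b] by simp

lemma finite_Lp_bweight:
  fixes G :: "complex ^ 'n \<Rightarrow> complex"
  shows "finite_Lp p t (\<lambda>w. G w * bweight 1 b w) \<longleftrightarrow> finite_Lp p (p * Re b + t) G"
proof -
  have "(\<integral>\<^sup>+w. ennreal (norm (G w * bweight 1 b w) powr p * rho w powr t) \<partial>lebesgue_on \<B>)
     = (\<integral>\<^sup>+w. ennreal (norm (G w) powr p * rho w powr (p * Re b + t)) \<partial>lebesgue_on \<B>)"
    by (rule nn_integral_cong)
       (simp add: norm_mult norm_bweight_rho powr_mult powr_powr powr_add mult_ac)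
  then show ?thesis by (simp only: finite_Lp_def)
qed

lemma finite_Lp_rho_mult:
  fixes F :: "complex ^ 'n \<Rightarrow> complex"
  shows "finite_Lp p t (\<lambda>w. of_real (rho w ^ k) * F w) \<longleftrightarrow> finite_Lp p (p * real k + t) F"
proof -
  have "finite_Lp p t (\<lambda>w. of_real (rho w ^ k) * F w) \<longleftrightarrow> finite_Lp p t (\<lambda>w. F w * bweight 1 (of_nat k) w)"
    unfolding finite_Lp_def
  proof (rule arg_cong[of _ _ "\<lambda>x. x < \<infinity>"], rule nn_integral_cong)
    fix w assume "w \<in> space (lebesgue_on \<B> :: (complex ^ 'n) measure)"
    then have w: "w \<in> \<B>" by simp
    have "norm (of_real (rho w ^ k) * F w) = norm (F w * bweight 1 (of_nat k) w)"
      unfolding norm_mult norm_of_real norm_bweight_rho[OF w]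
      using rho_pos[OF w] by (simp add: powr_realpow mult.commute)
    then show "ennreal (norm (of_real (rho w ^ k) * F w) powr p * rho w powr t)
      = ennreal (norm (F w * bweight 1 (of_nat k) w) powr p * rho w powr t)" by simp
  qed
  then show ?thesis by (simp add: finite_Lp_bweight)
qed

lemma measurable_holomorphic_sev:
  "F holomorphic_sev_on \<B> \<Longrightarrow> F \<in> borel_measurable (lebesgue_on \<B>)"
  by (intro measurable_continuous_ball holomorphic_sev_on_imp_continuous_on)

lemma bergman_space_iff:
  assumes f: "f holomorphic_sev_on \<B>"
  shows "f \<in> bergman_space p \<alpha> \<longleftrightarrow>
    (\<exists>k::nat. p * real k + \<alpha> > -1 \<and> finite_Lp p (p * real k + \<alpha>) ((radial_deriv ^^ k) f))"
proof -
  have "(\<lambda>z. of_real (rho z ^ k) * (radial_deriv ^^ k) f z) \<in> Lp_ball p (of_real \<alpha>)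
      \<longleftrightarrow> finite_Lp p (p * real k + \<alpha>) ((radial_deriv ^^ k) f)" for k
  proof -
    have "(\<lambda>z. of_real (rho z ^ k) * (radial_deriv ^^ k) f z) \<in> borel_measurable (lebesgue_on \<B>)"
      by (intro measurable_continuous_ball continuous_intros
          holomorphic_sev_on_imp_continuous_on holomorphic_sev_on_radial_deriv_iterate f) simp
    from Lp_ball_iff[OF this] show ?thesis by (simp only: finite_Lp_rho_mult Re_complex_of_real)
  qed
  then show ?thesis using f by (simp only: bergman_space_def mem_Collect_eq simp_thms)
qed

lemma finite_Lp_integrable_bweight:
  fixes F :: "complex ^ 'n \<Rightarrow> complex"
  assumes p: "p \<ge> 1" and F: "F holomorphic_sev_on \<B>" "finite_Lp p t F"
    and b: "p * (Re b - t / p + 1) > 1"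
  shows "integrable (lebesgue_on \<B>) (\<lambda>w. F w * bweight 1 b w)"
proof -
  let ?M = "lebesgue_on \<B> :: (complex ^ 'n) measure"
  define u where "u = (\<lambda>w. norm (F w) * rho w powr (t / p))"
  note contF = holomorphic_sev_on_imp_continuous_on[OF F(1)]
  have "(\<integral>\<^sup>+w. ennreal (u w * rho w powr (Re b - t / p)) \<partial>?M) < \<infinity>"
  proof (rule nn_integral_rho_powr_Lp[OF p b])
    show "u \<in> borel_measurable ?M" unfolding u_def
      by (intro measurable_continuous_ball continuous_intros continuous_on_rho_powr contF)
    show "u w \<ge> 0" for w by (simp add: u_def)
    have "(\<integral>\<^sup>+w. ennreal (u w powr p) \<partial>?M) = (\<integral>\<^sup>+w. ennreal (norm (F w) powr p * rho w powr t) \<partial>?M)"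
      using p by (intro nn_integral_cong) (simp add: u_def powr_mult powr_powr)
    then show "(\<integral>\<^sup>+w. ennreal (u w powr p) \<partial>?M) < \<infinity>" using F(2) by (simp add: finite_Lp_def)
  qed
  also have "(\<integral>\<^sup>+w. ennreal (u w * rho w powr (Re b - t / p)) \<partial>?M) = (\<integral>\<^sup>+w. ennreal (norm (F w * bweight 1 b w)) \<partial>?M)"
  proof (rule nn_integral_cong)
    fix w assume "w \<in> space ?M"
    then have "norm (bweight 1 b w) = rho w powr Re b" using norm_bweight[of w 1 b] by simp
    then show "ennreal (u w * rho w powr (Re b - t / p)) = ennreal (norm (F w * bweight 1 b w))"
      by (simp add: u_def norm_mult mult.assoc powr_add[symmetric])
  qed
  finally have "(\<integral>\<^sup>+w. ennreal (norm (F w * bweight 1 b w)) \<partial>?M) < \<infinity>" .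
  moreover have "(\<lambda>w. F w * bweight 1 b w) \<in> borel_measurable ?M"
    by (intro measurable_continuous_ball continuous_intros continuous_on_bweight contF)
  ultimately show ?thesis by (simp add: integrable_iff_bounded)
qed

text \<open>
  A function with a kernel representation has its radial derivatives in the weighted spaces that
  the density of the representation predicts, as soon as their exponents exceed \<open>-1\<close>. Both directions of the theorem use this: one for
  the given representation, the other for the reproducing formula.
\<close>

lemma kernel_integral_finite_Lp:
  fixes f \<mu> :: "complex ^ 'n \<Rightarrow> complex"
  assumes p: "p \<ge> 1" and f: "f holomorphic_sev_on \<B>"
    and \<mu>: "integrable (lebesgue_on \<B>) \<mu>"
    and rep: "\<And>z. z \<in> \<B> \<Longrightarrow> f z = (LINT w|lebesgue_on \<B>. \<mu> w * pow_kernel \<sigma> (herm z w))"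
    and t: "p * real k + t > -1" and B: "p * (B + 1) > 1"
    and \<sigma>: "Re \<sigma> = real CARD('n) + 1 + t / p + B"
    and fin: "finite_Lp p (- p * B) \<mu>"
  shows "finite_Lp p (p * real k + t) ((radial_deriv ^^ k) f)"
proof -
  let ?M = "lebesgue_on \<B> :: (complex ^ 'n) measure"
  let ?F = "(radial_deriv ^^ k) f"
  define A where "A = real k + t / p"
  have p0: "p > 0" using p by simp
  have pA: "p * A = p * real k + t" using p0 by (simp add: A_def distrib_left)
  obtain C where C: "C \<ge> 0" and le: "\<And>z. z \<in> \<B> \<Longrightarrow> ennreal (norm (?F z))
      \<le> (\<integral>\<^sup>+w. ennreal (C * (norm (\<mu> w) * kdecay (Re \<sigma> + real k) z w)) \<partial>?M)"
    using radial_deriv_kernel_integral[OF f \<mu> rep, of k] by blast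
  define u where "u = (\<lambda>w. C * (norm (\<mu> w) * rho w powr (- B)))"
  define h where "h = (\<lambda>z. norm (?F z) * rho z powr A)"
  have rho_m: "(\<lambda>w. rho w powr s) \<in> borel_measurable ?M" for s
    by (rule measurable_continuous_ball[OF continuous_on_rho_powr])
  have \<mu>_m: "\<mu> \<in> borel_measurable ?M" using \<mu> by simp
  have "(\<integral>\<^sup>+z. ennreal (h z powr p) \<partial>?M) < \<infinity>"
  proof (rule schur_test[OF p _ B, of A u h])
    show "p * A > -1" using t pA by simp
    show "u \<in> borel_measurable ?M" unfolding u_def using \<mu>_m rho_m[of "- B"] by measurable
    show "u w \<ge> 0" for w using C by (simp add: u_def)
    show "h z \<ge> 0" for z by (simp add: h_def)
    have "(\<integral>\<^sup>+w. ennreal (u w powr p) \<partial>?M)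
        = (\<integral>\<^sup>+w. ennreal (C powr p) * ennreal (norm (\<mu> w) powr p * rho w powr (- p * B)) \<partial>?M)"
      using C by (intro nn_integral_cong) (simp add: u_def powr_mult powr_powr ennreal_mult[symmetric] mult_ac)
    also have "\<dots> = ennreal (C powr p) * (\<integral>\<^sup>+w. ennreal (norm (\<mu> w) powr p * rho w powr (- p * B)) \<partial>?M)"
      by (intro nn_integral_cmult measurable_compose[OF finite_Lp_meas[OF \<mu>_m] measurable_ennreal])
    also have "\<dots> < \<infinity>" using fin unfolding finite_Lp_def by (simp add: ennreal_mult_less_top)
    finally show "(\<integral>\<^sup>+w. ennreal (u w powr p) \<partial>?M) < \<infinity>" .
    fix z :: "complex ^ 'n" assume z: "z \<in> \<B>"
    have "ennreal (h z) = ennreal (rho z powr A) * ennreal (norm (?F z))"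
      by (simp add: h_def ennreal_mult[symmetric] mult.commute)
    also have "\<dots> \<le> ennreal (rho z powr A) *
       (\<integral>\<^sup>+w. ennreal (C * (norm (\<mu> w) * kdecay (Re \<sigma> + real k) z w)) \<partial>?M)"
      by (intro mult_left_mono le z) simp
    also have "\<dots> = (\<integral>\<^sup>+w. ennreal (rho z powr A) *
        ennreal (C * (norm (\<mu> w) * kdecay (Re \<sigma> + real k) z w)) \<partial>?M)"
    proof (rule nn_integral_cmult[symmetric])
      have "(\<lambda>w. norm (1 - herm z w)) \<in> borel_measurable ?M"
        by (intro measurable_continuous_ball continuous_intros)
      then show "(\<lambda>w. ennreal (C * (norm (\<mu> w) * kdecay (Re \<sigma> + real k) z w))) \<in> borel_measurable ?M"
        using \<mu>_m by measurable
    qed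
    also have "\<dots> = (\<integral>\<^sup>+w. ennreal (schur_kernel A B z w * u w) \<partial>?M)"
    proof (rule nn_integral_cong)
      fix w assume "w \<in> space ?M"
      then have "rho w > 0" using rho_pos by auto
      then have "rho w powr B * rho w powr (- B) = 1" by (simp add: powr_minus)
      moreover have "Re \<sigma> + real k = real CARD('n) + 1 + A + B" by (simp add: \<sigma> A_def)
      ultimately have eq: "schur_kernel A B z w * u w = rho z powr A * (C * (norm (\<mu> w) * kdecay (Re \<sigma> + real k) z w))"
        unfolding u_def schur_kernel_def by (simp add: mult_ac)
      show "ennreal (rho z powr A) * ennreal (C * (norm (\<mu> w) * kdecay (Re \<sigma> + real k) z w))
        = ennreal (schur_kernel A B z w * u w)"
        unfolding eq by (rule ennreal_mult[symmetric]) (use C in auto)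
    qed
    finally show "ennreal (h z) \<le> (\<integral>\<^sup>+w. ennreal (schur_kernel A B z w * u w) \<partial>?M)" .
  qed
  also have "(\<integral>\<^sup>+z. ennreal (h z powr p) \<partial>?M) = (\<integral>\<^sup>+z. ennreal (norm (?F z) powr p * rho z powr (p * real k + t)) \<partial>?M)"
    unfolding pA[symmetric] by (intro nn_integral_cong) (simp add: h_def powr_mult powr_powr mult_ac)
  finally show ?thesis by (simp add: finite_Lp_def)
qed

lemma rho_radial_mono:
  assumes "z \<in> \<B>" "0 \<le> t" "t \<le> 1" "M \<ge> 0"
  shows "rho (of_real t *s z) powr (- M) \<le> rho z powr (- M)"
proof -
  have "t * norm z \<le> 1 * norm z" using assms by (intro mult_right_mono) auto
  then have "(t * norm z)\<^sup>2 \<le> (norm z)\<^sup>2" using assms by (intro power_mono) auto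
  then show ?thesis
    using rho_pos[OF assms(1)] assms by (intro powr_mono2') (auto simp: norm_vector_cmult)
qed

text \<open>
  The mean value inequality on the segment from \<open>z / 2\<close> to \<open>z\<close>, on which the growth bound is largest
  at \<open>z\<close>. The points \<open>z / 2\<close> stay in a compact subset of the ball.
\<close>

lemma growth_of_primitive:
  fixes f :: "complex ^ 'n \<Rightarrow> complex"
  assumes f: "f holomorphic_sev_on \<B>" and M: "M \<ge> 0"
    and C: "\<And>z. z \<in> \<B> \<Longrightarrow> norm (radial_deriv f z) \<le> C * rho z powr (- M)"
  shows "\<exists>C'. \<forall>z\<in>\<B>. norm (f z) \<le> C' * rho z powr (- M)"
proof -
  have "bounded (f ` cball 0 (1/2))"
    by (intro compact_imp_bounded compact_continuous_image compact_cball
        continuous_on_subset[OF holomorphic_sev_on_imp_continuous_on[OF f]]) auto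
  then obtain D where D: "D > 0" "\<And>w. w \<in> cball 0 (1/2) \<Longrightarrow> norm (f w) \<le> D"
    by (auto simp: bounded_pos)
  have C0: "C \<ge> 0" using order_trans[OF norm_ge_zero C[of 0]] by simp
  show ?thesis
  proof (intro exI ballI)
    fix z :: "complex ^ 'n" assume z: "z \<in> \<B>"
    have r1: "rho z powr (- M) \<ge> 1"
      using rho_pos[OF z] M powr_mono'[of "- M" 0 "rho z"] by simp
    have in_B: "of_real t *s z \<in> \<B>" if "0 \<le> t" "t \<le> 1" for t
    proof -
      have "t * norm z \<le> 1 * norm z" using that by (intro mult_right_mono) auto
      then show ?thesis using z that by (simp add: norm_vector_cmult)
    qed
    have "norm (f (of_real 1 *s z) - f (of_real (1/2) *s z)) \<le> 2 * C * rho z powr (- M) * norm (1 - 1/2 :: real)"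
    proof (rule differentiable_bound[where S = "{1/2..1}" and f = "\<lambda>t. f (of_real t *s z)"
          and f' = "\<lambda>t h. h *\<^sub>R dirderiv f z (of_real t *s z)"])
      fix t :: real assume "t \<in> {1/2..1}"
      then have t: "1/2 \<le> t" "t \<le> 1" by auto
      have B: "of_real t *s z \<in> \<B>" using in_B t by auto
      then have "((\<lambda>s. f (0 + s *s z)) has_field_derivative dirderiv f z (0 + of_real t *s z)) (at (of_real t))"
        by (intro holomorphic_sev_line[OF f]) simp
      from field_vector_diff_chain_at[OF has_vector_derivative_of_real[OF DERIV_ident] this]
      show "((\<lambda>t. f (of_real t *s z)) has_derivative (\<lambda>h. h *\<^sub>R dirderiv f z (of_real t *s z))) (at t within {1/2..1})"
        by (simp add: o_def has_vector_derivative_def has_derivative_at_withinI)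
      have "t * norm (dirderiv f z (of_real t *s z)) = norm (radial_deriv f (of_real t *s z))"
        using t by (simp add: radial_deriv_eq[OF f B] holomorphic_sev_has_derivative(2)[OF f B] norm_mult)
      also have "\<dots> \<le> C * rho (of_real t *s z) powr (- M)" by (rule C[OF B])
      also have "\<dots> \<le> C * rho z powr (- M)" using C0 t by (intro mult_left_mono rho_radial_mono z M) auto
      finally have "t * norm (dirderiv f z (of_real t *s z)) \<le> C * rho z powr (- M)" .
      moreover have "1/2 * norm (dirderiv f z (of_real t *s z)) \<le> t * norm (dirderiv f z (of_real t *s z))"
        using t by (intro mult_right_mono) auto
      ultimately have "norm (dirderiv f z (of_real t *s z)) \<le> 2 * C * rho z powr (- M)" by simp
      then show "onorm (\<lambda>h. h *\<^sub>R dirderiv f z (of_real t *s z)) \<le> 2 * C * rho z powr (- M)"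
        using C0 by (intro onorm_bound) (auto simp: mult.commute[of _ "\<bar>_\<bar>"] intro!: mult_left_mono)
    qed auto
    moreover have "norm (f (of_real (1/2) *s z)) \<le> D * rho z powr (- M)"
    proof -
      have "norm (f (of_real (1/2) *s z)) \<le> D"
        by (rule D(2)) (use z in \<open>simp add: norm_vector_cmult norm_divide\<close>)
      also have "\<dots> \<le> D * rho z powr (- M)" using mult_left_mono[OF r1, of D] D(1) by simp
      finally show ?thesis .
    qed
    ultimately have "norm (f z) \<le> C * rho z powr (- M) + D * rho z powr (- M)"
      using norm_triangle_ineq2[of "f z" "f (of_real (1/2) *s z)"] by simp
    then show "norm (f z) \<le> (C + D) * rho z powr (- M)" by (simp add: distrib_right)
  qed
qed

lemma growth_of_radial_antiderivatives:
  assumes "f holomorphic_sev_on \<B>" "M \<ge> 0"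
    and "\<exists>C. \<forall>z\<in>\<B>. norm ((radial_deriv ^^ k) f z) \<le> C * rho z powr (- M)" and "j \<le> k"
  shows "\<exists>C. \<forall>z\<in>\<B>. norm ((radial_deriv ^^ j) f z) \<le> C * rho z powr (- M)"
  using assms(4)
proof (induction j rule: inc_induct)
  case base
  show ?case by (rule assms(3))
next
  case (step j)
  then obtain C where C: "\<forall>z\<in>\<B>. norm (radial_deriv ((radial_deriv ^^ j) f) z) \<le> C * rho z powr (- M)"
    by auto
  show ?case
    by (rule growth_of_primitive[OF holomorphic_sev_on_radial_deriv_iterate[OF assms(1) open_ball] assms(2)])
       (rule bspec[OF C])
qed

lemma finite_Lp_of_growth:
  fixes F :: "complex ^ 'n \<Rightarrow> complex"
  assumes p: "p \<ge> 1" and C: "\<And>z. z \<in> \<B> \<Longrightarrow> norm (F z) \<le> C * rho z powr (- M)" and t: "t - p * M > -1"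
  shows "finite_Lp p t F"
proof -
  let ?M = "lebesgue_on \<B> :: (complex ^ 'n) measure"
  have "(\<integral>\<^sup>+w. ennreal (norm (F w) powr p * rho w powr t) \<partial>?M)
     \<le> (\<integral>\<^sup>+w. ennreal (\<bar>C\<bar> powr p) * ennreal (rho w powr (t - p * M)) \<partial>?M)"
  proof (rule nn_integral_mono)
    fix w assume "w \<in> space ?M"
    then have w: "w \<in> \<B>" by simp
    have "norm (F w) \<le> \<bar>C\<bar> * rho w powr (- M)"
      by (rule order_trans[OF C[OF w]], rule mult_right_mono) auto
    then have "norm (F w) powr p \<le> (\<bar>C\<bar> * rho w powr (- M)) powr p" using p by (intro powr_mono2) auto
    then have "norm (F w) powr p * rho w powr t \<le> (\<bar>C\<bar> * rho w powr (- M)) powr p * rho w powr t"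
      by (rule mult_right_mono) simp
    also have "\<dots> = \<bar>C\<bar> powr p * rho w powr (t - p * M)"
      by (simp add: powr_mult powr_powr mult.assoc powr_add[symmetric] algebra_simps)
    finally show "ennreal (norm (F w) powr p * rho w powr t) \<le> ennreal (\<bar>C\<bar> powr p) * ennreal (rho w powr (t - p * M))"
      by (simp add: ennreal_mult[symmetric] ennreal_leI)
  qed
  also have "\<dots> = ennreal (\<bar>C\<bar> powr p) * (\<integral>\<^sup>+w. ennreal (rho w powr (t - p * M)) \<partial>?M)"
  proof -
    have "(\<lambda>w. rho w powr (t - p * M)) \<in> borel_measurable ?M"
      by (rule measurable_continuous_ball[OF continuous_on_rho_powr])
    from nn_integral_cmult[OF measurable_compose[OF this measurable_ennreal]] show ?thesis .
  qed
  also have "\<dots> < \<infinity>"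
    using nn_integral_rho_powr_finite[OF t, where 'n = 'n] by (simp add: ennreal_mult_less_top)
  finally show ?thesis by (simp add: finite_Lp_def)
qed

text \<open>
  A crude pointwise bound from \<open>|1 - \<langle>z, w\<rangle>| \<ge> 1 - |z| \<ge> \<rho>(z) / 2\<close>.
\<close>

lemma kernel_integral_growth:
  fixes f \<mu> :: "complex ^ 'n \<Rightarrow> complex"
  assumes f: "f holomorphic_sev_on \<B>"
    and \<mu>: "integrable (lebesgue_on \<B>) \<mu>"
    and rep: "\<And>z. z \<in> \<B> \<Longrightarrow> f z = (LINT w|lebesgue_on \<B>. \<mu> w * pow_kernel \<sigma> (herm z w))"
    and \<sigma>: "Re \<sigma> \<ge> 0"
  shows "\<exists>C. \<forall>z\<in>\<B>. norm (f z) \<le> C * rho z powr (- Re \<sigma>)"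
proof -
  let ?M = "lebesgue_on \<B> :: (complex ^ 'n) measure"
  obtain C where C: "C \<ge> 0" and le: "\<And>z. z \<in> \<B> \<Longrightarrow> ennreal (norm (f z))
      \<le> (\<integral>\<^sup>+w. ennreal (C * (norm (\<mu> w) * kdecay (Re \<sigma>) z w)) \<partial>?M)"
    using radial_deriv_kernel_integral[OF f \<mu> rep, of 0] by auto
  define I where "I = (LINT w|?M. norm (\<mu> w))"
  have I: "(\<integral>\<^sup>+w. ennreal (norm (\<mu> w)) \<partial>?M) = ennreal I" "I \<ge> 0"
    unfolding I_def using \<mu> by (auto intro!: nn_integral_eq_integral)
  show ?thesis
  proof (intro exI ballI)
    fix z :: "complex ^ 'n" assume z: "z \<in> \<B>"
    have r: "rho z > 0" by (rule rho_pos[OF z])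
    let ?k = "C * (rho z / 2) powr (- Re \<sigma>)"
    have "ennreal (norm (f z)) \<le> (\<integral>\<^sup>+w. ennreal ?k * ennreal (norm (\<mu> w)) \<partial>?M)"
    proof (rule order_trans[OF le[OF z]], rule nn_integral_mono)
      fix w assume "w \<in> space ?M"
      then have w: "norm w < 1" by simp
      have "rho z / 2 \<le> norm (1 - herm z w)"
      proof -
        have "norm (herm z w) \<le> norm z"
          using norm_herm_le[of z w] mult_left_mono[of "norm w" 1 "norm z"] w by simp
        then have "1 - norm z \<le> norm (1 - herm z w)"
          using norm_triangle_ineq2[of 1 "herm z w"] by simp
        moreover have "rho z = (1 - norm z) * (1 + norm z)" by (simp add: power2_eq_square algebra_simps)
        moreover have "(1 - norm z) * (1 + norm z) \<le> (1 - norm z) * 2" using z by (intro mult_left_mono) auto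
        ultimately show ?thesis by simp
      qed
      then have "kdecay (Re \<sigma>) z w \<le> (rho z / 2) powr (- Re \<sigma>)"
        using r \<sigma> by (intro powr_mono2') auto
      then have "C * (norm (\<mu> w) * kdecay (Re \<sigma>) z w) \<le> C * (norm (\<mu> w) * (rho z / 2) powr (- Re \<sigma>))"
        using C by (intro mult_left_mono) auto
      then show "ennreal (C * (norm (\<mu> w) * kdecay (Re \<sigma>) z w)) \<le> ennreal ?k * ennreal (norm (\<mu> w))"
        using C by (simp add: ennreal_mult[symmetric] ennreal_leI mult_ac)
    qed
    also have "\<dots> = ennreal ?k * ennreal I"
      unfolding I(1)[symmetric] using \<mu> by (intro nn_integral_cmult) auto
    also have "\<dots> = ennreal (?k * I)" using C I(2) by (simp add: ennreal_mult)
    finally have "norm (f z) \<le> ?k * I" using C I(2) by (simp add: ennreal_le_iff)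
    also have "\<dots> = (C * I * 2 powr Re \<sigma>) * rho z powr (- Re \<sigma>)"
      using r by (simp add: powr_divide powr_minus_divide field_simps)
    finally show "norm (f z) \<le> (C * I * 2 powr Re \<sigma>) * rho z powr (- Re \<sigma>)" .
  qed
qed

section \<open>Kernel representations of functions in the Bergman space\<close>

lemma slice_sums:
  assumes "F holomorphic_sev_on ball 0 R" "z \<in> ball 0 R" "norm t < 1"
  shows "(\<lambda>m. slice_coeff F m z * t ^ m) sums F (t *s z)"
proof -
  obtain q where q: "q > 1" "(\<lambda>t. F (t *s z)) holomorphic_on ball 0 q"
    using slice_holomorphic[OF assms(1,2)] by blast
  show ?thesis
    using holomorphic_power_series[OF q(2), of t] q(1) assms(3) by (simp add: slice_coeff_def)
qed

lemma slice_coeff_radial_polynomial: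
  fixes c :: "nat \<Rightarrow> complex"
  assumes f: "f holomorphic_sev_on \<B>" and z: "z \<in> \<B>"
  shows "slice_coeff (\<lambda>w. \<Sum>i\<le>N. c i * (radial_deriv ^^ i) f w) m z
    = (\<Sum>i\<le>N. c i * of_nat m ^ i) * slice_coeff f m z"
proof (rule slice_coeff_unique[where R = 1 and e = 1])
  show "(\<lambda>w. \<Sum>i\<le>N. c i * (radial_deriv ^^ i) f w) holomorphic_sev_on \<B>"
    by (intro holomorphic_sev_on_sum holomorphic_sev_on_mult holomorphic_sev_on_const
        holomorphic_sev_on_radial_deriv_iterate f open_ball)
  fix t :: complex assume t: "norm t < 1"
  have "(\<lambda>m. \<Sum>i\<le>N. c i * (slice_coeff ((radial_deriv ^^ i) f) m z * t ^ m)) sums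
      (\<Sum>i\<le>N. c i * (radial_deriv ^^ i) f (t *s z))"
    by (intro sums_sum sums_mult slice_sums[OF holomorphic_sev_on_radial_deriv_iterate[OF f open_ball] z t])
  then show "(\<lambda>m. (\<Sum>i\<le>N. c i * of_nat m ^ i) * slice_coeff f m z * t ^ m) sums
      (\<Sum>i\<le>N. c i * (radial_deriv ^^ i) f (t *s z))"
    by (simp add: slice_coeff_radial_deriv_iterate[OF f] sum_distrib_right mult.assoc)
qed auto

text \<open>
  The multiplier \<open>(\<sigma> + m)\<^sub>N\<close> is a polynomial in \<open>m\<close> of degree \<open>N\<close>, hence it belongs to a polynomial in
  the radial derivative.
\<close>

lemma pochhammer_shift_polynomial:
  fixes \<sigma> :: complex
  obtains c d where "d \<le> N" "\<And>m :: nat. pochhammer (\<sigma> + of_nat m) N = (\<Sum>i\<le>d. c i * of_nat m ^ i)"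
proof -
  define P where "P = (\<Prod>j\<in>{0..<N}. [:\<sigma> + of_nat j, 1:])"
  have "degree P \<le> (\<Sum>j\<in>{0..<N}. degree [:\<sigma> + of_nat j, 1:])"
    unfolding P_def using degree_prod_sum_le[of "{0..<N}" "\<lambda>j. [:\<sigma> + of_nat j, 1:]"] by (simp add: o_def)
  then have "degree P \<le> N" by simp
  moreover have "pochhammer (\<sigma> + of_nat m) N = (\<Sum>i\<le>degree P. coeff P i * of_nat m ^ i)" for m :: nat
    unfolding poly_altdef[symmetric] by (simp add: P_def poly_prod pochhammer_prod algebra_simps)
  ultimately show ?thesis using that by blast
qed

lemma dv_const_pos: "dv_const TYPE(complex ^ 'n) \<gamma> > 0"
proof (cases "\<gamma> \<in> \<real> \<and> Re \<gamma> > -1")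
  case True
  then show ?thesis
    using defect_integral_pos[of 1 "Re \<gamma>", where 'n = 'n] by (simp add: dv_const_def)
qed (auto simp: dv_const_def)

lemma dv_density_eq:
  "dv_density \<gamma> (w :: complex ^ 'n) = of_real (dv_const TYPE(complex ^ 'n) \<gamma>) * bweight 1 \<gamma> w"
  by (simp add: dv_density_def bweight_def)

lemma bweight_add: "w \<in> \<B> \<Longrightarrow> bweight 1 (a + b) w = bweight 1 a w * bweight 1 b w"
  unfolding bweight_def by (rule powr_add)

text \<open>
  The density \<open>g dv\<^sub>\<gamma>\<close> satisfies the hypotheses of the general lemma on kernel integrals with
  \<open>B = Re \<gamma> - Re \<lambda> / p\<close>, for which condition (a) reads \<open>p (B + 1) > 1\<close>.
\<close>

lemma bergman_space_of_kernel_integral: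
  fixes f g :: "complex ^ 'n \<Rightarrow> complex"
  assumes p: "p \<ge> 1" and a: "p * (Re \<gamma> + 1) > Re lam + 1"
    and f: "f holomorphic_sev_on \<B>" and g: "g \<in> Lp_ball p lam"
    and \<sigma>: "\<sigma> = of_nat CARD('n) + 1 + \<gamma> + (of_real \<alpha> - lam) / of_real p"
    and rep: "\<And>z. z \<in> \<B> \<Longrightarrow> has_bochner_integral (lebesgue_on \<B>)
         (\<lambda>w. g w * dv_density \<gamma> w * pow_kernel \<sigma> (herm z w)) (f z)"
  shows "f \<in> bergman_space p \<alpha>"
proof -
  let ?M = "lebesgue_on \<B> :: (complex ^ 'n) measure"
  have p0: "p > 0" using p by simp
  define \<mu> where "\<mu> = (\<lambda>w. g w * dv_density \<gamma> w)"
  \<comment> \<open>At \<open>z = 0\<close> the kernel equals 1.\<close>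
  have \<mu>: "integrable ?M \<mu>"
    using rep[of 0] by (simp add: \<mu>_def has_bochner_integral_iff pow_kernel_def)
  have rep': "f z = (LINT w|?M. \<mu> w * pow_kernel \<sigma> (herm z w))" if "z \<in> \<B>" for z
    using rep[OF that] by (simp add: \<mu>_def has_bochner_integral_iff)
  \<comment> \<open>Every admissible \<open>k\<close> works; one of them suffices for membership.\<close>
  have "\<exists>k::nat. (- 1 - \<alpha>) / p < real k" by (rule reals_Archimedean2)
  then obtain k :: nat where k: "p * real k + \<alpha> > -1"
    using p0 by (auto simp: divide_less_eq algebra_simps)
  define B where "B = Re \<gamma> - Re lam / p"
  have B: "p * (B + 1) > 1" using a p0 by (simp add: B_def algebra_simps)
  have \<sigma>': "Re \<sigma> = real CARD('n) + 1 + \<alpha> / p + B"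
    by (simp add: \<sigma> B_def diff_divide_distrib)
  have g_m: "g \<in> borel_measurable ?M" and g_fin: "finite_Lp p (Re lam) g"
    using g Lp_ball_iff[of g p lam] by (auto simp: Lp_ball_def)
  let ?\<kappa> = "dv_const TYPE(complex ^ 'n) \<gamma>"
  have "p * Re \<gamma> + - p * B = Re lam" using p0 by (simp add: B_def algebra_simps)
  moreover have "\<mu> = (\<lambda>w. of_real ?\<kappa> * g w * bweight 1 \<gamma> w)"
    by (simp add: \<mu>_def dv_density_eq mult_ac fun_eq_iff)
  ultimately have "finite_Lp p (- p * B) \<mu>"
    using finite_Lp_cmult[OF g_fin g_m] by (simp only: finite_Lp_bweight)
  from kernel_integral_finite_Lp[OF p f \<mu> rep' k B \<sigma>' this]
  show ?thesis using k by (auto simp: bergman_space_iff[OF f])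
qed

text \<open>
  The reproducing formula with a large real exponent \<open>b\<close> is a kernel representation of \<open>f\<close> by \<open>f\<close>
  itself.
\<close>

lemma radial_deriv_finite_Lp:
  fixes f :: "complex ^ 'n \<Rightarrow> complex"
  assumes p: "p \<ge> 1" and f: "f holomorphic_sev_on \<B>" and t: "t > -1" and fin: "finite_Lp p t f"
  shows "finite_Lp p (p * real i + t) ((radial_deriv ^^ i) f)"
    and "\<exists>M\<ge>0. \<exists>C. \<forall>z\<in>\<B>. norm (f z) \<le> C * rho z powr (- M)"
proof -
  let ?M = "lebesgue_on \<B> :: (complex ^ 'n) measure"
  have p0: "p > 0" using p by simp
  \<comment> \<open>Large enough that \<open>B = b - t / p \<ge> 1\<close>.\<close>
  define b where "b = \<bar>t / p\<bar> + 1"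
  have "b - t / p \<ge> 1" unfolding b_def using abs_ge_self[of "t / p"] by linarith
  then have "p * (b - t / p + 1) \<ge> 1 * (1 + 1)" using p by (intro mult_mono) auto
  then have B: "p * (b - t / p + 1) > 1" by simp
  have b1: "b \<ge> 1" unfolding b_def using abs_ge_zero[of "t / p"] by linarith
  have b0: "Re (of_real b) \<ge> 0" "Re (of_real b) > -1"
    using b1 by simp_all
  let ?V = "bmass TYPE(complex ^ 'n) 1 (of_real b)"
  have V: "?V \<noteq> 0" by (rule bmass_nonzero) (use b0 in simp)
  have int: "integrable ?M (\<lambda>w. f w * bweight 1 (of_real b) w)"
    by (rule finite_Lp_integrable_bweight[OF p f fin]) (use B in simp)
  define \<mu> where "\<mu> = (\<lambda>w. inverse ?V * (f w * bweight 1 (of_real b) w))"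
  have \<mu>: "integrable ?M \<mu>" unfolding \<mu>_def by (intro integrable_mult_right int)
  define \<sigma> where "\<sigma> = of_nat CARD('n) + of_real b + (1 :: complex)"
  have rep: "f z = (LINT w|?M. \<mu> w * pow_kernel \<sigma> (herm z w))" if z: "z \<in> \<B>" for z
    using reproducing_formula[OF f b0(1) int z] V by (simp add: \<mu>_def \<sigma>_def mult.assoc)
  have \<sigma>': "Re \<sigma> = real CARD('n) + 1 + t / p + (b - t / p)" by (simp add: \<sigma>_def)
  show "finite_Lp p (p * real i + t) ((radial_deriv ^^ i) f)"
  proof (rule kernel_integral_finite_Lp[OF p f \<mu> rep _ B \<sigma>'])
    show "p * real i + t > -1" using t mult_nonneg_nonneg[of p "real i"] p0 by linarith
    have "p * Re (of_real b) + - p * (b - t / p) = t" using p0 by (simp add: algebra_simps)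
    moreover have "\<mu> = (\<lambda>w. inverse ?V * f w * bweight 1 (of_real b) w)" by (simp add: \<mu>_def mult_ac fun_eq_iff)
    ultimately show "finite_Lp p (- p * (b - t / p)) \<mu>"
      using finite_Lp_cmult[OF fin measurable_holomorphic_sev[OF f]] by (simp only: finite_Lp_bweight)
  qed
  have "Re \<sigma> \<ge> 0" using b0 by (simp add: \<sigma>_def)
  then show "\<exists>M\<ge>0. \<exists>C. \<forall>z\<in>\<B>. norm (f z) \<le> C * rho z powr (- M)"
    using kernel_integral_growth[OF f \<mu> rep] by blast
qed

text \<open>
  Each derivative beyond order \<open>k\<close> costs one factor \<open>1 / \<rho>\<close>, which the weight compensates. Those of
  lower order grow at most like a fixed power of \<open>1 / \<rho>\<close>, which a sufficiently large \<open>N\<close> absorbs. Thus the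
  integer \<open>k\<close> in the definition of the space can be exchanged for every large \<open>N\<close>.
\<close>

lemma radial_derivs_finite_Lp:
  fixes f :: "complex ^ 'n \<Rightarrow> complex"
  assumes p: "p \<ge> 1" and f: "f holomorphic_sev_on \<B>" and k: "p * real k + \<alpha> > -1"
    and fin: "finite_Lp p (p * real k + \<alpha>) ((radial_deriv ^^ k) f)"
  shows "\<exists>N0::nat. \<forall>N\<ge>N0. \<forall>j\<le>N. finite_Lp p (p * real N + \<alpha>) ((radial_deriv ^^ j) f)"
proof -
  note Rk = holomorphic_sev_on_radial_deriv_iterate[OF f open_ball, of k]
  obtain M where M: "M \<ge> 0" "\<exists>C. \<forall>z\<in>\<B>. norm ((radial_deriv ^^ k) f z) \<le> C * rho z powr (- M)"
    using radial_deriv_finite_Lp(2)[OF p Rk k fin] by blast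
  obtain N0 :: nat where N0: "real N0 > M + \<bar>\<alpha>\<bar>" using reals_Archimedean2 by blast
  have "finite_Lp p (p * real N + \<alpha>) ((radial_deriv ^^ j) f)" if N: "N \<ge> N0" and j: "j \<le> N" for N j
  proof (cases "j \<ge> k")
    case True
    have "finite_Lp p (p * real (j - k) + (p * real k + \<alpha>)) ((radial_deriv ^^ (j - k)) ((radial_deriv ^^ k) f))"
      by (rule radial_deriv_finite_Lp(1)[OF p Rk k fin])
    also have "(radial_deriv ^^ (j - k)) ((radial_deriv ^^ k) f) = (radial_deriv ^^ j) f"
      using True by (metis comp_apply funpow_add le_add_diff_inverse2)
    finally show ?thesis
    proof (rule finite_Lp_mono)
      have "p * real j \<le> p * real N" using j p by (intro mult_left_mono) auto
      then show "p * real (j - k) + (p * real k + \<alpha>) \<le> p * real N + \<alpha>"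
        using True by (simp add: of_nat_diff algebra_simps)
    qed
  next
    case False
    then obtain C where C: "\<And>z. z \<in> \<B> \<Longrightarrow> norm ((radial_deriv ^^ j) f z) \<le> C * rho z powr (- M)"
      using growth_of_radial_antiderivatives[OF f M, of j] by (metis nat_le_linear)
    show ?thesis
    proof (rule finite_Lp_of_growth[OF p C])
      have "1 * (real N - M) \<le> p * (real N - M)" using N N0 p by (intro mult_right_mono) auto
      then show "p * real N + \<alpha> - p * M > -1" using N N0 by (simp add: algebra_simps)
    qed
  qed
  then show ?thesis by blast
qed

text \<open>
  Let \<open>\<beta> = \<gamma> + (\<alpha> - \<lambda>) / p\<close>, so that \<open>\<sigma> = n + 1 + \<beta>\<close>, and let \<open>b = \<beta> + N\<close>. Pairing a function \<open>G\<close>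
  and the weight of exponent \<open>b\<close> with the kernel of exponent \<open>\<sigma>\<close> multiplies Taylor coefficients by
  \<open>(\<sigma>)\<^sub>m / (\<sigma> + N)\<^sub>m = (\<sigma>)\<^sub>N / (\<sigma> + m)\<^sub>N\<close>. The function \<open>G\<close> with coefficients \<open>(\<sigma> + m)\<^sub>N\<close> times those of \<open>f\<close>
  arises from \<open>f\<close> by a polynomial of degree \<open>N\<close> in the radial derivative, so that it belongs to
  the right weighted space and the pairing returns \<open>(\<sigma>)\<^sub>N f\<close> up to the mass. Condition (b)
  ensures \<open>(\<sigma>)\<^sub>N \<noteq> 0\<close>.
\<close>

lemma kernel_integral_of_bergman_space:
  fixes f :: "complex ^ 'n \<Rightarrow> complex"
  assumes p: "p \<ge> 1" and a: "p * (Re \<gamma> + 1) > Re lam + 1"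
    and f: "f holomorphic_sev_on \<B>" and fb: "f \<in> bergman_space p \<alpha>"
    and \<sigma>: "\<sigma> = of_nat CARD('n) + 1 + \<gamma> + (of_real \<alpha> - lam) / of_real p"
    and nz: "\<And>j::nat. \<sigma> + of_nat j \<noteq> 0"
  shows "\<exists>g \<in> Lp_ball p lam. \<forall>z \<in> \<B>. has_bochner_integral (lebesgue_on \<B>)
         (\<lambda>w. g w * dv_density \<gamma> w * pow_kernel \<sigma> (herm z w)) (f z)"
proof -
  let ?M = "lebesgue_on \<B> :: (complex ^ 'n) measure"
  let ?\<kappa> = "complex_of_real (dv_const TYPE(complex ^ 'n) \<gamma>)"
  have p0: "p > 0" using p by simp
  have \<kappa>: "?\<kappa> \<noteq> 0" using dv_const_pos[of \<gamma>, where 'n = 'n] by simp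
  define \<beta> where "\<beta> = \<gamma> + (of_real \<alpha> - lam) / of_real p"
  obtain k :: nat where k: "p * real k + \<alpha> > -1" "finite_Lp p (p * real k + \<alpha>) ((radial_deriv ^^ k) f)"
    using fb bergman_space_iff[OF f] by blast
  obtain N0 :: nat where N0: "\<And>N j. N \<ge> N0 \<Longrightarrow> j \<le> N \<Longrightarrow> finite_Lp p (p * real N + \<alpha>) ((radial_deriv ^^ j) f)"
    using radial_derivs_finite_Lp[OF p f k] by blast
  obtain N1 :: nat where N1: "real N1 > - Re \<beta>" using reals_Archimedean2 by blast
  define N where "N = max N0 N1"
  define b where "b = \<beta> + of_nat N"
  have b: "Re b \<ge> 0" using N1 by (simp add: b_def N_def)
  obtain c d where d: "d \<le> N" and c: "\<And>m::nat. pochhammer (\<sigma> + of_nat m) N = (\<Sum>i\<le>d. c i * of_nat m ^ i)"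
    using pochhammer_shift_polynomial by blast
  define G where "G = (\<lambda>w. \<Sum>i\<le>d. c i * (radial_deriv ^^ i) f w)"
  have G: "G holomorphic_sev_on \<B>" unfolding G_def
    by (intro holomorphic_sev_on_sum holomorphic_sev_on_mult holomorphic_sev_on_const
        holomorphic_sev_on_radial_deriv_iterate f open_ball)
  have G_coeff: "slice_coeff G m z = pochhammer (\<sigma> + of_nat m) N * slice_coeff f m z" if "z \<in> \<B>" for m z
    unfolding G_def slice_coeff_radial_polynomial[OF f that] c ..
  have G_fin: "finite_Lp p (p * real N + \<alpha>) G"
    unfolding G_def
  proof (rule finite_Lp_sum[OF p], simp, intro conjI)
    fix i assume "i \<in> {..d}"
    then have i: "i \<le> N" using d by simp
    have m: "(radial_deriv ^^ i) f \<in> borel_measurable ?M"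
      by (intro measurable_holomorphic_sev holomorphic_sev_on_radial_deriv_iterate f open_ball)
    show "finite_Lp p (p * real N + \<alpha>) (\<lambda>w. c i * (radial_deriv ^^ i) f w)"
      by (rule finite_Lp_cmult[OF N0 m]) (use i in \<open>auto simp: N_def\<close>)
    show "(\<lambda>w. c i * (radial_deriv ^^ i) f w) \<in> borel_measurable ?M" using m by simp
  qed
  have int: "integrable ?M (\<lambda>w. G w * bweight 1 b w)"
  proof (rule finite_Lp_integrable_bweight[OF p G G_fin])
    have eq: "Re b - (p * real N + \<alpha>) / p = Re \<gamma> - Re lam / p"
      using p0 by (simp add: b_def \<beta>_def field_simps)
    show "p * (Re b - (p * real N + \<alpha>) / p + 1) > 1"
      unfolding eq using a p0 by (simp add: algebra_simps)
  qed
  let ?V = "bmass TYPE(complex ^ 'n) 1 b"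
  let ?P = "pochhammer \<sigma> N"
  have V: "?V \<noteq> 0" by (rule bmass_nonzero) (use b in simp)
  have P: "?P \<noteq> 0" 
  proof
    assume "?P = 0"
    then obtain j where "\<sigma> = - of_nat j" by (auto simp: pochhammer_eq_0_iff)
    then show False using nz[of j] by simp
  qed
  have nb: "of_nat CARD('n) + b + 1 = \<sigma> + of_nat N" by (simp add: b_def \<beta>_def \<sigma> add_ac)
  have pairing: "(LINT w|?M. G w * bweight 1 b w * pow_kernel \<sigma> (herm z w)) = ?V * ?P * f z" if z: "z \<in> \<B>" for z
  proof -
    have "(\<lambda>m. ?V * (pochhammer \<sigma> m / pochhammer (\<sigma> + of_nat N) m * slice_coeff G m z)) sums
       (LINT w|?M. G w * bweight 1 b w * pow_kernel \<sigma> (herm z w))"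
      using kernel_integral_sums[OF G b int z, of \<sigma>] unfolding nb .
    also have "(\<lambda>m. ?V * (pochhammer \<sigma> m / pochhammer (\<sigma> + of_nat N) m * slice_coeff G m z))
        = (\<lambda>m. ?V * ?P * slice_coeff f m z)"
    proof
      fix m
      have nz': "pochhammer (\<sigma> + of_nat N) m \<noteq> 0"
        using b unfolding nb[symmetric] by (intro pochhammer_neq_0) simp
      have "pochhammer \<sigma> m * pochhammer (\<sigma> + of_nat m) N = ?P * pochhammer (\<sigma> + of_nat N) m"
        by (simp only: pochhammer_product'[symmetric] add.commute)
      then have "pochhammer \<sigma> m / pochhammer (\<sigma> + of_nat N) m * pochhammer (\<sigma> + of_nat m) N = ?P"
        using nz' by (simp add: field_simps)
      then show "?V * (pochhammer \<sigma> m / pochhammer (\<sigma> + of_nat N) m * slice_coeff G m z) = ?V * ?P * slice_coeff f m z"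
        unfolding G_coeff[OF z] by (metis mult.assoc)
    qed
    finally have 1: "(\<lambda>m. ?V * ?P * slice_coeff f m z) sums (LINT w|?M. G w * bweight 1 b w * pow_kernel \<sigma> (herm z w))" .
    have "(\<lambda>m. ?V * ?P * slice_coeff f m z) sums (?V * ?P * f z)"
      by (intro sums_mult slice_coeff_sums[OF f z])
    from sums_unique2[OF 1 this] show ?thesis .
  qed
  \<comment> \<open>The exponent with \<open>e + \<gamma> = b\<close>, so that the density \<open>dv\<^sub>\<gamma>\<close> completes the weight of \<open>G\<close>.\<close>
  define e where "e = of_nat N + (of_real \<alpha> - lam) / of_real p"
  define g where "g = (\<lambda>w. inverse (?\<kappa> * ?V * ?P) * (G w * bweight 1 e w))"
  have g_dens: "g w * dv_density \<gamma> w = inverse (?V * ?P) * (G w * bweight 1 b w)" if "w \<in> \<B>" for w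
  proof -
    have "bweight 1 b w = bweight 1 e w * bweight 1 \<gamma> w"
      unfolding bweight_add[OF that, symmetric] by (simp add: b_def \<beta>_def e_def add_ac)
    then show ?thesis using \<kappa> by (simp add: g_def dv_density_eq)
  qed
  have Ge_m: "(\<lambda>w. G w * bweight 1 e w) \<in> borel_measurable ?M"
    by (intro measurable_continuous_ball continuous_intros continuous_on_bweight
        holomorphic_sev_on_imp_continuous_on[OF G])
  have g_m: "g \<in> borel_measurable ?M" unfolding g_def using Ge_m by simp
  have "p * Re e + Re lam = p * real N + \<alpha>" using p0 by (simp add: e_def field_simps)
  then have "finite_Lp p (Re lam) (\<lambda>w. G w * bweight 1 e w)"
    using G_fin by (simp only: finite_Lp_bweight)
  then have "finite_Lp p (Re lam) g" unfolding g_def by (rule finite_Lp_cmult[OF _ Ge_m])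
  then have g_Lp: "g \<in> Lp_ball p lam" by (simp add: Lp_ball_iff[OF g_m])
  show ?thesis
  proof (rule bexI[OF _ g_Lp], rule ballI)
    fix z :: "complex ^ 'n" assume z: "z \<in> \<B>"
    have i: "integrable ?M (\<lambda>w. inverse (?V * ?P) * (G w * bweight 1 b w * pow_kernel \<sigma> (herm z w)))"
      by (intro integrable_mult_right sums_integral_herm_power(1)[OF int z pow_kernel_sums])
    have v: "(LINT w|?M. inverse (?V * ?P) * (G w * bweight 1 b w * pow_kernel \<sigma> (herm z w))) = f z"
      unfolding integral_mult_right_zero pairing[OF z] using V P by (simp add: field_simps)
    have "has_bochner_integral ?M (\<lambda>w. inverse (?V * ?P) * (G w * bweight 1 b w * pow_kernel \<sigma> (herm z w))) (f z)"
      using i v by (simp only: has_bochner_integral_iff)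
    moreover have "inverse (?V * ?P) * (G w * bweight 1 b w * pow_kernel \<sigma> (herm z w)) = g w * dv_density \<gamma> w * pow_kernel \<sigma> (herm z w)"
      if "w \<in> space ?M" for w
      using g_dens[of w] that by (simp add: mult.assoc)
    ultimately show "has_bochner_integral ?M (\<lambda>w. g w * dv_density \<gamma> w * pow_kernel \<sigma> (herm z w)) (f z)"
      by (simp only: cong: has_bochner_integral_cong)
  qed
qed

theorem theorem30:
  fixes p \<alpha> :: real and \<gamma> lam :: complex and f :: "complex ^ 'n \<Rightarrow> complex"
  assumes "p \<ge> 1"
    and "p * (Re \<gamma> + 1) > Re lam + 1"
    and "\<nexists>m::nat. m \<ge> 1 \<and>
           of_nat CARD('n) + \<gamma> + (of_real \<alpha> - lam) / of_real p = - of_nat m"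
    and "f holomorphic_sev_on \<B>"
  shows "f \<in> bergman_space p \<alpha> \<longleftrightarrow>
    (\<exists>g \<in> Lp_ball p lam. \<forall>z \<in> \<B>.
       has_bochner_integral (lebesgue_on \<B>)
         (\<lambda>w. g w * dv_density \<gamma> w /
               (1 - herm z w) powr
                 (of_nat CARD('n) + 1 + \<gamma> + (of_real \<alpha> - lam) / of_real p))
         (f z))"
proof -
  define \<sigma> where "\<sigma> = of_nat CARD('n) + 1 + \<gamma> + (of_real \<alpha> - lam) / of_real p"
  have pow_kernel: "x / (1 - y) powr \<sigma> = x * pow_kernel \<sigma> y" for x y
    by (simp add: pow_kernel_def powr_minus divide_inverse)
  have nz: "\<sigma> + of_nat j \<noteq> 0" for j :: nat
  proof
    assume "\<sigma> + of_nat j = 0"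
    then have "of_nat CARD('n) + \<gamma> + (of_real \<alpha> - lam) / of_real p = - of_nat (Suc j)"
      by (simp add: \<sigma>_def algebra_simps eq_neg_iff_add_eq_0)
    then show False using assms(3) by (metis le_add1 plus_1_eq_Suc)
  qed
  show ?thesis
    unfolding \<sigma>_def[symmetric] pow_kernel
    using kernel_integral_of_bergman_space[OF assms(1,2,4) _ \<sigma>_def nz]
      bergman_space_of_kernel_integral[OF assms(1,2,4) _ \<sigma>_def] by blast
qed

end
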